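(* Let $H\in(\tfrac12,1)$, let $\{\xi_k\}_{k\ge 1}$ be a sequence of i.i.d. real random variables with $\mathbb{E}[\xi_k]=0$ and $\mathbb{E}[\xi_k^2]=1$, and for $n\ge 1$ and $t\in[0,1]$ define $$X_n(t)=\sum_{k=1}^{\lfloor nt\rfloor} n\left(\int_{\frac{k-1}{n}}^{\frac{k}{n}}K_H\!\left(\tfrac{\lfloor nt\rfloor}{n},u\right)du\right)\frac{\xi_k}{\sqrt n},$$ where $K_H$ is the kernel defined in the context. Then, as $n\to\infty$, the processes $\{X_n(t),\,t\in[0,1]\}$ converge weakly in the Skorohod topology (i.e. in law, as random elements of $D([0,1])$) to the sub-fractional Brownian motion $X^H=\{X^H(t),\,t\in[0,1]\}$ with index $H$, given by $X^H(t)=\int_0^t K_H(t,s)\,W(ds)$ with $W$ a standard Brownian motion.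
   Context: $\lfloor x\rfloor$ denotes the greatest integer not exceeding $x$. $D([0,1])$ is the space of real-valued right-continuous functions with left limits on $[0,1]$, with the Skorohod topology. Sub-fractional Brownian motion with index $H\in(0,1)$ is the centered Gaussian process $X^H$ with $X^H(0)=0$ and covariance $\mathbb{E}[X^H(t)X^H(s)]=s^{2H}+t^{2H}-\frac12\left[(s+t)^{2H}+|t-s|^{2H}\right]$. For $H\in(\tfrac12,1)$ the kernel is $$K_H(t,s)=\frac{C_H\sqrt{\pi}}{2^{H-1}\Gamma(H-\frac12)}\,s^{\frac32-H}\int_s^t(x^2-s^2)^{H-\frac32}\,dx\;\mathbf 1_{(0,t)}(s),\qquad s,t\in[0,1],$$ where $C_H>0$ is the normalizing constant for which $X^H(t)=\int_0^tK_H(t,s)\,W(ds)$, $t\in[0,1]$ ($W$ a standard Brownian motion, Wiener integral), is a sub-fractional Brownian motion with index $H$; equivalently, $\int_0^{1}K_H(t,u)K_H(s,u)\,du=s^{2H}+t^{2H}-\frac12[(s+t)^{2H}+|t-s|^{2H}]$ for all $s,t\in[0,1]$. (That such a $C_H$ exists is a known representation theorem.) *)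

theory Defs
  imports "HOL-Probability.Probability"
begin

section \<open>The Skorohod space on the unit interval\<close>

definition cadlag :: "(real \<Rightarrow> real) \<Rightarrow> bool" where
  "cadlag f \<longleftrightarrow>
     (\<forall>t\<in>{0..<1}. (f \<longlongrightarrow> f t) (at_right t)) \<and>
     (\<forall>t\<in>{0<..1}. \<exists>l. (f \<longlongrightarrow> l) (at_left t))"

lemma cadlag_restrict: "cadlag (restrict f {0..1}) \<longleftrightarrow> cadlag f"
proof -
  have "((restrict f {0..1} \<longlongrightarrow> f t) (at_right t)) = ((f \<longlongrightarrow> f t) (at_right t))" if "t \<in> {0..<1}" for t
    by (rule filterlim_cong[OF refl refl], rule eventually_mono[OF eventually_at_right_real[of t 1]])
       (use that in auto)
  moreover have "((restrict f {0..1} \<longlongrightarrow> l) (at_left t)) = ((f \<longlongrightarrow> l) (at_left t))" if "t \<in> {0<..1}" for t l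
    by (rule filterlim_cong[OF refl refl], rule eventually_mono[OF eventually_at_left_real[of 0 t]])
       (use that in auto)
  ultimately show ?thesis by (auto simp: cadlag_def)
qed

text \<open>A function on \<open>[0,1]\<close> is represented by its extension with the value
  \<^const>\<open>undefined\<close> outside \<open>[0,1]\<close>, so that equality is equality on \<open>[0,1]\<close>.\<close>

typedef skorohod = "{f :: real \<Rightarrow> real. f \<in> extensional {0..1} \<and> cadlag f}"
  morphisms path_of Abs_skorohod
proof
  have "cadlag (\<lambda>_. 0)" unfolding cadlag_def by (auto intro: tendsto_const)
  then show "restrict (\<lambda>_. 0) {0..1} \<in> {f :: real \<Rightarrow> real. f \<in> extensional {0..1} \<and> cadlag f}"
    by (simp add: cadlag_restrict)
qed

definition to_skorohod :: "(real \<Rightarrow> real) \<Rightarrow> skorohod" where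
  "to_skorohod f = Abs_skorohod (restrict f {0..1})"

lemma path_of_to_skorohod: "cadlag f \<Longrightarrow> path_of (to_skorohod f) = restrict f {0..1}"
  by (simp add: to_skorohod_def Abs_skorohod_inverse cadlag_restrict)

definition time_changes :: "(real \<Rightarrow> real) set" where
  "time_changes =
     {l. strict_mono_on {0..1} l \<and> continuous_on {0..1} l \<and> l ` {0..1} = {0..1}}"

definition skorohod_dist_via :: "(real \<Rightarrow> real) \<Rightarrow> skorohod \<Rightarrow> skorohod \<Rightarrow> real" where
  "skorohod_dist_via l x y =
     max (SUP t\<in>{0..1}. \<bar>l t - t\<bar>) (SUP t\<in>{0..1}. \<bar>path_of x t - path_of y (l t)\<bar>)"

lemma cadlag_bounded:
  assumes "cadlag f"
  shows "\<exists>B. \<forall>t\<in>{0..1}. \<bar>f t\<bar> \<le> B"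
proof -
  define P where "P = (\<lambda>a b. \<exists>B. \<forall>t\<in>{a..b} \<inter> {0..1}. \<bar>f t\<bar> \<le> B)"
  have "P 0 1"
    using zero_le_one
  proof (induction rule: Bolzano)
    case (trans a b c)
    from trans obtain B1 B2 where B: "\<forall>t\<in>{a..b} \<inter> {0..1}. \<bar>f t\<bar> \<le> B1"
        "\<forall>t\<in>{b..c} \<inter> {0..1}. \<bar>f t\<bar> \<le> B2"
      by (auto simp: P_def)
    have "\<bar>f t\<bar> \<le> max B1 B2" if "t \<in> {a..c} \<inter> {0..1}" for t
    proof (cases "t \<le> b")
      case True
      with B(1) that have "\<bar>f t\<bar> \<le> B1" by auto
      then show ?thesis by linarith
    next
      case False
      with B(2) that have "\<bar>f t\<bar> \<le> B2" by auto
      then show ?thesis by linarith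
    qed
    then show ?case unfolding P_def by blast
  next
    case (local x)
    have "\<exists>d>0. \<exists>B. \<forall>t. x < t \<and> t < x + d \<and> t \<le> 1 \<longrightarrow> \<bar>f t\<bar> \<le> B"
    proof (cases "x < 1")
      case True
      then have "(f \<longlongrightarrow> f x) (at_right x)" using assms local by (auto simp: cadlag_def)
      then have "\<forall>\<^sub>F t in at_right x. dist (f t) (f x) < 1" by (simp add: tendstoD)
      then obtain b where b: "b > x" "\<And>t. x < t \<Longrightarrow> t < b \<Longrightarrow> dist (f t) (f x) < 1"
        by (auto simp: eventually_at_right_field)
      show ?thesis
        by (rule exI[of _ "b - x"], rule conjI, use b in simp, rule exI[of _ "\<bar>f x\<bar> + 1"])
           (use b(2) in \<open>force simp: dist_real_def\<close>)
    next
      case False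
      then show ?thesis by (intro exI[of _ 1]) auto
    qed
    then obtain d1 B1 where 1: "d1 > 0" "\<And>t. x < t \<Longrightarrow> t < x + d1 \<Longrightarrow> t \<le> 1 \<Longrightarrow> \<bar>f t\<bar> \<le> B1" by blast
    have "\<exists>d>0. \<exists>B. \<forall>t. x - d < t \<and> t < x \<and> 0 \<le> t \<longrightarrow> \<bar>f t\<bar> \<le> B"
    proof (cases "0 < x")
      case True
      with local have "x \<in> {0<..1}" by simp
      with assms obtain l where "(f \<longlongrightarrow> l) (at_left x)" unfolding cadlag_def by blast
      then have "\<forall>\<^sub>F t in at_left x. dist (f t) l < 1" by (simp add: tendstoD)
      then obtain b where b: "b < x" "\<And>t. b < t \<Longrightarrow> t < x \<Longrightarrow> dist (f t) l < 1"
        by (auto simp: eventually_at_left_field)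
      show ?thesis
        by (rule exI[of _ "x - b"], rule conjI, use b in simp, rule exI[of _ "\<bar>l\<bar> + 1"])
           (use b(2) in \<open>force simp: dist_real_def\<close>)
    next
      case False
      then show ?thesis by (intro exI[of _ 1]) auto
    qed
    then obtain d2 B2 where 2: "d2 > 0" "\<And>t. x - d2 < t \<Longrightarrow> t < x \<Longrightarrow> 0 \<le> t \<Longrightarrow> \<bar>f t\<bar> \<le> B2" by blast
    show ?case
    proof (intro exI[of _ "min d1 d2"] conjI allI impI)
      show "min d1 d2 > 0" using 1 2 by simp
      fix a b assume ab: "a \<le> x \<and> x \<le> b \<and> b - a < min d1 d2"
      have "\<bar>f t\<bar> \<le> max \<bar>f x\<bar> (max B1 B2)" if t: "t \<in> {a..b} \<inter> {0..1}" for t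
      proof -
        consider "t = x" | "x < t" | "t < x" by linarith
        then show ?thesis
        proof cases
          case 2
          with 1(2)[of t] t ab have "\<bar>f t\<bar> \<le> B1" by auto
          then show ?thesis by linarith
        next
          case 3
          with 2(2)[of t] t ab have "\<bar>f t\<bar> \<le> B2" by auto
          then show ?thesis by linarith
        qed simp
      qed
      then show "P a b" unfolding P_def by blast
    qed
  qed
  then show ?thesis by (auto simp: P_def)
qed

lemma cadlag_path_of: "cadlag (path_of x)" and path_of_extensional: "path_of x \<in> extensional {0..1}"
  using path_of[of x] by auto

lemma time_changesD:
  assumes "l \<in> time_changes"
  shows "\<And>t. t \<in> {0..1} \<Longrightarrow> l t \<in> {0..1}"
    and "\<And>s. s \<in> {0..1} \<Longrightarrow> \<exists>t\<in>{0..1}. l t = s"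
proof -
  have im: "l ` {0..1} = {0..1}" using assms by (simp add: time_changes_def)
  show "l t \<in> {0..1}" if "t \<in> {0..1}" for t using im that by blast
  show "\<exists>t\<in>{0..1}. l t = s" if "s \<in> {0..1}" for s using im that by (metis imageE)
qed

lemma id_time_change: "(\<lambda>t. t) \<in> time_changes"
  by (auto simp: time_changes_def strict_mono_on_def)

lemma comp_time_change:
  assumes "k \<in> time_changes" "l \<in> time_changes"
  shows "k \<circ> l \<in> time_changes"
proof -
  have "strict_mono_on {0..1} (k \<circ> l)"
  proof (rule strict_mono_onI)
    fix r s :: real assume rs: "r \<in> {0..1}" "s \<in> {0..1}" "r < s"
    have "l r < l s"
      using assms(2) rs by (auto simp: time_changes_def strict_mono_on_def)
    then show "(k \<circ> l) r < (k \<circ> l) s"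
      using assms(1) time_changesD(1)[OF assms(2) rs(1)] time_changesD(1)[OF assms(2) rs(2)]
      by (auto simp: time_changes_def strict_mono_on_def)
  qed
  moreover have "continuous_on {0..1} (k \<circ> l)"
    using assms by (intro continuous_on_compose) (auto simp: time_changes_def)
  moreover have "(k \<circ> l) ` {0..1} = {0..1}"
    using assms by (metis (mono_tags, lifting) image_comp mem_Collect_eq time_changes_def)
  ultimately show ?thesis by (simp add: time_changes_def)
qed

lemma inv_time_change:
  assumes "l \<in> time_changes"
  obtains k where "k \<in> time_changes" "\<And>t. t \<in> {0..1} \<Longrightarrow> l (k t) = t"
proof
  have sm: "strict_mono_on {0..1} l" and c: "continuous_on {0..1} l" and im: "l ` {0..1} = {0..1}"
    using assms by (auto simp: time_changes_def)
  have inj: "inj_on l {0..1}" by (rule strict_mono_on_imp_inj_on[OF sm])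
  let ?k = "the_inv_into {0..1} l"
  show lk: "l (?k t) = t" if "t \<in> {0..1}" for t
    using that im by (simp add: f_the_inv_into_f[OF inj])
  have kin: "?k t \<in> {0..1}" if "t \<in> {0..1}" for t
    using that im by (simp only: the_inv_into_into[OF inj _ order_refl])
  have "strict_mono_on {0..1} ?k"
  proof (rule strict_mono_onI)
    fix r s :: real assume rs: "r \<in> {0..1}" "s \<in> {0..1}" "r < s"
    show "?k r < ?k s"
    proof (rule ccontr)
      assume "\<not> ?k r < ?k s"
      then have "l (?k s) \<le> l (?k r)"
        using strict_mono_on_leD[OF sm kin[OF rs(2)] kin[OF rs(1)]] by simp
      with rs lk show False by simp
    qed
  qed
  moreover have "continuous_on {0..1} ?k"
    using continuous_on_inv_into[OF c compact_Icc inj] im by simp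
  moreover have "?k ` {0..1} = {0..1}"
    using the_inv_into_onto[OF inj] im by simp
  ultimately show "?k \<in> time_changes" by (simp add: time_changes_def)
qed

lemma skorohod_dist_via_le_iff:
  assumes l: "l \<in> time_changes"
  shows "skorohod_dist_via l x y \<le> e \<longleftrightarrow>
    (\<forall>t\<in>{0..1}. \<bar>l t - t\<bar> \<le> e \<and> \<bar>path_of x t - path_of y (l t)\<bar> \<le> e)"
proof -
  obtain B1 B2 where B: "\<forall>t\<in>{0..1}. \<bar>path_of x t\<bar> \<le> B1" "\<forall>t\<in>{0..1}. \<bar>path_of y t\<bar> \<le> B2"
    using cadlag_bounded cadlag_path_of by metis
  have 1: "bdd_above ((\<lambda>t. \<bar>l t - t\<bar>) ` {0..1})"
    by (rule bdd_aboveI2[of _ _ 1]) (use time_changesD(1)[OF l] in \<open>force simp: abs_le_iff\<close>)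
  have 2: "bdd_above ((\<lambda>t. \<bar>path_of x t - path_of y (l t)\<bar>) ` {0..1})"
  proof (rule bdd_aboveI2[of _ _ "B1 + B2"])
    fix t :: real assume t: "t \<in> {0..1}"
    show "\<bar>path_of x t - path_of y (l t)\<bar> \<le> B1 + B2"
      using B(1)[rule_format, OF t] B(2)[rule_format, OF time_changesD(1)[OF l t]] by linarith
  qed
  show ?thesis
    unfolding skorohod_dist_via_def using 1 2 by (auto simp: cSUP_le_iff)
qed

lemma skorohod_dist_via_nonneg: "l \<in> time_changes \<Longrightarrow> 0 \<le> skorohod_dist_via l x y"
  using skorohod_dist_via_le_iff[of l x y "skorohod_dist_via l x y"] by force

text \<open>The metric \<open>d\<close> of Billingsley's book; it induces Skorohod's \<open>J\<^sub>1\<close> topology.\<close>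

instantiation skorohod :: metric_space
begin

definition dist_skorohod :: "skorohod \<Rightarrow> skorohod \<Rightarrow> real" where
  "dist_skorohod x y = (INF l\<in>time_changes. skorohod_dist_via l x y)"

definition uniformity_skorohod :: "(skorohod \<times> skorohod) filter" where
  "uniformity_skorohod = (INF e\<in>{0<..}. principal {(x, y). dist x y < e})"

definition open_skorohod :: "skorohod set \<Rightarrow> bool" where
  "open_skorohod U = (\<forall>x\<in>U. \<forall>\<^sub>F (x', y) in uniformity. x' = x \<longrightarrow> y \<in> U)"

lemma skorohod_dist_less:
  fixes x y :: skorohod
  assumes "dist x y < e"
  obtains l where "l \<in> time_changes"
    "\<And>t. t \<in> {0..1} \<Longrightarrow> \<bar>l t - t\<bar> < e \<and> \<bar>path_of x t - path_of y (l t)\<bar> < e"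
proof -
  have "\<exists>l\<in>time_changes. skorohod_dist_via l x y < e"
    using assms id_time_change unfolding dist_skorohod_def
    by (subst (asm) cINF_less_iff)
       (auto intro!: bdd_belowI2[of _ 0] simp: skorohod_dist_via_nonneg)
  then obtain l where l: "l \<in> time_changes" "skorohod_dist_via l x y < e" by blast
  with skorohod_dist_via_le_iff[of l x y "skorohod_dist_via l x y"] show ?thesis
    by (intro that[of l]) force+
qed

lemma skorohod_dist_le:
  fixes x y :: skorohod
  assumes "l \<in> time_changes"
    and "\<And>t. t \<in> {0..1} \<Longrightarrow> \<bar>l t - t\<bar> \<le> e \<and> \<bar>path_of x t - path_of y (l t)\<bar> \<le> e"
  shows "dist x y \<le> e"
proof -
  have "dist x y \<le> skorohod_dist_via l x y"
    unfolding dist_skorohod_def using assms(1)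
    by (intro cINF_lower bdd_belowI2[of _ 0]) (auto simp: skorohod_dist_via_nonneg)
  also have "\<dots> \<le> e" using assms by (simp add: skorohod_dist_via_le_iff)
  finally show ?thesis .
qed

lemma skorohod_dist_commute_le:
  fixes x y :: skorohod
  shows "dist y x \<le> dist x y"
proof (rule field_le_epsilon)
  fix e :: real assume "e > 0"
  then have "dist x y < dist x y + e" by simp
  then obtain l where l: "l \<in> time_changes"
    "\<And>t. t \<in> {0..1} \<Longrightarrow> \<bar>l t - t\<bar> < dist x y + e \<and> \<bar>path_of x t - path_of y (l t)\<bar> < dist x y + e"
    by (rule skorohod_dist_less) blast
  from inv_time_change[OF l(1)] obtain k
    where k: "k \<in> time_changes" "\<And>t. t \<in> {0..1} \<Longrightarrow> l (k t) = t" by blast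
  show "dist y x \<le> dist x y + e"
  proof (rule skorohod_dist_le[OF k(1)])
    fix t :: real assume t: "t \<in> {0..1}"
    show "\<bar>k t - t\<bar> \<le> dist x y + e \<and> \<bar>path_of y t - path_of x (k t)\<bar> \<le> dist x y + e"
      using l(2)[OF time_changesD(1)[OF k(1) t]] k(2)[OF t] by (auto simp: abs_minus_commute)
  qed
qed

lemma skorohod_dist_triangle:
  fixes x y z :: skorohod
  shows "dist x z \<le> dist x y + dist y z"
proof (rule field_le_epsilon)
  fix e :: real assume "e > 0"
  then have "dist x y < dist x y + e / 2" "dist y z < dist y z + e / 2" by simp_all
  then obtain k l where k: "k \<in> time_changes"
      "\<And>t. t \<in> {0..1} \<Longrightarrow> \<bar>k t - t\<bar> < dist x y + e / 2 \<and> \<bar>path_of x t - path_of y (k t)\<bar> < dist x y + e / 2"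
    and l: "l \<in> time_changes"
      "\<And>t. t \<in> {0..1} \<Longrightarrow> \<bar>l t - t\<bar> < dist y z + e / 2 \<and> \<bar>path_of y t - path_of z (l t)\<bar> < dist y z + e / 2"
    by (metis skorohod_dist_less)
  show "dist x z \<le> dist x y + dist y z + e"
  proof (rule skorohod_dist_le[OF comp_time_change[OF l(1) k(1)]])
    fix t :: real assume t: "t \<in> {0..1}"
    have 1: "\<bar>k t - t\<bar> < dist x y + e / 2" "\<bar>path_of x t - path_of y (k t)\<bar> < dist x y + e / 2"
      using k(2)[OF t] by auto
    have 2: "\<bar>l (k t) - k t\<bar> < dist y z + e / 2"
      "\<bar>path_of y (k t) - path_of z (l (k t))\<bar> < dist y z + e / 2"
      using l(2)[OF time_changesD(1)[OF k(1) t]] by auto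
    show "\<bar>(l \<circ> k) t - t\<bar> \<le> dist x y + dist y z + e \<and>
        \<bar>path_of x t - path_of z ((l \<circ> k) t)\<bar> \<le> dist x y + dist y z + e"
      unfolding o_def by (intro conjI; insert 1 2; linarith)
  qed
qed

lemma skorohod_dist_eq_0D:
  fixes x y :: skorohod
  assumes "dist x y = 0"
  shows "x = y"
proof -
  have "path_of x t = path_of y t" if "0 \<le> t" "t \<le> 1" for t
  proof -
    have "\<bar>path_of x t - path_of y t\<bar> \<le> e" if "e > 0" for e
    proof (cases "t = 1")
      case True
      obtain l where l: "l \<in> time_changes"
        "\<And>t. t \<in> {0..1} \<Longrightarrow> \<bar>l t - t\<bar> < e \<and> \<bar>path_of x t - path_of y (l t)\<bar> < e"
        using skorohod_dist_less[of x y e] assms \<open>e > 0\<close> by auto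
      obtain s where s: "s \<in> {0..1}" "l s = 1" using time_changesD(2)[OF l(1), of 1] by auto
      have "strict_mono_on {0..1} l" using l(1) by (simp add: time_changes_def)
      from strict_mono_on_leD[OF this s(1), of 1] s have "1 \<le> l 1" by auto
      with time_changesD(1)[OF l(1), of 1] have "l 1 = 1" by auto
      with l(2)[of 1] True show ?thesis by auto
    next
      case False
      with \<open>0 \<le> t\<close> \<open>t \<le> 1\<close> have t: "0 \<le> t" "t < 1" by auto
      have "(path_of x \<longlongrightarrow> path_of x t) (at_right t)" "(path_of y \<longlongrightarrow> path_of y t) (at_right t)"
        using cadlag_path_of[of x] cadlag_path_of[of y] t by (auto simp: cadlag_def)
      then have "\<forall>\<^sub>F u in at_right t. dist (path_of x u) (path_of x t) < e / 3"
        "\<forall>\<^sub>F u in at_right t. dist (path_of y u) (path_of y t) < e / 3"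
        using \<open>e > 0\<close> by (auto simp del: less_divide_eq_numeral1 intro!: tendstoD)
      then have "\<forall>\<^sub>F u in at_right t. u < 1 \<and> dist (path_of x u) (path_of x t) < e / 3 \<and>
          dist (path_of y u) (path_of y t) < e / 3"
        using eventually_at_right_real[OF t(2)] by eventually_elim auto
      then obtain b where b: "b > t"
        "\<And>u. t < u \<Longrightarrow> u < b \<Longrightarrow> u < 1 \<and> dist (path_of x u) (path_of x t) < e / 3 \<and>
          dist (path_of y u) (path_of y t) < e / 3"
        by (auto simp: eventually_at_right_field)
      define s where "s = (t + b) / 2"
      define d where "d = min (e / 3) ((b - t) / 2)"
      have s: "t < s" "s < b" "s - d \<ge> t" "s + d \<le> b" and d: "d > 0" "d \<le> e / 3"
        using b(1) \<open>e > 0\<close> by (auto simp: s_def d_def min_def field_simps)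
      have s1: "s \<in> {0..1}" using b(2)[of s] s t by auto
      obtain l where l: "l \<in> time_changes"
        "\<And>t. t \<in> {0..1} \<Longrightarrow> \<bar>l t - t\<bar> < d \<and> \<bar>path_of x t - path_of y (l t)\<bar> < d"
        using skorohod_dist_less[of x y d] assms d(1) by auto
      have ls: "t < l s" "l s < b" using l(2)[OF s1] s by (auto simp: abs_less_iff)
      show ?thesis
        using l(2)[OF s1] b(2)[OF s(1,2)] b(2)[OF ls] d unfolding dist_real_def by linarith
    qed
    then have "\<bar>path_of x t - path_of y t\<bar> \<le> 0" by (rule field_le_epsilon) simp
    then show ?thesis by simp
  qed
  then have "path_of x = path_of y"
    by (intro extensionalityI[OF path_of_extensional path_of_extensional]) auto
  then show ?thesis by (simp add: path_of_inject)
qed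

instance
proof
  fix x y z :: skorohod
  have commute: "dist u v = dist v u" for u v :: skorohod
    using skorohod_dist_commute_le[of u v] skorohod_dist_commute_le[of v u] by simp
  have "dist x x \<le> 0" by (rule skorohod_dist_le[OF id_time_change]) simp
  moreover have "0 \<le> dist x y" for y
    unfolding dist_skorohod_def using id_time_change
    by (intro cINF_greatest) (auto simp: skorohod_dist_via_nonneg)
  ultimately have "dist x x = 0" by (metis order_antisym)
  then show "dist x y = 0 \<longleftrightarrow> x = y" using skorohod_dist_eq_0D by blast
  show "dist x y \<le> dist x z + dist y z"
    using skorohod_dist_triangle[of x y z] commute[of z y] by simp
qed (simp_all add: uniformity_skorohod_def open_skorohod_def)

end


section \<open>Weak convergence\<close>

definition weakly_converges ::
    "(nat \<Rightarrow> 'a :: topological_space measure) \<Rightarrow> 'a measure \<Rightarrow> bool" where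
  "weakly_converges \<mu> \<nu> \<longleftrightarrow>
     (\<forall>f :: 'a \<Rightarrow> real. continuous_on UNIV f \<and> bounded (range f) \<longrightarrow>
        (\<lambda>n. integral\<^sup>L (\<mu> n) f) \<longlonglongrightarrow> integral\<^sup>L \<nu> f)"

definition sample_path :: "(real \<Rightarrow> 'a \<Rightarrow> real) \<Rightarrow> 'a \<Rightarrow> skorohod" where
  "sample_path X \<omega> = to_skorohod (\<lambda>t. X t \<omega>)"

text \<open>The requirement on the paths is needed because \<^const>\<open>to_skorohod\<close> is unspecified on
  functions that are not cadlag. Note that \<^const>\<open>cadlag\<close> only concerns values on \<open>[0,1]\<close>.\<close>

definition skorohod_random_element :: "'a measure \<Rightarrow> (real \<Rightarrow> 'a \<Rightarrow> real) \<Rightarrow> bool" where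
  "skorohod_random_element M X \<longleftrightarrow>
     (\<forall>\<omega>\<in>space M. cadlag (\<lambda>t. X t \<omega>)) \<and> sample_path X \<in> borel_measurable M"

definition converges_in_law_skorohod ::
    "'a measure \<Rightarrow> (nat \<Rightarrow> real \<Rightarrow> 'a \<Rightarrow> real) \<Rightarrow> 'b measure \<Rightarrow> (real \<Rightarrow> 'b \<Rightarrow> real) \<Rightarrow> bool" where
  "converges_in_law_skorohod M X N Y \<longleftrightarrow>
     (\<forall>n. skorohod_random_element M (X n)) \<and> skorohod_random_element N Y \<and>
     weakly_converges (\<lambda>n. distr M borel (sample_path (X n))) (distr N borel (sample_path Y))"


section \<open>Brownian motion and the Wiener integral\<close>

text \<open>Only the time set \<open>[0,1]\<close> is considered.\<close>

definition standard_brownian_motion :: "'b measure \<Rightarrow> (real \<Rightarrow> 'b \<Rightarrow> real) \<Rightarrow> bool" where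
  "standard_brownian_motion N W \<longleftrightarrow>
     (\<forall>t\<in>{0..1}. W t \<in> borel_measurable N) \<and>
     (AE \<omega> in N. W 0 \<omega> = 0) \<and>
     (\<forall>s t. 0 \<le> s \<and> s < t \<and> t \<le> 1 \<longrightarrow>
        distributed N lborel (\<lambda>\<omega>. W t \<omega> - W s \<omega>) (normal_density 0 (sqrt (t - s)))) \<and>
     (\<forall>m (p :: nat \<Rightarrow> real). mono_on {..m} p \<and> p ` {..m} \<subseteq> {0..1} \<longrightarrow>
        prob_space.indep_vars N (\<lambda>_. borel) (\<lambda>i \<omega>. W (p (Suc i)) \<omega> - W (p i) \<omega>) {..<m}) \<and>
     (AE \<omega> in N. continuous_on {0..1} (\<lambda>t. W t \<omega>))"

definition step_fun :: "nat \<Rightarrow> (nat \<Rightarrow> real) \<Rightarrow> (nat \<Rightarrow> real) \<Rightarrow> real \<Rightarrow> real" where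
  "step_fun m p a u = (\<Sum>i<m. a i * indicator {p i<..p (Suc i)} u)"

definition step_integral ::
    "(real \<Rightarrow> 'b \<Rightarrow> real) \<Rightarrow> nat \<Rightarrow> (nat \<Rightarrow> real) \<Rightarrow> (nat \<Rightarrow> real) \<Rightarrow> 'b \<Rightarrow> real" where
  "step_integral W m p a \<omega> = (\<Sum>i<m. a i * (W (p (Suc i)) \<omega> - W (p i) \<omega>))"

text \<open>\<open>Z\<close> is (a version of) the Wiener integral of \<open>f\<close> over \<open>[0,T]\<close> with respect to \<open>W\<close>: the
  \<open>L\<^sup>2\<close>-limit of the integrals of step functions converging to \<open>f\<close> in \<open>L\<^sup>2([0,T])\<close>.
  It is a relation because the integral is determined only up to almost sure equality. The
  nonnegative integral makes the convergences meaningful without prior integrability.\<close>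

definition has_wiener_integral ::
    "'b measure \<Rightarrow> (real \<Rightarrow> 'b \<Rightarrow> real) \<Rightarrow> real \<Rightarrow> (real \<Rightarrow> real) \<Rightarrow> ('b \<Rightarrow> real) \<Rightarrow> bool" where
  "has_wiener_integral N W T f Z \<longleftrightarrow>
     set_borel_measurable lborel {0..T} f \<and>
     set_integrable lborel {0..T} (\<lambda>u. (f u)\<^sup>2) \<and>
     Z \<in> borel_measurable N \<and>
     (\<exists>(m :: nat \<Rightarrow> nat) p a.
        (\<forall>j. mono_on {..m j} (p j) \<and> p j ` {..m j} \<subseteq> {0..T}) \<and>
        (\<lambda>j. \<integral>\<^sup>+u\<in>{0..T}. ennreal ((step_fun (m j) (p j) (a j) u - f u)\<^sup>2) \<partial>lborel) \<longlonglongrightarrow> 0 \<and>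
        (\<lambda>j. \<integral>\<^sup>+\<omega>. ennreal ((step_integral W (m j) (p j) (a j) \<omega> - Z \<omega>)\<^sup>2) \<partial>N) \<longlonglongrightarrow> 0)"


section \<open>Sub-fractional Brownian motion\<close>

definition gaussian_rv :: "'b measure \<Rightarrow> ('b \<Rightarrow> real) \<Rightarrow> bool" where
  "gaussian_rv N Y \<longleftrightarrow>
     Y \<in> borel_measurable N \<and>
     (\<exists>\<mu> \<sigma>. \<sigma> \<ge> 0 \<and> (if \<sigma> = 0 then (AE \<omega> in N. Y \<omega> = \<mu>)
                      else distributed N lborel Y (normal_density \<mu> \<sigma>)))"

definition gaussian_process :: "'b measure \<Rightarrow> real set \<Rightarrow> (real \<Rightarrow> 'b \<Rightarrow> real) \<Rightarrow> bool" where
  "gaussian_process N I X \<longleftrightarrow>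
     (\<forall>J c. finite J \<and> J \<subseteq> I \<longrightarrow> gaussian_rv N (\<lambda>\<omega>. \<Sum>t\<in>J. c t * X t \<omega>))"

definition subfbm_cov :: "real \<Rightarrow> real \<Rightarrow> real \<Rightarrow> real" where
  "subfbm_cov H s t =
     s powr (2 * H) + t powr (2 * H) - 1/2 * ((s + t) powr (2 * H) + \<bar>t - s\<bar> powr (2 * H))"

definition subfractional_brownian_motion ::
    "'b measure \<Rightarrow> real \<Rightarrow> (real \<Rightarrow> 'b \<Rightarrow> real) \<Rightarrow> bool" where
  "subfractional_brownian_motion N H X \<longleftrightarrow>
     gaussian_process N {0..1} X \<and>
     (AE \<omega> in N. X 0 \<omega> = 0) \<and>
     (\<forall>t\<in>{0..1}. has_bochner_integral N (X t) 0) \<and>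
     (\<forall>s\<in>{0..1}. \<forall>t\<in>{0..1}. has_bochner_integral N (\<lambda>\<omega>. X t \<omega> * X s \<omega>) (subfbm_cov H s t))"

text \<open>The kernel \<open>K\<^sub>H(t,s)\<close>, with the constant \<open>C\<^sub>H\<close> as a parameter.\<close>

definition subfbm_kernel :: "real \<Rightarrow> real \<Rightarrow> real \<Rightarrow> real \<Rightarrow> real" where
  "subfbm_kernel H C t s =
     C * sqrt pi / (2 powr (H - 1) * Gamma (H - 1/2)) * s powr (3/2 - H)
       * (LBINT x:{s..t}. (x\<^sup>2 - s\<^sup>2) powr (H - 3/2)) * indicator {0<..<t} s"

definition subfbm_normalizing :: "real \<Rightarrow> real \<Rightarrow> bool" where
  "subfbm_normalizing H C \<longleftrightarrow>
     C > 0 \<and>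
     (\<forall>s\<in>{0..1}. \<forall>t\<in>{0..1}.
        set_integrable lborel {0..1} (\<lambda>u. subfbm_kernel H C t u * subfbm_kernel H C s u) \<and>
        (LBINT u:{0..1}. subfbm_kernel H C t u * subfbm_kernel H C s u) = subfbm_cov H s t)"

definition subfbm_approx ::
    "real \<Rightarrow> real \<Rightarrow> (nat \<Rightarrow> 'a \<Rightarrow> real) \<Rightarrow> nat \<Rightarrow> real \<Rightarrow> 'a \<Rightarrow> real" where
  "subfbm_approx H C \<xi> n t \<omega> =
     (\<Sum>k = 1..nat \<lfloor>real n * t\<rfloor>.
        real n * (LBINT u:{(real k - 1) / real n..real k / real n}.
                    subfbm_kernel H C (real_of_int \<lfloor>real n * t\<rfloor> / real n) u)
          * (\<xi> k \<omega> / sqrt (real n)))"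

end

theory Submission
  imports Defs
begin

text \<open>
  Write \<open>K\<^sub>t\<close> for the kernel \<open>K\<^sub>H(t,\<cdot>)\<close>. It vanishes outside \<open>(0,t)\<close>, and by the
  normalization the inner products of the \<open>K\<^sub>t\<close> in \<open>L\<^sup>2\<close> are the covariances of sub-fractional Brownian motion. Convexity
  of \<open>x powr (2H)\<close> turns this into \<open>\<parallel>K\<^sub>t - K\<^sub>s\<parallel>\<^sup>2 \<le> \<bar>t - s\<bar> powr (2H)\<close>, whose exponent \<open>p = 2H\<close> exceeds 1. These
  facts are all that the proof takes from the kernel.

  The Wiener integral is an isometry, and integrals of step functions are linear combinations of
  independent normal increments. Passing to \<open>L\<^sup>2\<close> limits, the process \<open>X\<close> is Gaussian and centred, with the
  inner products of the \<open>K\<^sub>t\<close> as covariance. Likewise the value of the approximation at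
  \<open>j/n\<close> is the image of the kernel \<open>K\<close> at time \<open>j/n\<close> under a linear contraction from \<open>L\<^sup>2\<close> of Lebesgue measure
  into \<open>L\<^sup>2\<close> of the innovations (Bessel's inequality). Hence both processes have increments whose
  second moments are at most \<open>\<bar>t - s\<bar> powr p\<close>.

  Weak convergence needs to be tested only on bounded Lipschitz functions \<open>f\<close>
  (\<open>weakly_converges_if_lipschitz\<close>), and for these it follows from three comparisons.

  \<^item> Because \<open>p > 1\<close>, dyadic chaining with second moments alone bounds the mean square uniform distance between
    a path and the step path through its values at \<open>i/m\<close>, by a quantity that tends to 0 as
    \<open>m\<close> grows, uniformly in \<open>n\<close> (\<open>grid_process_modulus\<close>, \<open>cadlag_process_modulus\<close>).
  \<^item> For fixed \<open>m\<close>, the finitely many kernels \<open>K\<^sub>t\<close>, \<open>t = i/m\<close>, are within \<open>\<epsilon>\<close> in \<open>L\<^sup>2\<close> of step functions on one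
    grid of mesh \<open>1/q\<close>. Up to \<open>O(\<epsilon>)\<close> this replaces both vectors, of the approximation
    and of the limit, by the same linear image of \<open>q\<close> independent quantities: the normalized sums of the
    innovations over \<open>q\<close> consecutive blocks, and the increments of \<open>W\<close> over the grid.
  \<^item> The block sums converge in law to these increments (\<open>block_sums_converge\<close>): the one-dimensional central
    limit theorem together with Skorohod's representation gives an almost surely convergent copy of one
    block, and \<open>q\<close> independent copies of it live on a product space.
\<close>

section \<open>Square-integrable functions\<close>

definition sq_integrable :: "'a measure \<Rightarrow> ('a \<Rightarrow> real) \<Rightarrow> bool" where
  "sq_integrable M f \<longleftrightarrow> f \<in> borel_measurable M \<and> integrable M (\<lambda>x. (f x)\<^sup>2)"

definition sq_norm :: "'a measure \<Rightarrow> ('a \<Rightarrow> real) \<Rightarrow> real" where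
  "sq_norm M f = (\<integral>x. (f x)\<^sup>2 \<partial>M)"

lemma sq_integrableD:
  assumes "sq_integrable M f"
  shows "f \<in> borel_measurable M" "integrable M (\<lambda>x. (f x)\<^sup>2)"
  using assms by (auto simp: sq_integrable_def)

lemma sq_norm_nonneg: "0 \<le> sq_norm M f"
  by (simp add: sq_norm_def)

lemma sq_integrable_mult:
  assumes "sq_integrable M f" "sq_integrable M g"
  shows "integrable M (\<lambda>x. f x * g x)"
proof (rule Bochner_Integration.integrable_bound)
  show "integrable M (\<lambda>x. (f x)\<^sup>2 + (g x)\<^sup>2)" "(\<lambda>x. f x * g x) \<in> borel_measurable M"
    using assms by (auto simp: sq_integrable_def)
  have "\<bar>a * b\<bar> \<le> a\<^sup>2 + b\<^sup>2" for a b :: real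
    using sum_squares_bound[of "\<bar>a\<bar>" "\<bar>b\<bar>"] zero_le_power2[of a] zero_le_power2[of b]
    by (simp only: abs_mult power2_abs)
  note * = this
  show "AE x in M. norm (f x * g x) \<le> norm ((f x)\<^sup>2 + (g x)\<^sup>2)"
  proof (rule AE_I2)
    show "norm (f x * g x) \<le> norm ((f x)\<^sup>2 + (g x)\<^sup>2)" for x
      using *[of "f x" "g x"] unfolding real_norm_def by linarith
  qed
qed

lemma sq_integrable_cmult: "sq_integrable M f \<Longrightarrow> sq_integrable M (\<lambda>x. c * f x)"
  by (auto simp: sq_integrable_def power_mult_distrib)

lemma sq_integrable_add:
  assumes "sq_integrable M f" "sq_integrable M g"
  shows "sq_integrable M (\<lambda>x. f x + g x)"
  unfolding sq_integrable_def power2_sum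
  using assms sq_integrable_mult[OF assms] by (auto simp: sq_integrable_def mult.assoc)

lemma sq_integrable_diff:
  assumes "sq_integrable M f" "sq_integrable M g"
  shows "sq_integrable M (\<lambda>x. f x - g x)"
  using sq_integrable_add[OF assms(1) sq_integrable_cmult[OF assms(2), of "-1"]] by simp

lemma sq_integrable_sum:
  assumes "\<And>i. i \<in> I \<Longrightarrow> sq_integrable M (f i)"
  shows "sq_integrable M (\<lambda>x. \<Sum>i\<in>I. f i x)"
  using assms
  by (induction I rule: infinite_finite_induct)
     (auto intro: sq_integrable_add, auto simp: sq_integrable_def)

lemma sq_norm_cmult: "sq_norm M (\<lambda>x. c * f x) = c\<^sup>2 * sq_norm M f"
  by (simp add: sq_norm_def power_mult_distrib)

lemma sq_norm_minus_commute: "sq_norm M (\<lambda>x. f x - g x) = sq_norm M (\<lambda>x. g x - f x)"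
  by (simp add: sq_norm_def power2_commute)

lemma sq_norm_sum_le:
  assumes "finite I" "\<And>i. i \<in> I \<Longrightarrow> sq_integrable M (f i)"
  shows "sq_norm M (\<lambda>x. \<Sum>i\<in>I. f i x) \<le> card I * (\<Sum>i\<in>I. sq_norm M (f i))"
proof -
  have int: "integrable M (\<lambda>x. (f i x)\<^sup>2)" if "i \<in> I" for i
    using assms(2)[OF that] by (rule sq_integrableD)
  have "sq_norm M (\<lambda>x. \<Sum>i\<in>I. f i x) \<le> (\<integral>x. (\<Sum>i\<in>I. (f i x)\<^sup>2) * card I \<partial>M)"
    unfolding sq_norm_def
  proof (rule integral_mono)
    show "integrable M (\<lambda>x. (\<Sum>i\<in>I. f i x)\<^sup>2)"
      using sq_integrable_sum[of I M f] assms(2) by (simp add: sq_integrable_def)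
    show "integrable M (\<lambda>x. (\<Sum>i\<in>I. (f i x)\<^sup>2) * real (card I))" using int by auto
  qed (rule sum_squared_le_sum_of_squares)
  also have "\<dots> = card I * (\<Sum>i\<in>I. sq_norm M (f i))"
    using int by (simp add: sq_norm_def)
  finally show ?thesis .
qed

lemma sq_norm_add_le:
  assumes "sq_integrable M f" "sq_integrable M g"
  shows "sq_norm M (\<lambda>x. f x + g x) \<le> 2 * sq_norm M f + 2 * sq_norm M g"
  using sq_norm_sum_le[of "UNIV :: bool set" M "\<lambda>b. if b then f else g"] assms
  by (simp add: UNIV_bool algebra_simps)

lemma sq_norm_triangle:
  assumes "sq_integrable M f" "sq_integrable M g" "sq_integrable M h"
  shows "sq_norm M (\<lambda>x. f x - h x)
    \<le> 2 * sq_norm M (\<lambda>x. f x - g x) + 2 * sq_norm M (\<lambda>x. g x - h x)"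
  using sq_norm_add_le[OF sq_integrable_diff[OF assms(1,2)] sq_integrable_diff[OF assms(2,3)]]
  by simp

text \<open>Young's inequality with a free parameter \<open>d\<close>. It stands in for the Cauchy--Schwarz inequality
  in the \<open>L\<^sup>2\<close> limits below: choosing \<open>d\<close> first and then making the second square small is all that a limit argument needs.\<close>

lemma integral_mult_abs_le:
  assumes "sq_integrable M f" "sq_integrable M g" "0 < d"
  shows "\<bar>\<integral>x. f x * g x \<partial>M\<bar> \<le> d * sq_norm M f + sq_norm M g / d"
proof -
  have i: "integrable M (\<lambda>x. f x * g x)" by (rule sq_integrable_mult[OF assms(1,2)])
  have "\<bar>\<integral>x. f x * g x \<partial>M\<bar> \<le> (\<integral>x. \<bar>f x * g x\<bar> \<partial>M)" by (rule integral_abs_bound)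
  also have "\<dots> \<le> (\<integral>x. d * (f x)\<^sup>2 + (g x)\<^sup>2 / d \<partial>M)"
  proof (rule integral_mono)
    show "integrable M (\<lambda>x. \<bar>f x * g x\<bar>)" using i by auto
    show "integrable M (\<lambda>x. d * (f x)\<^sup>2 + (g x)\<^sup>2 / d)"
      using assms by (auto simp: sq_integrable_def)
    fix x
    define a b where "a = sqrt d * \<bar>f x\<bar>" and "b = \<bar>g x\<bar> / sqrt d"
    have ab: "a * b = \<bar>f x * g x\<bar>" "a\<^sup>2 = d * (f x)\<^sup>2" "b\<^sup>2 = (g x)\<^sup>2 / d"
      using assms(3) by (simp_all add: a_def b_def abs_mult power_mult_distrib power_divide)
    show "\<bar>f x * g x\<bar> \<le> d * (f x)\<^sup>2 + (g x)\<^sup>2 / d"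
      using sum_squares_bound[of a b] zero_le_power2[of a] zero_le_power2[of b]
      unfolding ab[symmetric] by linarith
  qed
  also have "\<dots> = d * sq_norm M f + sq_norm M g / d"
    using assms by (simp add: sq_norm_def sq_integrable_def)
  finally show ?thesis .
qed

lemma (in prob_space) integral_abs_le_sq_norm:
  assumes "sq_integrable M f" "0 < d"
  shows "(\<integral>x. \<bar>f x\<bar> \<partial>M) \<le> d + sq_norm M f / d"
proof -
  have "sq_integrable M (\<lambda>_. 1)" "sq_integrable M (\<lambda>x. \<bar>f x\<bar>)"
    using assms(1) by (auto simp: sq_integrable_def)
  from integral_mult_abs_le[OF this assms(2)] show ?thesis
    by (simp add: sq_norm_def prob_space)
qed

lemma sq_norm_diff_le:
  assumes "sq_integrable M f" "sq_integrable M g" "0 < d"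
  shows "\<bar>sq_norm M f - sq_norm M g\<bar>
    \<le> 2 * d * sq_norm M g + (1 + 2 / d) * sq_norm M (\<lambda>x. f x - g x)"
proof -
  let ?h = "\<lambda>x. f x - g x"
  have h: "sq_integrable M ?h" using assms sq_integrable_diff by blast
  have "sq_norm M f = (\<integral>x. (g x)\<^sup>2 + 2 * (g x * ?h x) + (?h x)\<^sup>2 \<partial>M)"
    unfolding sq_norm_def by (rule Bochner_Integration.integral_cong) (auto simp: power2_eq_square algebra_simps)
  also have "\<dots> = sq_norm M g + 2 * (\<integral>x. g x * ?h x \<partial>M) + sq_norm M ?h"
    using h assms sq_integrable_mult[OF assms(2) h] by (simp add: sq_norm_def sq_integrable_def)
  finally have "\<bar>sq_norm M f - sq_norm M g\<bar> \<le> 2 * \<bar>\<integral>x. g x * ?h x \<partial>M\<bar> + sq_norm M ?h"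
    using sq_norm_nonneg[of M ?h] by linarith
  also have "\<dots> \<le> 2 * (d * sq_norm M g + sq_norm M ?h / d) + sq_norm M ?h"
    using integral_mult_abs_le[OF assms(2) h assms(3)] by simp
  finally show ?thesis by (simp add: algebra_simps)
qed

text \<open>From \<open>\<parallel>f\<parallel>\<^sup>2 - \<parallel>g\<parallel>\<^sup>2 = 2 \<langle>g, f - g\<rangle> + \<parallel>f - g\<parallel>\<^sup>2\<close>: in \<open>sq_norm_diff_le\<close> the parameter \<open>d\<close> is chosen so
  that the cross term costs at most half of the tolerance.\<close>

lemma sq_norm_tendsto:
  assumes "\<And>n. sq_integrable M (f n)" "sq_integrable M g"
    and lim: "(\<lambda>n. sq_norm M (\<lambda>x. f n x - g x)) \<longlonglongrightarrow> 0"
  shows "(\<lambda>n. sq_norm M (f n)) \<longlonglongrightarrow> sq_norm M g"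
proof (rule LIMSEQ_I)
  fix r :: real assume r: "0 < r"
  define d where "d = r / (4 * (sq_norm M g + 1))"
  have d: "0 < d" using r sq_norm_nonneg[of M g] by (simp add: d_def)
  have "2 * d * sq_norm M g < 2 * d * (sq_norm M g + 1)" using d by simp
  also have "\<dots> = r / 2" using sq_norm_nonneg[of M g] by (simp add: d_def field_simps)
  finally have 1: "2 * d * sq_norm M g < r / 2" .
  have "(\<lambda>n. (1 + 2 / d) * sq_norm M (\<lambda>x. f n x - g x)) \<longlonglongrightarrow> (1 + 2 / d) * 0"
    by (intro tendsto_intros lim)
  then have "\<forall>\<^sub>F n in sequentially. (1 + 2 / d) * sq_norm M (\<lambda>x. f n x - g x) < r / 2"
    by (rule order_tendstoD) (use r in simp)
  then have "\<forall>\<^sub>F n in sequentially. norm (sq_norm M (f n) - sq_norm M g) < r"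
  proof eventually_elim
    case (elim n)
    with 1 sq_norm_diff_le[OF assms(1)[of n] assms(2) d] show ?case by simp
  qed
  then show "\<exists>no. \<forall>n\<ge>no. norm (sq_norm M (f n) - sq_norm M g) < r"
    by (simp add: eventually_sequentially)
qed

lemma sq_norm_orthogonal_sum:
  assumes "finite I" "\<And>i. i \<in> I \<Longrightarrow> sq_integrable M (f i)"
    and orth: "\<And>i j. i \<in> I \<Longrightarrow> j \<in> I \<Longrightarrow> i \<noteq> j \<Longrightarrow> (\<integral>x. f i x * f j x \<partial>M) = 0"
  shows "sq_norm M (\<lambda>x. \<Sum>i\<in>I. f i x) = (\<Sum>i\<in>I. sq_norm M (f i))"
proof -
  have "sq_norm M (\<lambda>x. \<Sum>i\<in>I. f i x) = (\<integral>x. (\<Sum>i\<in>I. \<Sum>j\<in>I. f i x * f j x) \<partial>M)"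
    by (simp add: sq_norm_def power2_eq_square sum_product)
  also have "\<dots> = (\<Sum>i\<in>I. \<integral>x. (\<Sum>j\<in>I. f i x * f j x) \<partial>M)"
    by (intro Bochner_Integration.integral_sum Bochner_Integration.integrable_sum
        sq_integrable_mult assms(2))
  also have "\<dots> = (\<Sum>i\<in>I. \<Sum>j\<in>I. \<integral>x. f i x * f j x \<partial>M)"
    by (intro sum.cong[OF refl] Bochner_Integration.integral_sum sq_integrable_mult assms(2))
  also have "\<dots> = (\<Sum>i\<in>I. sq_norm M (f i))"
  proof (rule sum.cong[OF refl])
    fix i assume i: "i \<in> I"
    have "(\<Sum>j\<in>I. \<integral>x. f i x * f j x \<partial>M) = (\<Sum>j\<in>I. if j = i then sq_norm M (f i) else 0)"
      by (rule sum.cong[OF refl]) (use orth i in \<open>auto simp: sq_norm_def power2_eq_square\<close>)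
    then show "(\<Sum>j\<in>I. \<integral>x. f i x * f j x \<partial>M) = sq_norm M (f i)"
      using i assms(1) by simp
  qed
  finally show ?thesis .
qed


section \<open>Processes with unit-rate square-integrable increments\<close>

text \<open>Two processes satisfy this: Brownian motion on its probability space, and the indicators of
  \<open>(0,v]\<close>, indexed by \<open>v\<close>, on the real line with Lebesgue measure. The Wiener integral
  is the isometry that carries the second to the first, so each \<open>L\<^sup>2\<close> computation is done once, here, for both.\<close>

locale unit_increments =
  fixes Q :: "'c measure" and F :: "real \<Rightarrow> 'c \<Rightarrow> real"
  assumes measurable_process: "x \<in> {0..1} \<Longrightarrow> F x \<in> borel_measurable Q"
    and increment: "x \<in> {0..1} \<Longrightarrow> y \<in> {0..1} \<Longrightarrow>
      has_bochner_integral Q (\<lambda>\<omega>. (F x \<omega> - F y \<omega>)\<^sup>2) \<bar>x - y\<bar>"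

text \<open>The integral, with respect to \<open>F\<close>, of the step function with the value \<open>b k\<close> on \<open>(k/n, (k+1)/n]\<close>.
  Sums of this kind on one grid are closed under linear combinations, unlike step functions with partitions
  of their own.\<close>

definition grid_sum :: "(real \<Rightarrow> 'c \<Rightarrow> real) \<Rightarrow> nat \<Rightarrow> (nat \<Rightarrow> real) \<Rightarrow> 'c \<Rightarrow> real" where
  "grid_sum F n b \<omega> = (\<Sum>k<n. b k * (F (real (Suc k) / n) \<omega> - F (real k / n) \<omega>))"

lemma grid_sum_linear:
  "grid_sum F n (\<lambda>k. c * b k + d * b' k) \<omega> = c * grid_sum F n b \<omega> + d * grid_sum F n b' \<omega>"
  unfolding grid_sum_def sum_distrib_left sum.distrib[symmetric]
  by (rule sum.cong) (auto simp: algebra_simps)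

text \<open>The grid points in \<open>(x,y]\<close> are the right end points of the cells with numbers from \<open>\<lfloor>nx\<rfloor>\<close> up to, but excluding, \<open>\<lfloor>ny\<rfloor>\<close>, so
  the increments of \<open>G\<close> over these cells telescope.\<close>

lemma grid_telescope:
  fixes G :: "real \<Rightarrow> real"
  assumes "0 \<le> x" "x \<le> y" "y \<le> 1" "0 < n"
  shows "(\<Sum>k<n. indicator {x<..y} (real (Suc k) / n) * (G (real (Suc k) / n) - G (real k / n)))
    = G (real (nat \<lfloor>n * y\<rfloor>) / n) - G (real (nat \<lfloor>n * x\<rfloor>) / n)"
proof -
  let ?A = "nat \<lfloor>n * x\<rfloor>" and ?B = "nat \<lfloor>n * y\<rfloor>"
  have mono: "real n * x \<le> real n * y" using assms by (simp add: mult_left_mono)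
  have AB: "?A \<le> ?B" by (intro nat_mono floor_mono mono)
  have "real n * y \<le> real n" using assms by (simp add: mult_left_le)
  then have Bn: "?B \<le> n" by linarith
  have nx: "0 \<le> real n * x" "0 \<le> real n * y" using assms by auto
  have "(indicator {x<..y} (real (Suc k) / n) :: real) = (if k \<in> {?A..<?B} then 1 else 0)" for k
  proof -
    have "x < real (Suc k) / n \<longleftrightarrow> n * x < Suc k" using assms(4) by (simp add: field_simps)
    also have "\<dots> \<longleftrightarrow> ?A \<le> k" using nx by linarith
    finally have 1: "x < real (Suc k) / n \<longleftrightarrow> ?A \<le> k" .
    have "real (Suc k) / n \<le> y \<longleftrightarrow> Suc k \<le> n * y" using assms(4) by (simp add: field_simps)
    also have "\<dots> \<longleftrightarrow> k < ?B" using nx by linarith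
    finally show ?thesis using 1 by (simp add: indicator_def)
  qed
  then have "(\<Sum>k<n. indicator {x<..y} (real (Suc k) / n) * (G (real (Suc k) / n) - G (real k / n)))
    = (\<Sum>k<n. if k \<in> {?A..<?B} then G (real (Suc k) / n) - G (real k / n) else 0)"
    by (intro sum.cong) auto
  also have "\<dots> = (\<Sum>k\<in>{?A..<?B}. G (real (Suc k) / n) - G (real k / n))"
    by (subst sum.inter_restrict[symmetric]) (use Bn in \<open>auto intro!: sum.cong\<close>)
  also have "\<dots> = G (real ?B / n) - G (real ?A / n)"
    using sum_Suc_diff'[OF AB, of "\<lambda>k. G (real k / n)"] by simp
  finally show ?thesis .
qed

context unit_increments
begin

lemma sq_integrable_increment:
  "x \<in> {0..1} \<Longrightarrow> y \<in> {0..1} \<Longrightarrow> sq_integrable Q (\<lambda>\<omega>. F x \<omega> - F y \<omega>)"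
  using increment[of x y] measurable_process[of x] measurable_process[of y]
  by (auto simp: sq_integrable_def has_bochner_integral_iff)

lemma sq_norm_increment:
  "x \<in> {0..1} \<Longrightarrow> y \<in> {0..1} \<Longrightarrow> sq_norm Q (\<lambda>\<omega>. F x \<omega> - F y \<omega>) = \<bar>x - y\<bar>"
  using increment[of x y] by (simp add: sq_norm_def has_bochner_integral_iff)

text \<open>Polarization: \<open>2 (b - a) (d - c) = (d - a)\<^sup>2 + (c - b)\<^sup>2 - (d - b)\<^sup>2 - (c - a)\<^sup>2\<close>, and for
  \<open>a \<le> b \<le> c \<le> d\<close> the four distances cancel.\<close>

lemma increments_orthogonal:
  assumes "0 \<le> a" "a \<le> b" "b \<le> c" "c \<le> d" "d \<le> 1"
  shows "(\<integral>\<omega>. (F b \<omega> - F a \<omega>) * (F d \<omega> - F c \<omega>) \<partial>Q) = 0"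
proof -
  have i: "integrable Q (\<lambda>\<omega>. (F x \<omega> - F y \<omega>)\<^sup>2)" "(\<integral>\<omega>. (F x \<omega> - F y \<omega>)\<^sup>2 \<partial>Q) = \<bar>x - y\<bar>"
    if "x \<in> {0..1}" "y \<in> {0..1}" for x y
    using increment[OF that] by (simp_all add: has_bochner_integral_iff)
  have "(\<integral>\<omega>. (F b \<omega> - F a \<omega>) * (F d \<omega> - F c \<omega>) \<partial>Q)
    = (\<integral>\<omega>. ((F d \<omega> - F a \<omega>)\<^sup>2 + (F c \<omega> - F b \<omega>)\<^sup>2 - (F d \<omega> - F b \<omega>)\<^sup>2 - (F c \<omega> - F a \<omega>)\<^sup>2) / 2 \<partial>Q)"
    by (rule Bochner_Integration.integral_cong) (auto simp: power2_eq_square field_simps)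
  also have "\<dots> = (\<bar>d - a\<bar> + \<bar>c - b\<bar> - \<bar>d - b\<bar> - \<bar>c - a\<bar>) / 2"
    using assms i by (simp add: Bochner_Integration.integral_add Bochner_Integration.integral_diff)
  also have "\<dots> = 0" using assms by simp
  finally show ?thesis .
qed

lemma grid_point: "k \<le> n \<Longrightarrow> real k / real n \<in> {0..1}"
  by (auto simp: divide_le_eq_1)

lemma sq_integrable_grid_sum: "sq_integrable Q (grid_sum F n b)"
  unfolding grid_sum_def[abs_def]
  by (intro sq_integrable_sum sq_integrable_cmult sq_integrable_increment grid_point) auto

lemma grid_increments_inner:
  fixes k l n :: nat
  assumes "k < n" "l < n"
  shows "(\<integral>\<omega>. (F (real (Suc k) / n) \<omega> - F (real k / n) \<omega>) * (F (real (Suc l) / n) \<omega> - F (real l / n) \<omega>) \<partial>Q)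
    = (if k = l then 1 / n else 0)"
proof -
  let ?D = "\<lambda>k \<omega>. F (real (Suc k) / n) \<omega> - F (real k / n) \<omega>"
  have lt: "(\<integral>\<omega>. ?D k \<omega> * ?D l \<omega> \<partial>Q) = 0" if "k < l" "l < n" for k l
    by (rule increments_orthogonal) (use that in \<open>auto simp: divide_right_mono divide_le_eq_1\<close>)
  have "(\<integral>\<omega>. ?D k \<omega> * ?D k \<omega> \<partial>Q) = 1 / n"
  proof -
    have "\<bar>real (Suc k) / n - real k / n\<bar> = 1 / n" by (simp add: diff_divide_distrib[symmetric])
    moreover have "sq_norm Q (?D k) = \<bar>real (Suc k) / n - real k / n\<bar>"
      using assms by (intro sq_norm_increment grid_point) auto
    ultimately show ?thesis by (simp only: sq_norm_def power2_eq_square)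
  qed
  moreover have "(\<integral>\<omega>. ?D k \<omega> * ?D l \<omega> \<partial>Q) = 0" if "k \<noteq> l"
    using lt[of k l] lt[of l k] that assms by (cases "k < l") (auto simp: mult.commute)
  ultimately show ?thesis by auto
qed

lemma sq_norm_grid_sum: "sq_norm Q (grid_sum F n b) = (\<Sum>k<n. (b k)\<^sup>2) / n"
proof -
  let ?D = "\<lambda>k \<omega>. F (real (Suc k) / n) \<omega> - F (real k / n) \<omega>"
  have inner: "(\<integral>\<omega>. (b k * ?D k \<omega>) * (b l * ?D l \<omega>) \<partial>Q) = (if k = l then (b k)\<^sup>2 / n else 0)"
    if "k < n" "l < n" for k l
  proof -
    have "(\<lambda>\<omega>. (b k * ?D k \<omega>) * (b l * ?D l \<omega>)) = (\<lambda>\<omega>. (b k * b l) * (?D k \<omega> * ?D l \<omega>))"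
      by (simp add: ac_simps)
    then have "(\<integral>\<omega>. (b k * ?D k \<omega>) * (b l * ?D l \<omega>) \<partial>Q) = (b k * b l) * (if k = l then 1 / n else 0)"
      by (simp only: integral_mult_right_zero grid_increments_inner[OF that])
    then show ?thesis by (auto simp: power2_eq_square)
  qed
  have "sq_norm Q (grid_sum F n b) = (\<Sum>k<n. sq_norm Q (\<lambda>\<omega>. b k * ?D k \<omega>))"
    unfolding grid_sum_def[abs_def]
    by (intro sq_norm_orthogonal_sum sq_integrable_cmult sq_integrable_increment grid_point)
       (simp_all only: inner lessThan_iff finite_lessThan Suc_leI less_imp_le if_False)
  also have "\<dots> = (\<Sum>k<n. (b k)\<^sup>2 / n)"
    unfolding sq_norm_def
    by (intro sum.cong refl) (simp only: inner power2_eq_square[of "b _ * _"] lessThan_iff simp_thms if_True)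
  finally show ?thesis by (simp add: sum_divide_distrib)
qed

lemma sq_integrable_step_integral:
  assumes "p ` {..m} \<subseteq> {0..1}"
  shows "sq_integrable Q (step_integral F m p a)"
  unfolding step_integral_def[abs_def]
  by (intro sq_integrable_sum sq_integrable_cmult sq_integrable_increment subsetD[OF assms] imageI)
     auto

text \<open>Rounding the partition points of a step function down to the grid of mesh \<open>1/n\<close>: on that
  grid the rounded step function takes its value at the right end point of each cell.\<close>

lemma sq_norm_grid_sum_step_integral:
  assumes p: "mono_on {..m} p" "p ` {..m} \<subseteq> {0..1}" and n: "0 < n"
  shows "sq_norm Q (\<lambda>\<omega>. grid_sum F n (\<lambda>k. step_fun m p a (real (Suc k) / n)) \<omega>
      - step_integral F m p a \<omega>) \<le> m * (\<Sum>i<m. (a i)\<^sup>2 * 4) / n"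
proof -
  define r where "r = (\<lambda>x :: real. real (nat \<lfloor>n * x\<rfloor>) / n)"
  have r: "r x \<in> {0..1}" "\<bar>r x - x\<bar> \<le> 1 / n" if x: "x \<in> {0..1}" for x
  proof -
    have "0 \<le> real n * x" "real n * x \<le> real n" using x by (auto simp: mult_left_le)
    then have 1: "real (nat \<lfloor>n * x\<rfloor>) \<le> n" "\<bar>real (nat \<lfloor>n * x\<rfloor>) - n * x\<bar> \<le> 1" by linarith+
    then show "r x \<in> {0..1}" using n by (simp add: r_def divide_le_eq_1)
    have "\<bar>r x - x\<bar> = \<bar>real (nat \<lfloor>n * x\<rfloor>) - n * x\<bar> / n"
    proof -
      have "r x - x = (real (nat \<lfloor>n * x\<rfloor>) - n * x) / n" using n by (simp add: r_def field_simps)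
      then show ?thesis by (simp add: abs_divide)
    qed
    with 1 show "\<bar>r x - x\<bar> \<le> 1 / n" by (simp add: divide_right_mono)
  qed
  have pin: "p i \<in> {0..1}" "p (Suc i) \<in> {0..1}" "p i \<le> p (Suc i)" if "i < m" for i
  proof -
    have "p i \<in> {0..1}" if "i \<le> m" for i using p(2) that by blast
    then show "p i \<in> {0..1}" "p (Suc i) \<in> {0..1}" using that by auto
    show "p i \<le> p (Suc i)" using p(1) that by (auto simp: mono_on_def)
  qed
  let ?E = "\<lambda>i \<omega>. (F (r (p (Suc i))) \<omega> - F (p (Suc i)) \<omega>) - (F (r (p i)) \<omega> - F (p i) \<omega>)"
  have eq: "grid_sum F n (\<lambda>k. step_fun m p a (real (Suc k) / n)) \<omega> - step_integral F m p a \<omega>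
    = (\<Sum>i<m. a i * ?E i \<omega>)" for \<omega>
  proof -
    let ?G = "\<lambda>k. F (real (Suc k) / n) \<omega> - F (real k / n) \<omega>"
    have "grid_sum F n (\<lambda>k. step_fun m p a (real (Suc k) / n)) \<omega>
      = (\<Sum>k<n. \<Sum>i<m. a i * (indicator {p i<..p (Suc i)} (real (Suc k) / n) * ?G k))"
      by (simp only: grid_sum_def step_fun_def sum_distrib_right mult.assoc)
    also have "\<dots> = (\<Sum>i<m. a i * (\<Sum>k<n. indicator {p i<..p (Suc i)} (real (Suc k) / n) * ?G k))"
      by (subst sum.swap) (simp only: sum_distrib_left)
    also have "\<dots> = (\<Sum>i<m. a i * (F (r (p (Suc i))) \<omega> - F (r (p i)) \<omega>))"
      unfolding r_def
      by (intro sum.cong[OF refl] arg_cong2[where f="(*)"] refl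
            grid_telescope[where G="\<lambda>x. F x \<omega>"]) (use pin n in auto)
    finally show ?thesis
      by (simp add: step_integral_def sum_subtractf[symmetric] algebra_simps)
  qed
  have sq: "sq_integrable Q (?E i)" if "i < m" for i
    by (intro sq_integrable_diff[OF sq_integrable_increment sq_integrable_increment] r pin that)
  have "sq_norm Q (\<lambda>\<omega>. \<Sum>i<m. a i * ?E i \<omega>) \<le> card {..<m} * (\<Sum>i<m. sq_norm Q (\<lambda>\<omega>. a i * ?E i \<omega>))"
    by (rule sq_norm_sum_le) (auto intro!: sq_integrable_cmult sq)
  also have "\<dots> \<le> m * (\<Sum>i<m. (a i)\<^sup>2 * (4 / n))"
  proof -
    have "sq_norm Q (?E i) \<le> 4 / n" if i: "i < m" for i
    proof -
      let ?u = "\<lambda>\<omega>. F (r (p (Suc i))) \<omega> - F (p (Suc i)) \<omega>" and ?v = "\<lambda>\<omega>. F (p i) \<omega> - F (r (p i)) \<omega>"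
      have "sq_norm Q (?E i) = sq_norm Q (\<lambda>\<omega>. ?u \<omega> + ?v \<omega>)" by (simp add: algebra_simps)
      also have "\<dots> \<le> 2 * sq_norm Q ?u + 2 * sq_norm Q ?v"
        by (intro sq_norm_add_le sq_integrable_increment r pin i)
      also have "\<dots> = 2 * \<bar>r (p (Suc i)) - p (Suc i)\<bar> + 2 * \<bar>p i - r (p i)\<bar>"
        by (simp only: sq_norm_increment r pin i)
      also have "\<dots> \<le> 2 * (1 / n) + 2 * (1 / n)"
        using r(2)[OF pin(1)[OF i]] r(2)[OF pin(2)[OF i]]
        by (intro add_mono mult_left_mono) (simp_all add: abs_minus_commute)
      also have "\<dots> = 4 / n" by simp
      finally show ?thesis .
    qed
    then show ?thesis
      by (simp only: sq_norm_cmult card_lessThan)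
         (intro mult_left_mono sum_mono, auto)
  qed
  finally show ?thesis unfolding eq by (simp add: sum_divide_distrib[symmetric])
qed

end

lemma distributed_normal_second_moment:
  assumes "prob_space N" "distributed N lborel D (normal_density 0 s)" "0 < s"
  shows "has_bochner_integral N (\<lambda>\<omega>. (D \<omega>)\<^sup>2) (s\<^sup>2)"
proof -
  interpret N: prob_space N by fact
  have "integrable N (\<lambda>\<omega>. (D \<omega>)\<^sup>2)"
    using distributed_integrable[OF assms(2), of "\<lambda>x. x\<^sup>2"] integrable_normal_moment[OF assms(3), of 0 2]
    by simp
  moreover have "(\<integral>\<omega>. (D \<omega>)\<^sup>2 \<partial>N) = s\<^sup>2"
    using N.normal_distributed_variance[OF assms(3,2)]
      N.normal_distributed_expectation[OF assms(3,2)] by simp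
  ultimately show ?thesis by (simp add: has_bochner_integral_iff)
qed

lemma brownian_unit_increments:
  assumes N: "prob_space N" and W: "standard_brownian_motion N W"
  shows "unit_increments N W"
proof
  show "W x \<in> borel_measurable N" if "x \<in> {0..1}" for x
    using W that by (simp add: standard_brownian_motion_def)
  have less: "has_bochner_integral N (\<lambda>\<omega>. (W y \<omega> - W x \<omega>)\<^sup>2) (y - x)"
    if "x \<in> {0..1}" "y \<in> {0..1}" "x < y" for x y
  proof -
    have "distributed N lborel (\<lambda>\<omega>. W y \<omega> - W x \<omega>) (normal_density 0 (sqrt (y - x)))"
      using W that by (simp add: standard_brownian_motion_def)
    from distributed_normal_second_moment[OF N this] that show ?thesis by simp
  qed
  show "has_bochner_integral N (\<lambda>\<omega>. (W x \<omega> - W y \<omega>)\<^sup>2) \<bar>x - y\<bar>"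
    if "x \<in> {0..1}" "y \<in> {0..1}" for x y
  proof -
    consider "x < y" | "y < x" | "x = y" by linarith
    then show ?thesis
    proof cases
      case 1
      then show ?thesis using less[OF that] by (simp add: power2_commute)
    next
      case 2
      then show ?thesis using less[of y x] that by simp
    qed (simp add: has_bochner_integral_zero)
  qed
qed

text \<open>For \<open>0 \<le> x \<le> y\<close> the increment from \<open>x\<close> to \<open>y\<close> is the indicator of \<open>(x,y]\<close>; hence grid sums and step
  integrals with respect to this process are the step functions themselves.\<close>

definition ind_upto :: "real \<Rightarrow> real \<Rightarrow> real" where
  "ind_upto v u = indicator {0<..v} u"

lemma ind_upto_increment: "0 \<le> x \<Longrightarrow> x \<le> y \<Longrightarrow> ind_upto y u - ind_upto x u = indicator {x<..y} u"
  by (auto simp: ind_upto_def indicator_def)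

interpretation ind_upto: unit_increments lborel ind_upto
proof
  show "ind_upto x \<in> borel_measurable lborel" for x by (simp add: ind_upto_def[abs_def])
  have le: "has_bochner_integral lborel (\<lambda>u. (ind_upto y u - ind_upto x u)\<^sup>2) (y - x)"
    if "0 \<le> x" "x \<le> y" for x y :: real
  proof -
    have "has_bochner_integral lborel (indicator {x<..y} :: real \<Rightarrow> real) (measure lborel {x<..y})"
      by (rule has_bochner_integral_real_indicator) (use that in auto)
    moreover have "(\<lambda>u. (ind_upto y u - ind_upto x u)\<^sup>2) = indicator {x<..y}"
      using ind_upto_increment[OF that] by (auto simp: fun_eq_iff indicator_def)
    ultimately show ?thesis using that by simp
  qed
  show "has_bochner_integral lborel (\<lambda>u. (ind_upto x u - ind_upto y u)\<^sup>2) \<bar>x - y\<bar>"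
    if "x \<in> {0..1}" "y \<in> {0..1}" for x y
    using le[of x y] le[of y x] that by (cases "x \<le> y") (auto simp: power2_commute)
qed

lemma step_integral_ind_upto:
  assumes "mono_on {..m} p" "p ` {..m} \<subseteq> {0..T}"
  shows "step_integral ind_upto m p a = step_fun m p a"
proof -
  have "ind_upto (p (Suc i)) u - ind_upto (p i) u = indicator {p i<..p (Suc i)} u" if "i < m" for i u
  proof (rule ind_upto_increment)
    show "p i \<le> p (Suc i)" using assms(1) that by (auto simp: mono_on_def)
    have "p i \<in> {0..T}" using assms(2) that by (meson atMost_iff image_subset_iff less_imp_le)
    then show "0 \<le> p i" by simp
  qed
  then show ?thesis by (auto simp: fun_eq_iff step_integral_def step_fun_def)
qed

lemma step_fun_outside:
  assumes "p ` {..m} \<subseteq> {0..T}" "u \<notin> {0..T}"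
  shows "step_fun m p a u = 0"
proof -
  have "indicator {p i<..p (Suc i)} u = (0 :: real)" if "i < m" for i
  proof -
    have "p i \<in> {0..T}" "p (Suc i) \<in> {0..T}"
      using assms(1) that by (meson Suc_leI atMost_iff image_subset_iff less_imp_le)+
    with assms(2) show ?thesis by (auto simp: indicator_def)
  qed
  then show ?thesis by (simp add: step_fun_def)
qed


section \<open>Wiener integrals through uniform grids\<close>

text \<open>\<open>Z\<close> is the Wiener integral of \<open>f\<close>: on every fine enough uniform grid, some step function
  approximates \<open>f\<close> and its integral approximates \<open>Z\<close>. Because the grid may be
  prescribed, finitely many pairs have approximations on a common grid, which makes this form of
  the definition compatible with linear combinations and gives joint approximations.\<close>

definition wiener_pair ::
    "'b measure \<Rightarrow> (real \<Rightarrow> 'b \<Rightarrow> real) \<Rightarrow> (real \<Rightarrow> real) \<Rightarrow> ('b \<Rightarrow> real) \<Rightarrow> bool" where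
  "wiener_pair N W f Z \<longleftrightarrow> sq_integrable lborel f \<and> sq_integrable N Z \<and>
     (\<forall>e>0. \<forall>\<^sub>F n in sequentially. \<exists>b.
        sq_norm lborel (\<lambda>u. grid_sum ind_upto n b u - f u) < e \<and>
        sq_norm N (\<lambda>\<omega>. grid_sum W n b \<omega> - Z \<omega>) < e)"

lemma wiener_pairD:
  assumes "wiener_pair N W f Z"
  shows "sq_integrable lborel f" "sq_integrable N Z"
    "\<And>e. 0 < e \<Longrightarrow> \<forall>\<^sub>F n in sequentially. \<exists>b.
        sq_norm lborel (\<lambda>u. grid_sum ind_upto n b u - f u) < e \<and>
        sq_norm N (\<lambda>\<omega>. grid_sum W n b \<omega> - Z \<omega>) < e"
  using assms by (auto simp: wiener_pair_def)

lemma wiener_pair_lincomb: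
  assumes W: "unit_increments N W"
    and "wiener_pair N W f Y" "wiener_pair N W g Z"
  shows "wiener_pair N W (\<lambda>u. c * f u + d * g u) (\<lambda>\<omega>. c * Y \<omega> + d * Z \<omega>)"
proof -
  interpret W: unit_increments N W by fact
  note f = wiener_pairD[OF assms(2)] and g = wiener_pairD[OF assms(3)]
  have bound: "sq_norm Q (\<lambda>x. grid_sum F n (\<lambda>k. c * b k + d * b' k) x - (c * u x + d * v x)) < e"
    if "sq_norm Q (\<lambda>x. grid_sum F n b x - u x) < e / (2 * c\<^sup>2 + 2 * d\<^sup>2 + 1)"
      "sq_norm Q (\<lambda>x. grid_sum F n b' x - v x) < e / (2 * c\<^sup>2 + 2 * d\<^sup>2 + 1)"
      "unit_increments Q F" "sq_integrable Q u" "sq_integrable Q v" "0 < e"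
    for Q :: "'c measure" and F n b b' u v e
  proof -
    interpret F: unit_increments Q F by fact
    let ?e = "e / (2 * c\<^sup>2 + 2 * d\<^sup>2 + 1)"
    have pos: "0 < 2 * c\<^sup>2 + 2 * d\<^sup>2 + 1" by (intro add_nonneg_pos) auto
    have "sq_norm Q (\<lambda>x. grid_sum F n (\<lambda>k. c * b k + d * b' k) x - (c * u x + d * v x))
      = sq_norm Q (\<lambda>x. c * (grid_sum F n b x - u x) + d * (grid_sum F n b' x - v x))"
      by (simp add: grid_sum_linear algebra_simps)
    also have "\<dots> \<le> 2 * sq_norm Q (\<lambda>x. c * (grid_sum F n b x - u x))
        + 2 * sq_norm Q (\<lambda>x. d * (grid_sum F n b' x - v x))"
      by (intro sq_norm_add_le sq_integrable_cmult sq_integrable_diff F.sq_integrable_grid_sum that)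
    also have "\<dots> \<le> 2 * (c\<^sup>2 * ?e) + 2 * (d\<^sup>2 * ?e)"
      unfolding sq_norm_cmult using that by (intro add_mono mult_left_mono) auto
    also have "\<dots> = (2 * c\<^sup>2 + 2 * d\<^sup>2) * ?e" by (simp only: distrib_right mult.assoc)
    also have "\<dots> < (2 * c\<^sup>2 + 2 * d\<^sup>2 + 1) * ?e"
      using pos that(6) by (intro mult_strict_right_mono) auto
    also have "\<dots> = e" using pos by simp
    finally show ?thesis .
  qed
  have "\<forall>\<^sub>F n in sequentially. \<exists>b.
        sq_norm lborel (\<lambda>x. grid_sum ind_upto n b x - (c * f x + d * g x)) < e \<and>
        sq_norm N (\<lambda>\<omega>. grid_sum W n b \<omega> - (c * Y \<omega> + d * Z \<omega>)) < e" if e: "0 < e" for e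
  proof -
    have "0 < 2 * c\<^sup>2 + 2 * d\<^sup>2 + 1" by (intro add_nonneg_pos) auto
    then have e': "0 < e / (2 * c\<^sup>2 + 2 * d\<^sup>2 + 1)" using e by simp
    show ?thesis using f(3)[OF e'] g(3)[OF e']
    proof eventually_elim
      case (elim n)
      then obtain b b' where
        "sq_norm lborel (\<lambda>x. grid_sum ind_upto n b x - f x) < e / (2 * c\<^sup>2 + 2 * d\<^sup>2 + 1)"
        "sq_norm N (\<lambda>x. grid_sum W n b x - Y x) < e / (2 * c\<^sup>2 + 2 * d\<^sup>2 + 1)"
        "sq_norm lborel (\<lambda>x. grid_sum ind_upto n b' x - g x) < e / (2 * c\<^sup>2 + 2 * d\<^sup>2 + 1)"
        "sq_norm N (\<lambda>x. grid_sum W n b' x - Z x) < e / (2 * c\<^sup>2 + 2 * d\<^sup>2 + 1)" by blast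
      then show ?case
        by (intro exI[of _ "\<lambda>k. c * b k + d * b' k"] conjI bound)
           (use e f g W ind_upto.unit_increments_axioms in auto)
    qed
  qed
  then show ?thesis
    unfolding wiener_pair_def
    by (intro conjI allI impI sq_integrable_add sq_integrable_cmult f g) auto
qed

lemma wiener_pair_sum:
  assumes W: "unit_increments N W" and "finite J" "\<And>t. t \<in> J \<Longrightarrow> wiener_pair N W (f t) (Z t)"
  shows "wiener_pair N W (\<lambda>u. \<Sum>t\<in>J. c t * f t u) (\<lambda>\<omega>. \<Sum>t\<in>J. c t * Z t \<omega>)"
  using assms(2,3)
proof (induction J)
  case empty
  interpret W: unit_increments N W by fact
  show ?case
    by (auto simp: wiener_pair_def sq_integrable_def sq_norm_def grid_sum_def
        intro!: always_eventually exI[of _ "\<lambda>_. 0"])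
next
  case (insert t J)
  from wiener_pair_lincomb[OF W insert.prems[of t] insert.IH, of "c t" 1] insert
  show ?case by simp
qed

lemma wiener_pair_sequence:
  assumes "wiener_pair N W f Z"
  obtains n b where
    "(\<lambda>j. sq_norm lborel (\<lambda>u. grid_sum ind_upto (n j) (b j) u - f u)) \<longlonglongrightarrow> 0"
    "(\<lambda>j. sq_norm N (\<lambda>\<omega>. grid_sum W (n j) (b j) \<omega> - Z \<omega>)) \<longlonglongrightarrow> 0"
proof -
  have "\<exists>n b. sq_norm lborel (\<lambda>u. grid_sum ind_upto n b u - f u) < 1 / real (Suc j) \<and>
        sq_norm N (\<lambda>\<omega>. grid_sum W n b \<omega> - Z \<omega>) < 1 / real (Suc j)" for j
    using eventually_happens'[OF sequentially_bot wiener_pairD(3)[OF assms, of "1 / real (Suc j)"]]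
    by simp
  then obtain n b where nb:
      "\<And>j. sq_norm lborel (\<lambda>u. grid_sum ind_upto (n j) (b j) u - f u) < 1 / real (Suc j)"
      "\<And>j. sq_norm N (\<lambda>\<omega>. grid_sum W (n j) (b j) \<omega> - Z \<omega>) < 1 / real (Suc j)"
    by metis
  have lim: "(\<lambda>j. 1 / real (Suc j)) \<longlonglongrightarrow> 0"
    using LIMSEQ_inverse_real_of_nat by (simp add: inverse_eq_divide)
  show thesis
    by (rule that[of n b]; rule tendsto_sandwich[OF _ _ tendsto_const lim])
       (auto intro!: always_eventually sq_norm_nonneg less_imp_le nb simp del: of_nat_Suc)
qed

text \<open>Both sides are limits of the same numbers \<open>(\<Sum>k<n. (b k)\<^sup>2) / n\<close>.\<close>

lemma wiener_pair_isometry: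
  assumes W: "unit_increments N W" and pair: "wiener_pair N W f Z"
  shows "sq_norm N Z = sq_norm lborel f"
proof -
  interpret W: unit_increments N W by fact
  obtain n b where
    "(\<lambda>j. sq_norm lborel (\<lambda>u. grid_sum ind_upto (n j) (b j) u - f u)) \<longlonglongrightarrow> 0"
    "(\<lambda>j. sq_norm N (\<lambda>\<omega>. grid_sum W (n j) (b j) \<omega> - Z \<omega>)) \<longlonglongrightarrow> 0"
    by (rule wiener_pair_sequence[OF pair])
  then have "(\<lambda>j. sq_norm lborel (grid_sum ind_upto (n j) (b j))) \<longlonglongrightarrow> sq_norm lborel f"
    "(\<lambda>j. sq_norm N (grid_sum W (n j) (b j))) \<longlonglongrightarrow> sq_norm N Z"
    using wiener_pairD(1,2)[OF pair]
    by (auto intro!: sq_norm_tendsto ind_upto.sq_integrable_grid_sum W.sq_integrable_grid_sum)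
  then show ?thesis
    unfolding ind_upto.sq_norm_grid_sum W.sq_norm_grid_sum by (rule LIMSEQ_unique[symmetric])
qed

text \<open>Approximate by one step function of the defining sequence, then round its partition to a
  uniform grid; the cost of the rounding is \<open>O(1/n)\<close> on both sides.\<close>

lemma has_wiener_integral_imp_wiener_pair:
  assumes W: "unit_increments N W" and T: "T \<in> {0..1}"
    and int: "has_wiener_integral N W T f Z" and supp: "\<And>u. u \<notin> {0..T} \<Longrightarrow> f u = 0"
  shows "wiener_pair N W f Z"
proof -
  interpret W: unit_increments N W by fact
  obtain m p a where p: "\<And>j. mono_on {..m j} (p j)" "\<And>j. p j ` {..m j} \<subseteq> {0..T}"
    and lim_f: "(\<lambda>j. \<integral>\<^sup>+u\<in>{0..T}. ennreal ((step_fun (m j) (p j) (a j) u - f u)\<^sup>2) \<partial>lborel) \<longlonglongrightarrow> 0"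
    and lim_Z: "(\<lambda>j. \<integral>\<^sup>+\<omega>. ennreal ((step_integral W (m j) (p j) (a j) \<omega> - Z \<omega>)\<^sup>2) \<partial>N) \<longlonglongrightarrow> 0"
    using int unfolding has_wiener_integral_def by blast
  define s where "s j = step_fun (m j) (p j) (a j)" for j
  define S where "S j = step_integral W (m j) (p j) (a j)" for j
  have p1: "p j ` {..m j} \<subseteq> {0..1}" for j using p(2)[of j] T by fastforce
  have s_ind_upto: "s j = step_integral ind_upto (m j) (p j) (a j)" for j
    unfolding s_def by (rule step_integral_ind_upto[symmetric, OF p])
  have f_eq: "(\<lambda>u. indicator {0..T} u *\<^sub>R f u) = f" "(\<lambda>u. indicator {0..T} u *\<^sub>R (f u)\<^sup>2) = (\<lambda>u. (f u)\<^sup>2)"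
    using supp by (auto simp: indicator_def fun_eq_iff)
  have f: "sq_integrable lborel f"
    using int unfolding has_wiener_integral_def set_borel_measurable_def set_integrable_def
      sq_integrable_def f_eq by simp
  have s: "sq_integrable lborel (s j)" for j
    unfolding s_ind_upto by (rule ind_upto.sq_integrable_step_integral[OF p1])
  have S: "sq_integrable N (S j)" for j
    unfolding S_def by (rule W.sq_integrable_step_integral[OF p1])
  have "(\<integral>\<^sup>+u\<in>{0..T}. ennreal ((s j u - f u)\<^sup>2) \<partial>lborel) = ennreal (sq_norm lborel (\<lambda>u. s j u - f u))" for j
  proof -
    have "(\<integral>\<^sup>+u\<in>{0..T}. ennreal ((s j u - f u)\<^sup>2) \<partial>lborel) = (\<integral>\<^sup>+u. ennreal ((s j u - f u)\<^sup>2) \<partial>lborel)"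
      using supp step_fun_outside[OF p(2)]
      by (intro nn_integral_cong) (auto simp: indicator_def s_def)
    also have "\<dots> = ennreal (sq_norm lborel (\<lambda>u. s j u - f u))"
      using sq_integrable_diff[OF s f] unfolding sq_norm_def sq_integrable_def
      by (intro nn_integral_eq_integral) auto
    finally show ?thesis .
  qed
  with lim_f have lim_f: "(\<lambda>j. sq_norm lborel (\<lambda>u. s j u - f u)) \<longlonglongrightarrow> 0"
    by (simp add: s_def[symmetric] ennreal_tendsto_0_iff sq_norm_nonneg)
  have Z_meas: "Z \<in> borel_measurable N" using int by (simp add: has_wiener_integral_def)
  have Z: "sq_integrable N Z"
  proof -
    have "\<forall>\<^sub>F j in sequentially. (\<integral>\<^sup>+\<omega>. ennreal ((S j \<omega> - Z \<omega>)\<^sup>2) \<partial>N) < 1"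
      using lim_Z unfolding S_def by (rule order_tendstoD) simp
    then obtain j where j: "(\<integral>\<^sup>+\<omega>. ennreal ((S j \<omega> - Z \<omega>)\<^sup>2) \<partial>N) < 1"
      by (auto simp: eventually_sequentially)
    have "integrable N (\<lambda>\<omega>. (S j \<omega> - Z \<omega>)\<^sup>2)"
      using S[of j] Z_meas less_trans[OF j, of \<infinity>]
      by (intro integrableI_nonneg) (auto simp: sq_integrable_def)
    then have "sq_integrable N (\<lambda>\<omega>. S j \<omega> - Z \<omega>)"
      using S[of j] Z_meas by (auto simp: sq_integrable_def)
    from sq_integrable_diff[OF S[of j] this] show ?thesis by simp
  qed
  have "(\<integral>\<^sup>+\<omega>. ennreal ((S j \<omega> - Z \<omega>)\<^sup>2) \<partial>N) = ennreal (sq_norm N (\<lambda>\<omega>. S j \<omega> - Z \<omega>))" for j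
    using sq_integrable_diff[OF S Z] unfolding sq_norm_def sq_integrable_def
    by (intro nn_integral_eq_integral) auto
  with lim_Z have lim_Z: "(\<lambda>j. sq_norm N (\<lambda>\<omega>. S j \<omega> - Z \<omega>)) \<longlonglongrightarrow> 0"
    by (simp add: S_def[symmetric] ennreal_tendsto_0_iff sq_norm_nonneg)
  have "\<forall>\<^sub>F n in sequentially. \<exists>b.
        sq_norm lborel (\<lambda>u. grid_sum ind_upto n b u - f u) < e \<and>
        sq_norm N (\<lambda>\<omega>. grid_sum W n b \<omega> - Z \<omega>) < e" if e: "0 < e" for e
  proof -
    have "\<forall>\<^sub>F j in sequentially. sq_norm lborel (\<lambda>u. s j u - f u) < e / 4 \<and> sq_norm N (\<lambda>\<omega>. S j \<omega> - Z \<omega>) < e / 4"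
      using e by (intro eventually_conj order_tendstoD(2)[OF lim_f] order_tendstoD(2)[OF lim_Z]) auto
    then obtain j where j: "sq_norm lborel (\<lambda>u. s j u - f u) < e / 4" "sq_norm N (\<lambda>\<omega>. S j \<omega> - Z \<omega>) < e / 4"
      by (auto simp: eventually_sequentially)
    define c where "c = m j * (\<Sum>i<m j. (a j i)\<^sup>2 * 4)"
    have "(\<lambda>n. c / real n) \<longlonglongrightarrow> 0" by (rule lim_const_over_n)
    then have "\<forall>\<^sub>F n in sequentially. c / real n < e / 4"
      by (rule order_tendstoD) (use e in simp)
    then show ?thesis using eventually_gt_at_top[of 0]
    proof eventually_elim
      case (elim n)
      let ?b = "\<lambda>k. s j (real (Suc k) / n)"
      have "sq_norm lborel (\<lambda>u. grid_sum ind_upto n ?b u - s j u) \<le> c / n"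
        using ind_upto.sq_norm_grid_sum_step_integral[OF p(1) p1 elim(2), of j "a j"]
        unfolding step_integral_ind_upto[OF p] s_def c_def by simp
      with j(1) elim(1) sq_norm_triangle[OF ind_upto.sq_integrable_grid_sum[of n ?b] s[of j] f]
      have 1: "sq_norm lborel (\<lambda>u. grid_sum ind_upto n ?b u - f u) < e" by linarith
      have "sq_norm N (\<lambda>\<omega>. grid_sum W n ?b \<omega> - S j \<omega>) \<le> c / n"
        using W.sq_norm_grid_sum_step_integral[OF p(1) p1 elim(2), of j "a j"]
        unfolding s_def c_def S_def by simp
      with j(2) elim(1) sq_norm_triangle[OF W.sq_integrable_grid_sum[of n ?b] S[of j] Z]
      have 2: "sq_norm N (\<lambda>\<omega>. grid_sum W n ?b \<omega> - Z \<omega>) < e" by linarith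
      from 1 2 show ?case by blast
    qed
  qed
  then show ?thesis using f Z by (auto simp: wiener_pair_def)
qed

section \<open>Gaussian laws of Wiener integrals\<close>

lemma char_distr_normal:
  assumes "prob_space N" and D: "distributed N lborel D (normal_density 0 s)" and s: "0 < s"
  shows "char (distr N borel D) \<theta> = exp (- (s\<^sup>2 * \<theta>\<^sup>2) / 2)"
proof -
  interpret N: prob_space N by fact
  have meas: "D \<in> borel_measurable N" using distributed_measurable[OF D] by simp
  have std: "distributed N lborel (\<lambda>x. D x / s) std_normal_density"
    using N.normal_standard_normal_convert[OF s, of D 0] D by simp
  have "char (distr N borel D) \<theta> = (CLINT \<omega>|N. iexp (\<theta> * s * (D \<omega> / s)))"
    using meas s by (simp add: char_def integral_distr)
  also have "\<dots> = (CLINT x|distr N lborel (\<lambda>x. D x / s). iexp (\<theta> * s * x))"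
    using meas by (subst integral_distr) auto
  also have "\<dots> = char std_normal_distribution (\<theta> * s)"
    unfolding distributed_distr_eq_density[OF std] char_def ..
  also have "\<dots> = exp (- (s\<^sup>2 * \<theta>\<^sup>2) / 2)"
    by (simp add: char_std_normal_distribution power_mult_distrib mult.commute)
  finally show ?thesis .
qed

lemma brownian_grid_increment:
  fixes k n :: nat
  assumes W: "standard_brownian_motion N W" and k: "k < n"
  shows "distributed N lborel (\<lambda>\<omega>. W (real (Suc k) / n) \<omega> - W (real k / n) \<omega>)
    (normal_density 0 (sqrt (1 / n)))"
proof -
  have "real (Suc k) / n - real k / n = 1 / n" by (simp add: diff_divide_distrib[symmetric])
  moreover have "0 \<le> real k / n" "real k / n < real (Suc k) / n" "real (Suc k) / n \<le> 1"
    using k by (auto simp: divide_strict_right_mono divide_le_eq_1)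
  moreover have "distributed N lborel (\<lambda>\<omega>. W t \<omega> - W s \<omega>) (normal_density 0 (sqrt (t - s)))"
    if "0 \<le> s" "s < t" "t \<le> 1" for s t
    using W that unfolding standard_brownian_motion_def by blast
  ultimately show ?thesis by metis
qed

lemma brownian_grid_increments_indep:
  assumes W: "standard_brownian_motion N W"
  shows "prob_space.indep_vars N (\<lambda>_. borel) (\<lambda>k \<omega>. W (real (Suc k) / n) \<omega> - W (real k / n) \<omega>) {..<n}"
proof -
  have "mono_on {..n} (\<lambda>k. real k / n)" by (auto simp: mono_on_def divide_right_mono)
  moreover have "(\<lambda>k. real k / n) ` {..n} \<subseteq> {0..1}" by (auto simp: divide_le_eq_1)
  ultimately show ?thesis using W unfolding standard_brownian_motion_def by blast
qed

lemma brownian_grid_sum_char: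
  assumes N: "prob_space N" and W: "standard_brownian_motion N W"
  shows "char (distr N borel (grid_sum W n b)) \<theta>
    = exp (- (sq_norm lborel (grid_sum ind_upto n b) * \<theta>\<^sup>2) / 2)"
proof -
  interpret N: prob_space N by fact
  let ?D = "\<lambda>k \<omega>. W (real (Suc k) / n) \<omega> - W (real k / n) \<omega>"
  have "N.indep_vars (\<lambda>_. borel) (\<lambda>k \<omega>. b k * ?D k \<omega>) {..<n}"
    by (rule N.indep_vars_compose2[OF brownian_grid_increments_indep[OF W, of n]]) auto
  then have "char (distr N borel (grid_sum W n b)) \<theta>
    = (\<Prod>k<n. char (distr N borel (\<lambda>\<omega>. b k * ?D k \<omega>)) \<theta>)"
    unfolding grid_sum_def[abs_def] by (rule N.char_distr_sum)
  also have "\<dots> = (\<Prod>k<n. complex_of_real (exp (- ((b k)\<^sup>2 / n * \<theta>\<^sup>2) / 2)))"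
  proof (rule prod.cong[OF refl])
    fix k assume "k \<in> {..<n}"
    then have D: "distributed N lborel (?D k) (normal_density 0 (sqrt (1 / n)))" and n: "0 < n"
      using brownian_grid_increment[OF W, of k n] by auto
    have meas: "?D k \<in> borel_measurable N" using distributed_measurable[OF D] by simp
    have "char (distr N borel (\<lambda>\<omega>. b k * ?D k \<omega>)) \<theta> = char (distr N borel (?D k)) (b k * \<theta>)"
      using meas by (simp add: char_def integral_distr ac_simps)
    also have "\<dots> = complex_of_real (exp (- ((b k)\<^sup>2 / n * \<theta>\<^sup>2) / 2))"
      by (subst char_distr_normal[OF N D]) (use n in \<open>simp_all add: power_mult_distrib\<close>)
    finally show "char (distr N borel (\<lambda>\<omega>. b k * ?D k \<omega>)) \<theta>
      = complex_of_real (exp (- ((b k)\<^sup>2 / n * \<theta>\<^sup>2) / 2))" .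
  qed
  also have "\<dots> = complex_of_real (exp (\<Sum>k<n. - ((b k)\<^sup>2 / n * \<theta>\<^sup>2) / 2))"
    by (simp only: exp_sum finite_lessThan of_real_prod)
  also have "(\<Sum>k<n. - ((b k)\<^sup>2 / n * \<theta>\<^sup>2) / 2) = - (sq_norm lborel (grid_sum ind_upto n b) * \<theta>\<^sup>2) / 2"
    by (simp add: ind_upto.sq_norm_grid_sum sum_distrib_right sum_divide_distrib sum_negf)
  finally show ?thesis .
qed

lemma (in prob_space) sq_integrable_imp_integrable: "sq_integrable M f \<Longrightarrow> integrable M f"
  by (rule square_integrable_imp_integrable) (auto simp: sq_integrable_def)

lemma iexp_lipschitz: "cmod (iexp x - iexp y) \<le> \<bar>x - y\<bar>"
proof -
  have "iexp x - iexp y = iexp y * (iexp (x - y) - 1)"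
    by (simp add: algebra_simps exp_diff)
  then have "cmod (iexp x - iexp y) = cmod (iexp (x - y) - 1)"
    by (simp add: norm_mult)
  also have "\<dots> \<le> \<bar>x - y\<bar>" using iexp_approx1[of "x - y" 0] by simp
  finally show ?thesis .
qed

lemma (in prob_space) char_distr_tendsto:
  assumes "\<And>j. sq_integrable M (Y j)" "sq_integrable M Z"
    and lim: "(\<lambda>j. sq_norm M (\<lambda>\<omega>. Y j \<omega> - Z \<omega>)) \<longlonglongrightarrow> 0"
  shows "(\<lambda>j. char (distr M borel (Y j)) \<theta>) \<longlonglongrightarrow> char (distr M borel Z) \<theta>"
proof -
  have meas: "Y j \<in> borel_measurable M" "Z \<in> borel_measurable M" for j
    using assms(1)[of j] assms(2) by (auto simp: sq_integrable_def)
  have bound: "cmod (char (distr M borel (Y j)) \<theta> - char (distr M borel Z) \<theta>)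
      \<le> \<bar>\<theta>\<bar> * (d + sq_norm M (\<lambda>\<omega>. Y j \<omega> - Z \<omega>) / d)" if d: "0 < d" for j d
  proof -
    have sq: "sq_integrable M (\<lambda>\<omega>. Y j \<omega> - Z \<omega>)" by (intro sq_integrable_diff assms)
    then have "integrable M (\<lambda>\<omega>. Y j \<omega> - Z \<omega>)"
      by (rule sq_integrable_imp_integrable)
    then have i: "integrable M (\<lambda>\<omega>. \<bar>\<theta>\<bar> * \<bar>Y j \<omega> - Z \<omega>\<bar>)" by simp
    have int: "complex_integrable M (\<lambda>\<omega>. iexp (\<theta> * Y j \<omega>))" "complex_integrable M (\<lambda>\<omega>. iexp (\<theta> * Z \<omega>))"
      using meas by (auto intro!: integrable_iexp)
    have "cmod (char (distr M borel (Y j)) \<theta> - char (distr M borel Z) \<theta>)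
      = cmod (CLINT \<omega>|M. iexp (\<theta> * Y j \<omega>) - iexp (\<theta> * Z \<omega>))"
      using meas int by (simp add: char_def integral_distr)
    also have "\<dots> \<le> (\<integral>\<omega>. \<bar>\<theta>\<bar> * \<bar>Y j \<omega> - Z \<omega>\<bar> \<partial>M)"
    proof (rule order_trans[OF integral_norm_bound integral_mono[OF _ i]])
      show "integrable M (\<lambda>\<omega>. cmod (iexp (\<theta> * Y j \<omega>) - iexp (\<theta> * Z \<omega>)))" using int by simp
      show "cmod (iexp (\<theta> * Y j \<omega>) - iexp (\<theta> * Z \<omega>)) \<le> \<bar>\<theta>\<bar> * \<bar>Y j \<omega> - Z \<omega>\<bar>" for \<omega>
        using iexp_lipschitz[of "\<theta> * Y j \<omega>" "\<theta> * Z \<omega>"]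
        by (simp add: right_diff_distrib[symmetric] abs_mult del: of_real_mult)
    qed
    also have "\<dots> \<le> \<bar>\<theta>\<bar> * (d + sq_norm M (\<lambda>\<omega>. Y j \<omega> - Z \<omega>) / d)"
      using integral_abs_le_sq_norm[OF sq d] by (simp add: mult_left_mono)
    finally show ?thesis .
  qed
  show ?thesis
  proof (rule tendstoI)
    fix e :: real assume e: "0 < e"
    define d where "d = (e / 2) / (\<bar>\<theta>\<bar> + 1)"
    have d: "0 < d" using e unfolding d_def by (intro divide_pos_pos) auto
    have "(\<lambda>j. \<bar>\<theta>\<bar> * (d + sq_norm M (\<lambda>\<omega>. Y j \<omega> - Z \<omega>) / d)) \<longlonglongrightarrow> \<bar>\<theta>\<bar> * (d + 0 / d)"
      using d by (intro tendsto_intros lim) auto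
    moreover have "\<bar>\<theta>\<bar> * (d + 0 / d) < e"
    proof -
      have "\<bar>\<theta>\<bar> * d \<le> (\<bar>\<theta>\<bar> + 1) * d" using d by (intro mult_right_mono) auto
      also have "\<dots> = e / 2"
      proof -
        have "\<bar>\<theta>\<bar> + 1 \<noteq> 0" by linarith
        then have "d * (\<bar>\<theta>\<bar> + 1) = e / 2" unfolding d_def by (rule nonzero_eq_divide_eq[THEN iffD1]) (rule refl)
        then show ?thesis by (simp only: mult.commute)
      qed
      finally show ?thesis using e by simp
    qed
    ultimately have "\<forall>\<^sub>F j in sequentially. \<bar>\<theta>\<bar> * (d + sq_norm M (\<lambda>\<omega>. Y j \<omega> - Z \<omega>) / d) < e"
      by (rule order_tendstoD)
    then show "\<forall>\<^sub>F j in sequentially. dist (char (distr M borel (Y j)) \<theta>) (char (distr M borel Z) \<theta>) < e"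
      by eventually_elim (use bound[OF d] in \<open>simp only: dist_norm, rule le_less_trans\<close>)
  qed
qed

lemma wiener_pair_char:
  assumes N: "prob_space N" and W: "standard_brownian_motion N W" and pair: "wiener_pair N W f Z"
  shows "char (distr N borel Z) \<theta> = exp (- (sq_norm lborel f * \<theta>\<^sup>2) / 2)"
proof -
  interpret N: prob_space N by fact
  interpret W: unit_increments N W by (rule brownian_unit_increments[OF N W])
  obtain n b where lim:
    "(\<lambda>j. sq_norm lborel (\<lambda>u. grid_sum ind_upto (n j) (b j) u - f u)) \<longlonglongrightarrow> 0"
    "(\<lambda>j. sq_norm N (\<lambda>\<omega>. grid_sum W (n j) (b j) \<omega> - Z \<omega>)) \<longlonglongrightarrow> 0"
    by (rule wiener_pair_sequence[OF pair])
  have "(\<lambda>j. sq_norm lborel (grid_sum ind_upto (n j) (b j))) \<longlonglongrightarrow> sq_norm lborel f"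
    by (intro sq_norm_tendsto ind_upto.sq_integrable_grid_sum wiener_pairD[OF pair] lim)
  then have "(\<lambda>j. complex_of_real (exp (- (sq_norm lborel (grid_sum ind_upto (n j) (b j)) * \<theta>\<^sup>2) / 2)))
    \<longlonglongrightarrow> exp (- (sq_norm lborel f * \<theta>\<^sup>2) / 2)"
    by (intro tendsto_intros) auto
  moreover have "(\<lambda>j. char (distr N borel (grid_sum W (n j) (b j))) \<theta>) \<longlonglongrightarrow> char (distr N borel Z) \<theta>"
    by (intro N.char_distr_tendsto W.sq_integrable_grid_sum wiener_pairD[OF pair] lim)
  ultimately show ?thesis
    unfolding brownian_grid_sum_char[OF N W] by (rule LIMSEQ_unique[symmetric])
qed

text \<open>Levy's uniqueness theorem identifies the law from its characteristic function. Variance 0 is a case of its own: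
  there is no density then, and \<open>Z\<close> vanishes almost surely.\<close>

lemma wiener_pair_gaussian:
  assumes N: "prob_space N" and W: "standard_brownian_motion N W" and pair: "wiener_pair N W f Z"
  shows "gaussian_rv N Z"
proof -
  interpret N: prob_space N by fact
  note Z = wiener_pairD(2)[OF pair, unfolded sq_integrable_def]
  let ?v = "sq_norm lborel f"
  show ?thesis
  proof (cases "?v = 0")
    case True
    then have "sq_norm N Z = 0"
      using wiener_pair_isometry[OF brownian_unit_increments[OF N W] pair] by simp
    then have "AE \<omega> in N. (Z \<omega>)\<^sup>2 = 0"
      using Z unfolding sq_norm_def by (subst (asm) integral_nonneg_eq_0_iff_AE) auto
    then show ?thesis
      using Z unfolding gaussian_rv_def by (intro conjI exI[of _ 0]) auto
  next
    case False
    then have v: "0 < ?v" using sq_norm_nonneg[of lborel f] by simp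
    let ?d = "density lborel (normal_density 0 (sqrt ?v))"
    interpret d: prob_space ?d using v by (intro prob_space_normal_density) simp
    have id: "distributed ?d lborel (\<lambda>x. x) (normal_density 0 (sqrt ?v))"
      by (simp add: distributed_def distr_id2)
    have "distr N borel Z = distr ?d borel (\<lambda>x. x)"
    proof (rule Levy_uniqueness)
      show "real_distribution (distr N borel Z)" using Z by simp
      show "real_distribution (distr ?d borel (\<lambda>x. x))" by simp
      show "char (distr N borel Z) = char (distr ?d borel (\<lambda>x. x))"
        using v by (simp add: fun_eq_iff wiener_pair_char[OF N W pair]
            char_distr_normal[OF d.prob_space_axioms id])
    qed
    then have "distr N borel Z = ?d" by (simp add: distr_id2)
    moreover have "distr N lborel Z = distr N borel Z" by (rule distr_cong) auto
    ultimately have "distributed N lborel Z (normal_density 0 (sqrt ?v))"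
      using Z by (simp add: distributed_def)
    then show ?thesis
      using Z v unfolding gaussian_rv_def
      by (intro conjI exI[of _ 0] exI[of _ "sqrt ?v"]) auto
  qed
qed

lemma wiener_pair_mean:
  assumes N: "prob_space N" and W: "standard_brownian_motion N W" and pair: "wiener_pair N W f Z"
  shows "has_bochner_integral N Z 0"
proof -
  interpret N: prob_space N by fact
  interpret W: unit_increments N W by (rule brownian_unit_increments[OF N W])
  note integrable = N.sq_integrable_imp_integrable
  note Z = wiener_pairD(2)[OF pair]
  have grid: "(\<integral>\<omega>. grid_sum W n b \<omega> \<partial>N) = 0" for n b
  proof -
    have "(\<integral>\<omega>. grid_sum W n b \<omega> \<partial>N)
      = (\<Sum>k<n. \<integral>\<omega>. b k * (W (real (Suc k) / n) \<omega> - W (real k / n) \<omega>) \<partial>N)"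
      unfolding grid_sum_def
      by (intro Bochner_Integration.integral_sum integrable sq_integrable_cmult
          W.sq_integrable_increment W.grid_point) auto
    also have "\<dots> = 0"
    proof (intro sum.neutral ballI)
      fix k assume k: "k \<in> {..<n}"
      then have "(\<integral>\<omega>. W (real (Suc k) / n) \<omega> - W (real k / n) \<omega> \<partial>N) = 0"
        by (intro N.normal_distributed_expectation[OF _ brownian_grid_increment[OF W]]) auto
      then show "(\<integral>\<omega>. b k * (W (real (Suc k) / n) \<omega> - W (real k / n) \<omega>) \<partial>N) = 0"
        by (simp only: integral_mult_right_zero mult_zero_right)
    qed
    finally show ?thesis .
  qed
  have "\<bar>\<integral>\<omega>. Z \<omega> \<partial>N\<bar> \<le> 0 + e" if e: "0 < e" for e
  proof -
    have "0 < (e / 2)\<^sup>2" using e by simp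
    from eventually_happens'[OF sequentially_bot wiener_pairD(3)[OF pair this]]
    obtain n b where nb: "sq_norm N (\<lambda>\<omega>. grid_sum W n b \<omega> - Z \<omega>) < (e / 2)\<^sup>2" by blast
    have sq: "sq_integrable N (\<lambda>\<omega>. grid_sum W n b \<omega> - Z \<omega>)"
      by (intro sq_integrable_diff W.sq_integrable_grid_sum Z)
    have "\<bar>\<integral>\<omega>. Z \<omega> \<partial>N\<bar> = \<bar>\<integral>\<omega>. grid_sum W n b \<omega> - Z \<omega> \<partial>N\<bar>"
      using grid[of n b] integrable[OF W.sq_integrable_grid_sum] integrable[OF Z] by simp
    also have "\<dots> \<le> (\<integral>\<omega>. \<bar>grid_sum W n b \<omega> - Z \<omega>\<bar> \<partial>N)" by (rule integral_abs_bound)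
    also have "\<dots> \<le> e / 2 + sq_norm N (\<lambda>\<omega>. grid_sum W n b \<omega> - Z \<omega>) / (e / 2)"
      by (rule N.integral_abs_le_sq_norm[OF sq]) (use e in simp)
    also have "\<dots> \<le> e / 2 + (e / 2)\<^sup>2 / (e / 2)"
      using nb e by (intro add_left_mono divide_right_mono) auto
    also have "\<dots> = 0 + e" using e by (simp add: power2_eq_square)
    finally show ?thesis .
  qed
  then have "\<bar>\<integral>\<omega>. Z \<omega> \<partial>N\<bar> \<le> 0" by (rule field_le_epsilon)
  then show ?thesis using integrable[OF Z] by (simp add: has_bochner_integral_iff)
qed

text \<open>Polarization of the isometry.\<close>

lemma wiener_pair_covariance:
  assumes W: "unit_increments N W" and Y: "wiener_pair N W f Y" and Z: "wiener_pair N W g Z"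
  shows "has_bochner_integral N (\<lambda>\<omega>. Y \<omega> * Z \<omega>) (\<integral>u. f u * g u \<partial>lborel)"
proof -
  have polar: "(\<integral>x. u x * v x \<partial>Q) = (sq_norm Q (\<lambda>x. u x + v x) - sq_norm Q u - sq_norm Q v) / 2"
    if "sq_integrable Q u" "sq_integrable Q v" for Q :: "'c measure" and u v
  proof -
    have "sq_norm Q (\<lambda>x. u x + v x) = (\<integral>x. (u x)\<^sup>2 + (v x)\<^sup>2 + 2 * (u x * v x) \<partial>Q)"
      unfolding sq_norm_def by (simp add: power2_sum mult.assoc)
    also have "\<dots> = sq_norm Q u + sq_norm Q v + 2 * (\<integral>x. u x * v x \<partial>Q)"
      using that sq_integrable_mult[OF that] by (simp add: sq_norm_def sq_integrable_def)
    finally show ?thesis by simp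
  qed
  have "sq_norm N (\<lambda>\<omega>. Y \<omega> + Z \<omega>) = sq_norm lborel (\<lambda>u. f u + g u)"
    using wiener_pair_isometry[OF W wiener_pair_lincomb[OF W Y Z, of 1 1]] by simp
  moreover have "sq_norm N Y = sq_norm lborel f" "sq_norm N Z = sq_norm lborel g"
    by (intro wiener_pair_isometry[OF W] Y Z)+
  ultimately show ?thesis
    using wiener_pairD(1,2)[OF Y] wiener_pairD(1,2)[OF Z]
    by (simp add: has_bochner_integral_iff sq_integrable_mult polar[of N Y Z] polar[of lborel f g])
qed

section \<open>Sub-fractional Brownian motion\<close>

text \<open>Convexity at the midpoint of \<open>s\<close> and \<open>t\<close>.\<close>

lemma powr_add_le:
  fixes s t p :: real
  assumes "0 \<le> s" "0 \<le> t" "1 \<le> p"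
  shows "(s + t) powr p \<le> 2 powr (p - 1) * (s powr p + t powr p)"
proof (cases "s = 0 \<or> t = 0")
  case True
  have "1 \<le> 2 powr (p - 1)" using assms by (intro ge_one_powr_ge_zero) auto
  with True show ?thesis by (auto simp: mult_le_cancel_right1)
next
  case False
  then have pos: "0 < s" "0 < t" using assms by auto
  have "((1 - 1/2) *\<^sub>R s + (1/2) *\<^sub>R t) powr p \<le> (1 - 1/2) * s powr p + (1/2) * t powr p"
    by (rule convex_onD[OF powr_convex[OF assms(3)]]) (use pos in auto)
  then have "((s + t) / 2) powr p \<le> (s powr p + t powr p) / 2" by (simp add: add_divide_distrib)
  moreover have "((s + t) / 2) powr p = (s + t) powr p / 2 powr p"
    using pos by (simp add: powr_divide)
  ultimately have "(s + t) powr p \<le> 2 powr p * ((s powr p + t powr p) / 2)"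
    by (simp add: field_simps)
  also have "\<dots> = 2 powr (p - 1) * (s powr p + t powr p)"
    by (simp add: powr_diff)
  finally show ?thesis .
qed

text \<open>The left-hand side is \<open>\<bar>t - s\<bar>\<^sup>p + (s + t)\<^sup>p - 2\<^sup>p\<^sup>-\<^sup>1 (s\<^sup>p + t\<^sup>p)\<close> with \<open>p = 2H\<close>, and the
  last two terms are together at most 0.\<close>

lemma subfbm_cov_increment:
  assumes "0 \<le> s" "0 \<le> t" "1/2 \<le> H"
  shows "subfbm_cov H t t - 2 * subfbm_cov H s t + subfbm_cov H s s \<le> \<bar>t - s\<bar> powr (2 * H)"
proof -
  have d: "(x + x) powr (2 * H) = 2 * (2 powr (2 * H - 1) * x powr (2 * H))" if "0 \<le> x" for x
  proof -
    have "(x + x) powr (2 * H) = (2 * x) powr (2 * H)" by simp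
    also have "\<dots> = 2 * (2 powr (2 * H - 1) * x powr (2 * H))"
      using that by (simp add: powr_mult powr_diff)
    finally show ?thesis .
  qed
  show ?thesis
    using powr_add_le[of s t "2 * H"] assms d[OF assms(1)] d[OF assms(2)]
    by (simp add: subfbm_cov_def distrib_left)
qed

lemma subfbm_kernel_outside: "u \<notin> {0<..<t} \<Longrightarrow> subfbm_kernel H C t u = 0"
  by (simp add: subfbm_kernel_def)

lemma subfbm_kernel_inner:
  assumes "subfbm_normalizing H C" "s \<in> {0..1}" "t \<in> {0..1}"
  shows "(\<integral>u. subfbm_kernel H C t u * subfbm_kernel H C s u \<partial>lborel) = subfbm_cov H s t"
proof -
  have "(\<integral>u. subfbm_kernel H C t u * subfbm_kernel H C s u \<partial>lborel)
    = (LBINT u:{0..1}. subfbm_kernel H C t u * subfbm_kernel H C s u)"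
    unfolding set_lebesgue_integral_def
  proof (rule Bochner_Integration.integral_cong[OF refl])
    fix u
    show "subfbm_kernel H C t u * subfbm_kernel H C s u
      = indicator {0..1} u *\<^sub>R (subfbm_kernel H C t u * subfbm_kernel H C s u)"
      using assms(2,3) subfbm_kernel_outside[of u t H C] by (cases "u \<in> {0<..<t}") auto
  qed
  then show ?thesis using assms by (simp add: subfbm_normalizing_def)
qed

lemma subfbm_kernel_increment:
  assumes C: "subfbm_normalizing H C" and H: "1/2 \<le> H" and st: "s \<in> {0..1}" "t \<in> {0..1}"
    and sq: "sq_integrable lborel (subfbm_kernel H C s)" "sq_integrable lborel (subfbm_kernel H C t)"
  shows "sq_norm lborel (\<lambda>u. subfbm_kernel H C t u - subfbm_kernel H C s u) \<le> \<bar>t - s\<bar> powr (2 * H)"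
proof -
  let ?K = "subfbm_kernel H C"
  note i = sq_integrable_mult[OF sq(1,1)] sq_integrable_mult[OF sq(2,2)] sq_integrable_mult[OF sq(2,1)]
  have "sq_norm lborel (\<lambda>u. ?K t u - ?K s u)
    = (\<integral>u. ?K t u * ?K t u - 2 * (?K t u * ?K s u) + ?K s u * ?K s u \<partial>lborel)"
    unfolding sq_norm_def by (simp add: power2_eq_square algebra_simps)
  also have "\<dots> = subfbm_cov H t t - 2 * subfbm_cov H s t + subfbm_cov H s s"
    using i subfbm_kernel_inner[OF C st(1,1)] subfbm_kernel_inner[OF C st(2,2)]
      subfbm_kernel_inner[OF C st] by simp
  also have "\<dots> \<le> \<bar>t - s\<bar> powr (2 * H)"
    by (rule subfbm_cov_increment) (use st H in auto)
  finally show ?thesis .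
qed

lemma subfbm_wiener_integral_is_subfbm:
  assumes C: "subfbm_normalizing H C" and N: "prob_space N" and W: "standard_brownian_motion N W"
    and pair: "\<And>t. t \<in> {0..1} \<Longrightarrow> wiener_pair N W (subfbm_kernel H C t) (X t)"
  shows "subfractional_brownian_motion N H X"
  unfolding subfractional_brownian_motion_def
proof (intro conjI ballI)
  note W' = brownian_unit_increments[OF N W]
  show "gaussian_process N {0..1} X"
    unfolding gaussian_process_def
  proof (intro allI impI)
    fix J :: "real set" and c :: "real \<Rightarrow> real" assume "finite J \<and> J \<subseteq> {0..1}"
    then show "gaussian_rv N (\<lambda>\<omega>. \<Sum>t\<in>J. c t * X t \<omega>)"
      by (intro wiener_pair_gaussian[OF N W wiener_pair_sum[OF W', where f="subfbm_kernel H C"]] pair) auto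
  qed
  have pair0: "wiener_pair N W (subfbm_kernel H C 0) (X 0)" by (rule pair) simp
  have "sq_norm N (X 0) = 0"
    using wiener_pair_isometry[OF W' pair0] by (simp add: sq_norm_def subfbm_kernel_outside)
  then have "AE \<omega> in N. (X 0 \<omega>)\<^sup>2 = 0"
    using wiener_pairD(2)[OF pair0] unfolding sq_norm_def sq_integrable_def
    by (subst (asm) integral_nonneg_eq_0_iff_AE) auto
  then show "AE \<omega> in N. X 0 \<omega> = 0" by simp
  show "has_bochner_integral N (X t) 0" if "t \<in> {0..1}" for t
    by (rule wiener_pair_mean[OF N W pair[OF that]])
  show "has_bochner_integral N (\<lambda>\<omega>. X t \<omega> * X s \<omega>) (subfbm_cov H s t)"
    if "s \<in> {0..1}" "t \<in> {0..1}" for s t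
    using wiener_pair_covariance[OF W' pair[OF that(2)] pair[OF that(1)]]
    by (simp add: subfbm_kernel_inner[OF C that])
qed


section \<open>Dyadic chaining with second moments\<close>

text \<open>The squared increments over all dyadic intervals of length \<open>2\<^sup>-\<^sup>l\<close>, \<open>1 \<le> l \<le> r\<close>, with weights \<open>\<rho>\<^sup>-\<^sup>l\<close>. The
  weights must grow for the Cauchy--Schwarz inequality in \<open>dyadic_chain_square\<close> and grow slowly enough for the
  expectation in \<open>chain_energy_integral\<close> to stay bounded in \<open>r\<close>.\<close>

definition chain_energy :: "real \<Rightarrow> nat \<Rightarrow> (real \<Rightarrow> real) \<Rightarrow> real" where
  "chain_energy \<rho> r y =
     (\<Sum>l=1..r. (\<Sum>k<2^l. (y (real (Suc k) / 2^l) - y (real k / 2^l))\<^sup>2) / \<rho>^l)"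

text \<open>Cutting the last binary digit of \<open>j\<close> moves the point by at most one dyadic interval of level \<open>r\<close>; iterate.\<close>

lemma dyadic_chain:
  fixes y :: "real \<Rightarrow> real"
  assumes "\<And>l k. l \<in> {1..r} \<Longrightarrow> k < 2^l \<Longrightarrow> \<bar>y (real (Suc k) / 2^l) - y (real k / 2^l)\<bar> \<le> d l"
    and "j < 2^r" and d: "\<And>l. 0 \<le> d l"
  shows "\<bar>y (real j / 2^r) - y 0\<bar> \<le> (\<Sum>l=1..r. d l)"
  using assms(1,2)
proof (induction r arbitrary: j)
  case (Suc r)
  have IH: "\<bar>y (real (j div 2) / 2^r) - y 0\<bar> \<le> (\<Sum>l=1..r. d l)"
    using Suc.prems by (intro Suc.IH) auto
  have "\<bar>y (real j / 2^Suc r) - y (real (j div 2) / 2^r)\<bar> \<le> d (Suc r)"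
  proof (cases "even j")
    case True
    then obtain i where "j = 2 * i" by blast
    then show ?thesis using d by simp
  next
    case False
    then obtain i where i: "j = Suc (2 * i)" by (auto elim: oddE)
    have "real (j div 2) / 2^r = real (2 * i) / 2^Suc r" using i by simp
    moreover have "\<bar>y (real (Suc (2 * i)) / 2^Suc r) - y (real (2 * i) / 2^Suc r)\<bar> \<le> d (Suc r)"
      using Suc.prems(2) i by (intro Suc.prems(1)) auto
    ultimately show ?thesis using i by simp
  qed
  with IH show ?case by simp
qed simp

lemma geometric_partial_sum_le:
  assumes "0 < \<rho>" "\<rho> < (1::real)"
  shows "(\<Sum>l=1..r. \<rho>^l) \<le> 1 / (1 - \<rho>)"
proof -
  have "(\<Sum>l=1..r. \<rho>^l) \<le> (\<Sum>l. \<rho>^l)"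
    using assms by (intro sum_le_suminf summable_geometric) auto
  then show ?thesis using assms by (simp add: suminf_geometric)
qed

text \<open>The largest increment of level \<open>l\<close> is at most the root of the sum of the squares of all of them, and
  the sum over \<open>l\<close> is estimated by the Cauchy--Schwarz inequality with the weights \<open>\<rho>\<^sup>l\<close>.\<close>

lemma dyadic_chain_square:
  assumes \<rho>: "0 < \<rho>" "\<rho> < 1" and "j < 2^r"
  shows "(y (real j / 2^r) - y 0)\<^sup>2 \<le> chain_energy \<rho> r y / (1 - \<rho>)"
proof -
  let ?D = "\<lambda>l k. y (real (Suc k) / 2^l) - y (real k / 2^l)"
  define V where "V l = (\<Sum>k<2^l. (?D l k)\<^sup>2)" for l
  have V: "0 \<le> V l" for l by (simp add: V_def sum_nonneg)
  have energy: "chain_energy \<rho> r y = (\<Sum>l=1..r. V l / \<rho>^l)"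
    by (simp only: chain_energy_def V_def)
  have "\<bar>?D l k\<bar> \<le> sqrt (V l)" if "k < 2^l" for l k
  proof -
    have "(?D l k)\<^sup>2 \<le> V l" unfolding V_def by (rule member_le_sum) (use that in auto)
    then have "sqrt ((?D l k)\<^sup>2) \<le> sqrt (V l)" by (rule real_sqrt_le_mono)
    then show ?thesis by simp
  qed
  then have "\<bar>y (real j / 2^r) - y 0\<bar> \<le> (\<Sum>l=1..r. sqrt (V l))"
    by (intro dyadic_chain assms) (auto simp: V)
  then have "(y (real j / 2^r) - y 0)\<^sup>2 \<le> (\<Sum>l=1..r. sqrt (V l))\<^sup>2"
    using power_mono[of "\<bar>y (real j / 2^r) - y 0\<bar>" _ 2] by simp
  also have "\<dots> = (\<Sum>l=1..r. sqrt (\<rho>^l) * sqrt (V l / \<rho>^l))\<^sup>2"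
    using \<rho> by (simp add: real_sqrt_divide)
  also have "\<dots> \<le> (\<Sum>l=1..r. (sqrt (\<rho>^l))\<^sup>2) * (\<Sum>l=1..r. (sqrt (V l / \<rho>^l))\<^sup>2)"
    by (rule Cauchy_Schwarz_ineq_sum)
  also have "\<dots> = (\<Sum>l=1..r. \<rho>^l) * chain_energy \<rho> r y"
    using \<rho> V by (simp add: energy)
  also have "\<dots> \<le> 1 / (1 - \<rho>) * chain_energy \<rho> r y"
    using \<rho> V by (intro mult_right_mono geometric_partial_sum_le)
      (auto simp: energy intro!: sum_nonneg)
  finally show ?thesis by simp
qed

text \<open>Level \<open>l\<close> has \<open>2\<^sup>l\<close> intervals, each contributing at most \<open>c (\<rho>\<^sup>2/2)\<^sup>l \<rho>\<^sup>-\<^sup>l\<close>, so the expectation is bounded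
  by the geometric series \<open>c \<Sum>\<rho>\<^sup>l\<close>, for every \<open>r\<close>.\<close>

lemma chain_energy_integral:
  assumes \<rho>: "0 < \<rho>" "\<rho> < 1" and c: "0 \<le> c"
    and sq: "\<And>l k. l \<in> {1..r} \<Longrightarrow> k < 2^l \<Longrightarrow>
      sq_integrable M (\<lambda>\<omega>. Y (real (Suc k) / 2^l) \<omega> - Y (real k / 2^l) \<omega>)"
    and bound: "\<And>l k. l \<in> {1..r} \<Longrightarrow> k < 2^l \<Longrightarrow>
      sq_norm M (\<lambda>\<omega>. Y (real (Suc k) / 2^l) \<omega> - Y (real k / 2^l) \<omega>) \<le> c * (\<rho>\<^sup>2 / 2)^l"
  shows "integrable M (\<lambda>\<omega>. chain_energy \<rho> r (\<lambda>\<tau>. Y \<tau> \<omega>))"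
    and "(\<integral>\<omega>. chain_energy \<rho> r (\<lambda>\<tau>. Y \<tau> \<omega>) \<partial>M) \<le> c / (1 - \<rho>)"
proof -
  let ?D = "\<lambda>l k \<omega>. Y (real (Suc k) / 2^l) \<omega> - Y (real k / 2^l) \<omega>"
  have i: "integrable M (\<lambda>\<omega>. (?D l k \<omega>)\<^sup>2)" if "l \<in> {1..r}" "k < 2^l" for l k
    using sq[OF that] by (rule sq_integrableD)
  show "integrable M (\<lambda>\<omega>. chain_energy \<rho> r (\<lambda>\<tau>. Y \<tau> \<omega>))"
    unfolding chain_energy_def
    by (intro Bochner_Integration.integrable_sum integrable_divide i) auto
  have "(\<integral>\<omega>. chain_energy \<rho> r (\<lambda>\<tau>. Y \<tau> \<omega>) \<partial>M) = (\<Sum>l=1..r. \<integral>\<omega>. (\<Sum>k<2^l. (?D l k \<omega>)\<^sup>2) / \<rho>^l \<partial>M)"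
    unfolding chain_energy_def
    by (intro Bochner_Integration.integral_sum Bochner_Integration.integrable_sum integrable_divide i) auto
  also have "\<dots> = (\<Sum>l=1..r. (\<Sum>k<2^l. sq_norm M (?D l k)) / \<rho>^l)"
  proof (rule sum.cong[OF refl])
    fix l assume l: "l \<in> {1..r}"
    have "(\<integral>\<omega>. (\<Sum>k<2^l. (?D l k \<omega>)\<^sup>2) \<partial>M) = (\<Sum>k<2^l. sq_norm M (?D l k))"
      unfolding sq_norm_def by (intro Bochner_Integration.integral_sum i l) auto
    then show "(\<integral>\<omega>. (\<Sum>k<2^l. (?D l k \<omega>)\<^sup>2) / \<rho>^l \<partial>M) = (\<Sum>k<2^l. sq_norm M (?D l k)) / \<rho>^l"
      by (simp only: integral_divide_zero)
  qed
  also have "\<dots> \<le> (\<Sum>l=1..r. c * \<rho>^l)"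
  proof (rule sum_mono)
    fix l assume l: "l \<in> {1..r}"
    have "(\<Sum>k<2^l. sq_norm M (?D l k)) \<le> (\<Sum>k<(2::nat)^l. c * (\<rho>\<^sup>2 / 2)^l)"
      by (intro sum_mono bound l) auto
    also have "\<dots> = c * \<rho>^l * \<rho>^l" by (simp add: power_divide power2_eq_square power_mult_distrib)
    finally show "(\<Sum>k<2^l. sq_norm M (?D l k)) / \<rho>^l \<le> c * \<rho>^l"
      using \<rho> by (simp add: field_simps)
  qed
  also have "\<dots> = c * (\<Sum>l=1..r. \<rho>^l)" by (simp add: sum_distrib_left)
  also have "\<dots> \<le> c * (1 / (1 - \<rho>))"
    using c geometric_partial_sum_le[OF \<rho>] by (rule mult_left_mono[rotated])
  finally show "(\<integral>\<omega>. chain_energy \<rho> r (\<lambda>\<tau>. Y \<tau> \<omega>) \<partial>M) \<le> c / (1 - \<rho>)" by simp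
qed

section \<open>Weak convergence from Lipschitz test functions\<close>

text \<open>The largest function below \<open>f\<close> that is \<open>k\<close>-Lipschitz.\<close>

definition lipschitz_env :: "nat \<Rightarrow> ('a :: metric_space \<Rightarrow> real) \<Rightarrow> 'a \<Rightarrow> real" where
  "lipschitz_env k f x = (INF y. f y + real k * dist x y)"

lemma lipschitz_env:
  assumes B: "\<And>x. \<bar>f x\<bar> \<le> B"
  shows "\<bar>lipschitz_env k f x\<bar> \<le> B" "lipschitz_env k f x \<le> f x"
    "\<bar>lipschitz_env k f x - lipschitz_env k f z\<bar> \<le> real k * dist x z"
proof -
  have lower: "- B \<le> f y + real k * dist x y" for x y
  proof -
    have "0 \<le> real k * dist x y" by simp
    with B[of y] show ?thesis by linarith
  qed
  then have bdd: "bdd_below (range (\<lambda>y. f y + real k * dist x y))" for x by (intro bdd_belowI2) auto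
  have le: "lipschitz_env k f x \<le> f y + real k * dist x y" for x y
    unfolding lipschitz_env_def by (rule cINF_lower[OF bdd]) simp
  show le_f: "lipschitz_env k f x \<le> f x" using le[of x x] by simp
  have "- B \<le> lipschitz_env k f x"
    unfolding lipschitz_env_def by (rule cINF_greatest) (use lower in auto)
  with le_f B[of x] show "\<bar>lipschitz_env k f x\<bar> \<le> B" by linarith
  have half: "lipschitz_env k f x \<le> lipschitz_env k f z + real k * dist x z" for x z
  proof -
    have "lipschitz_env k f x - real k * dist x z \<le> f y + real k * dist z y" for y
    proof -
      have "real k * dist x y \<le> real k * dist x z + real k * dist z y"
        unfolding distrib_left[symmetric] by (intro mult_left_mono dist_triangle) simp
      with le[of x y] show ?thesis by linarith
    qed
    then have "lipschitz_env k f x - real k * dist x z \<le> lipschitz_env k f z"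
      unfolding lipschitz_env_def[of k f z] by (intro cINF_greatest) auto
    then show ?thesis by simp
  qed
  show "\<bar>lipschitz_env k f x - lipschitz_env k f z\<bar> \<le> real k * dist x z"
    using half[of x z] half[of z x] by (simp add: dist_commute abs_le_iff)
qed

lemma lipschitz_env_tendsto:
  assumes B: "\<And>x. \<bar>f x\<bar> \<le> B" and cont: "continuous_on UNIV f"
  shows "(\<lambda>k. lipschitz_env k f x) \<longlonglongrightarrow> f x"
proof (rule tendstoI)
  fix e :: real assume e: "0 < e"
  have "isCont f x" using cont by (simp add: continuous_on_eq_continuous_at)
  then obtain d where d: "0 < d" "\<And>y. dist y x < d \<Longrightarrow> dist (f y) (f x) < e / 2"
    using e unfolding continuous_at_eps_delta by (metis half_gt_zero)
  have "dist (lipschitz_env k f x) (f x) < e" if k: "2 * B / d \<le> real k" for k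
  proof -
    have "f x - e / 2 \<le> f y + real k * dist x y" for y
    proof (cases "dist y x < d")
      case True
      have "0 \<le> real k * dist x y" by simp
      with d(2)[OF True] show ?thesis unfolding dist_real_def by linarith
    next
      case False
      then have "2 * B \<le> real k * d" using k d by (simp add: field_simps)
      also have "\<dots> \<le> real k * dist x y"
        using False by (intro mult_left_mono) (auto simp: dist_commute)
      finally show ?thesis using B[of x] B[of y] e by linarith
    qed
    then have "f x - e / 2 \<le> lipschitz_env k f x"
      unfolding lipschitz_env_def by (intro cINF_greatest) auto
    with lipschitz_env(2)[where f=f, OF B, of k x] e show ?thesis
      unfolding dist_real_def by linarith
  qed
  moreover have "\<forall>\<^sub>F k in sequentially. 2 * B / d \<le> real k"
    using filterlim_real_sequentially by (simp add: filterlim_at_top)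
  ultimately show "\<forall>\<^sub>F k in sequentially. dist (lipschitz_env k f x) (f x) < e"
    by (auto elim: eventually_mono)
qed

lemma continuous_on_lipschitz:
  fixes f :: "'a :: metric_space \<Rightarrow> real"
  assumes "\<And>x y. \<bar>f x - f y\<bar> \<le> L * dist x y"
  shows "continuous_on UNIV f"
proof -
  have "(\<bar>L\<bar>)-lipschitz_on UNIV f"
  proof (rule lipschitz_onI)
    show "dist (f x) (f y) \<le> \<bar>L\<bar> * dist x y" for x y
      using assms[of x y] mult_right_mono[OF abs_ge_self[of L] zero_le_dist[of x y]]
      by (simp add: dist_real_def)
  qed simp
  then show ?thesis by (rule lipschitz_on_continuous_on)
qed

lemma bounded_continuous_integrable:
  fixes f :: "'a :: metric_space \<Rightarrow> real"
  assumes "prob_space \<mu>" "sets \<mu> = sets borel" "continuous_on UNIV f" "\<And>x. \<bar>f x\<bar> \<le> B"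
  shows "integrable \<mu> f"
proof -
  interpret prob_space \<mu> by fact
  have "f \<in> borel_measurable \<mu>"
    using borel_measurable_continuous_onI[OF assms(3)] assms(2) measurable_cong_sets by blast
  then show ?thesis
    by (rule integrable_const_bound[of _ B, rotated]) (use assms(4) in auto)
qed

text \<open>A bounded continuous \<open>f\<close> is the increasing limit of its Lipschitz envelopes, which yields the lower bound
  for \<open>liminf\<close>; the upper bound is the same statement for \<open>-f\<close>.\<close>

lemma weakly_converges_if_lipschitz:
  fixes \<mu> :: "nat \<Rightarrow> 'a :: metric_space measure"
  assumes \<mu>: "\<And>n. prob_space (\<mu> n)" "\<And>n. sets (\<mu> n) = sets borel"
    and \<nu>: "prob_space \<nu>" "sets \<nu> = sets borel"
    and lim: "\<And>f L B. (\<And>x y. \<bar>f x - f y\<bar> \<le> L * dist x y) \<Longrightarrow> (\<And>x. \<bar>f x\<bar> \<le> B) \<Longrightarrow>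
      (\<lambda>n. integral\<^sup>L (\<mu> n) f) \<longlonglongrightarrow> integral\<^sup>L \<nu> f"
  shows "weakly_converges \<mu> \<nu>"
  unfolding weakly_converges_def
proof (intro allI impI)
  have lower: "\<forall>\<^sub>F n in sequentially. integral\<^sup>L \<nu> f - e < integral\<^sup>L (\<mu> n) f"
    if cont: "continuous_on UNIV f" and B: "\<And>x. \<bar>f x\<bar> \<le> B" and e: "0 < e" for f :: "'a \<Rightarrow> real" and B e
  proof -
    note env = lipschitz_env[where f=f, OF B]
    have env_cont: "continuous_on UNIV (lipschitz_env k f)" for k
      by (rule continuous_on_lipschitz[OF env(3)])
    interpret prob_space \<nu> by fact
    have "(\<lambda>k. integral\<^sup>L \<nu> (lipschitz_env k f)) \<longlonglongrightarrow> integral\<^sup>L \<nu> f"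
    proof (rule integral_dominated_convergence[where w="\<lambda>_. B"])
      show "f \<in> borel_measurable \<nu>" "\<And>k. lipschitz_env k f \<in> borel_measurable \<nu>"
        using bounded_continuous_integrable[OF \<nu> cont B]
          bounded_continuous_integrable[OF \<nu> env_cont env(1)] by auto
      show "AE x in \<nu>. (\<lambda>k. lipschitz_env k f x) \<longlonglongrightarrow> f x"
        using lipschitz_env_tendsto[OF B cont] by simp
    qed (use env(1) in auto)
    then have "\<forall>\<^sub>F k in sequentially. integral\<^sup>L \<nu> f - e / 2 < integral\<^sup>L \<nu> (lipschitz_env k f)"
      by (rule order_tendstoD) (use e in simp)
    then obtain k where k: "integral\<^sup>L \<nu> f - e / 2 < integral\<^sup>L \<nu> (lipschitz_env k f)"
      by (auto simp: eventually_sequentially)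
    have "\<forall>\<^sub>F n in sequentially.
        integral\<^sup>L \<nu> (lipschitz_env k f) - e / 2 < integral\<^sup>L (\<mu> n) (lipschitz_env k f)"
      by (rule order_tendstoD(1)[OF lim[OF env(3,1)]]) (use e in simp)
    then show ?thesis
    proof eventually_elim
      case (elim n)
      have "integral\<^sup>L (\<mu> n) (lipschitz_env k f) \<le> integral\<^sup>L (\<mu> n) f"
        by (intro integral_mono bounded_continuous_integrable[OF \<mu> env_cont env(1)]
            bounded_continuous_integrable[OF \<mu> cont B] env(2))
      with elim k show ?case by linarith
    qed
  qed
  fix f :: "'a \<Rightarrow> real" assume f: "continuous_on UNIV f \<and> bounded (range f)"
  then obtain B where B: "\<bar>f x\<bar> \<le> B" for x by (auto simp: bounded_iff)
  show "(\<lambda>n. integral\<^sup>L (\<mu> n) f) \<longlonglongrightarrow> integral\<^sup>L \<nu> f"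
  proof (rule tendstoI)
    fix e :: real assume e: "0 < e"
    have "\<forall>\<^sub>F n in sequentially. integral\<^sup>L \<nu> (\<lambda>x. - f x) - e < integral\<^sup>L (\<mu> n) (\<lambda>x. - f x)"
      by (rule lower[where B=B]) (use f B e in \<open>auto intro: continuous_intros\<close>)
    moreover have "\<forall>\<^sub>F n in sequentially. integral\<^sup>L \<nu> f - e < integral\<^sup>L (\<mu> n) f"
      by (rule lower[where B=B]) (use f B e in auto)
    ultimately show "\<forall>\<^sub>F n in sequentially. dist (integral\<^sup>L (\<mu> n) f) (integral\<^sup>L \<nu> f) < e"
      by eventually_elim (simp add: dist_real_def abs_less_iff)
  qed
qed


section \<open>Step paths in the Skorohod space\<close>

text \<open>At \<open>t = 1\<close> the index \<open>m\<close> is reached, so the path depends on \<open>v 0, \<dots>, v m\<close>.\<close>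

definition grid_path :: "nat \<Rightarrow> (nat \<Rightarrow> real) \<Rightarrow> real \<Rightarrow> real" where
  "grid_path m v t = v (nat \<lfloor>real m * t\<rfloor>)"

lemma cadlag_grid_path: "cadlag (grid_path m v)"
proof (cases "m = 0")
  case True
  then have "grid_path m v = (\<lambda>_. v 0)" by (simp add: grid_path_def fun_eq_iff)
  then show ?thesis by (auto simp: cadlag_def)
next
  case False
  then have m: "0 < real m" by simp
  show ?thesis
    unfolding cadlag_def
  proof (intro conjI ballI)
    fix t :: real assume "t \<in> {0..<1}"
    define b where "b = (real_of_int \<lfloor>real m * t\<rfloor> + 1) / real m"
    have "real m * t < real_of_int \<lfloor>real m * t\<rfloor> + 1" by linarith
    then have "t < b" using m by (simp add: b_def pos_less_divide_eq mult.commute)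
    have "grid_path m v u = grid_path m v t" if "t < u" "u < b" for u
    proof -
      have "real m * t < real m * u" "real m * u < real_of_int \<lfloor>real m * t\<rfloor> + 1"
        using that m by (simp_all add: b_def field_simps)
      then have "\<lfloor>real m * u\<rfloor> = \<lfloor>real m * t\<rfloor>" by linarith
      then show ?thesis by (simp add: grid_path_def)
    qed
    then have "\<forall>\<^sub>F u in at_right t. grid_path m v u = grid_path m v t"
      using \<open>t < b\<close> by (auto simp: eventually_at_right_field)
    then show "(grid_path m v \<longlongrightarrow> grid_path m v t) (at_right t)"
      by (rule tendsto_eventually)
  next
    fix t :: real assume "t \<in> {0<..1}"
    define c where "c = \<lceil>real m * t\<rceil> - 1"
    define a where "a = real_of_int c / real m"
    have "a < t" using m unfolding a_def c_def by (simp add: field_simps) linarith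
    have "grid_path m v u = v (nat c)" if "a < u" "u < t" for u
    proof -
      have "real_of_int c < real m * u" "real m * u < real m * t"
        using that m by (simp_all add: a_def field_simps)
      then have "\<lfloor>real m * u\<rfloor> = c" unfolding c_def by linarith
      then show ?thesis by (simp add: grid_path_def)
    qed
    then have "\<forall>\<^sub>F u in at_left t. grid_path m v u = v (nat c)"
      using \<open>a < t\<close> by (auto simp: eventually_at_left_field)
    then show "\<exists>l. (grid_path m v \<longlongrightarrow> l) (at_left t)"
      by (intro exI tendsto_eventually)
  qed
qed

lemma dist_to_skorohod_le:
  assumes "cadlag f" "cadlag g" "\<And>t. t \<in> {0..1} \<Longrightarrow> \<bar>f t - g t\<bar> \<le> e"
  shows "dist (to_skorohod f) (to_skorohod g) \<le> e"
proof (rule skorohod_dist_le[OF id_time_change])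
  fix t :: real assume t: "t \<in> {0..1}"
  have "0 \<le> e" using assms(3)[OF t] by linarith
  then show "\<bar>t - t\<bar> \<le> e \<and> \<bar>path_of (to_skorohod f) t - path_of (to_skorohod g) t\<bar> \<le> e"
    using assms t by (simp add: path_of_to_skorohod)
qed

lemma nat_floor_le: "t \<in> {0..1} \<Longrightarrow> nat \<lfloor>real m * t\<rfloor> \<le> m"
  using mult_left_le[of t "real m"] by (simp add: nat_le_iff floor_le_iff)

lemma dist_grid_path_le:
  "dist (to_skorohod (grid_path m v)) (to_skorohod (grid_path m w)) \<le> (\<Sum>i\<le>m. \<bar>v i - w i\<bar>)"
proof (rule dist_to_skorohod_le[OF cadlag_grid_path cadlag_grid_path])
  fix t :: real assume "t \<in> {0..1}"
  then show "\<bar>grid_path m v t - grid_path m w t\<bar> \<le> (\<Sum>i\<le>m. \<bar>v i - w i\<bar>)"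
    unfolding grid_path_def by (intro member_le_sum) (auto intro: nat_floor_le)
qed

lemma continuous_on_grid_path: "continuous_on UNIV (\<lambda>v. to_skorohod (grid_path m v))"
proof -
  have "((\<lambda>v. to_skorohod (grid_path m v)) \<longlongrightarrow> to_skorohod (grid_path m w)) (at w)" for w
  proof -
    have coord: "((\<lambda>v. v i) \<longlongrightarrow> w i) (at w)" for i
    proof -
      have "continuous_on UNIV (\<lambda>v :: nat \<Rightarrow> real. v i)" by (rule continuous_on_product_coordinates)
      then show ?thesis by (simp add: continuous_on_def del: continuous_on_product_coordinates)
    qed
    have "((\<lambda>v. \<Sum>i\<le>m. \<bar>v i - w i\<bar>) \<longlongrightarrow> (\<Sum>i\<le>m. \<bar>w i - w i\<bar>)) (at w)"
      by (intro tendsto_intros coord)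
    then have "((\<lambda>v. \<Sum>i\<le>m. \<bar>v i - w i\<bar>) \<longlongrightarrow> 0) (at w)" by simp
    then have "((\<lambda>v. dist (to_skorohod (grid_path m v)) (to_skorohod (grid_path m w))) \<longlongrightarrow> 0) (at w)"
      by (rule tendsto_sandwich[OF _ _ tendsto_const, rotated 2])
         (auto intro!: always_eventually dist_grid_path_le)
    then show ?thesis by (simp add: tendsto_dist_iff[symmetric])
  qed
  then show ?thesis by (simp add: continuous_on_def)
qed

text \<open>The step path is a continuous function of the sequence of its values, in the product topology, for which
  the Borel sets are generated by the coordinates.\<close>

lemma measurable_grid_path:
  assumes "\<And>i. v i \<in> borel_measurable M"
  shows "(\<lambda>\<omega>. to_skorohod (grid_path m (\<lambda>i. v i \<omega>))) \<in> borel_measurable M"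
proof -
  have "(\<lambda>\<omega> i. v i \<omega>) \<in> borel_measurable M"
    by (rule measurable_coordinatewise_then_product) (rule assms)
  then show ?thesis
    by (rule measurable_compose) (rule borel_measurable_continuous_onI[OF continuous_on_grid_path])
qed

section \<open>Replacing a path by its values on a coarse grid\<close>

text \<open>The majorant \<open>G\<close> avoids the question whether the distance of two random elements of a metric space
  that need not be separable is measurable.\<close>

definition mean_square_close ::
    "'a measure \<Rightarrow> ('a \<Rightarrow> 'b :: metric_space) \<Rightarrow> ('a \<Rightarrow> 'b) \<Rightarrow> real \<Rightarrow> bool" where
  "mean_square_close M U V B \<longleftrightarrow> (\<exists>G \<in> borel_measurable M.
     (\<integral>\<^sup>+\<omega>. G \<omega> \<partial>M) \<le> ennreal B \<and> (\<forall>\<omega>\<in>space M. ennreal ((dist (U \<omega>) (V \<omega>))\<^sup>2) \<le> G \<omega>))"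

lemma (in prob_space) mean_square_close_expectation:
  fixes f :: "'b :: metric_space \<Rightarrow> real"
  assumes close: "mean_square_close M U V B" and meas: "U \<in> borel_measurable M" "V \<in> borel_measurable M"
    and f: "\<And>x y. \<bar>f x - f y\<bar> \<le> L * dist x y" "\<And>x. \<bar>f x\<bar> \<le> A" and d: "0 < d" and B: "0 \<le> B"
  shows "\<bar>(\<integral>\<omega>. f (U \<omega>) \<partial>M) - (\<integral>\<omega>. f (V \<omega>) \<partial>M)\<bar> \<le> d + L\<^sup>2 * B / d"
proof -
  obtain G where G: "G \<in> borel_measurable M" "(\<integral>\<^sup>+\<omega>. G \<omega> \<partial>M) \<le> ennreal B"
    "\<And>\<omega>. \<omega> \<in> space M \<Longrightarrow> ennreal ((dist (U \<omega>) (V \<omega>))\<^sup>2) \<le> G \<omega>"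
    using close unfolding mean_square_close_def by blast
  have "f \<in> borel_measurable borel"
    by (rule borel_measurable_continuous_onI[OF continuous_on_lipschitz[OF f(1)]])
  then have fm: "(\<lambda>\<omega>. f (U \<omega>)) \<in> borel_measurable M" "(\<lambda>\<omega>. f (V \<omega>)) \<in> borel_measurable M"
    using meas by (auto intro: measurable_compose)
  have i: "integrable M (\<lambda>\<omega>. f (U \<omega>))" "integrable M (\<lambda>\<omega>. f (V \<omega>))"
    by (rule integrable_const_bound[of _ A]; use f(2) fm in simp)+
  let ?D = "\<lambda>\<omega>. f (U \<omega>) - f (V \<omega>)"
  have "(\<integral>\<^sup>+\<omega>. ennreal ((?D \<omega>)\<^sup>2) \<partial>M) \<le> (\<integral>\<^sup>+\<omega>. ennreal (L\<^sup>2) * G \<omega> \<partial>M)"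
  proof (rule nn_integral_mono)
    fix \<omega> assume \<omega>: "\<omega> \<in> space M"
    have "\<bar>?D \<omega>\<bar>\<^sup>2 \<le> (L * dist (U \<omega>) (V \<omega>))\<^sup>2"
      by (rule power_mono[OF f(1)]) simp
    then have "ennreal ((?D \<omega>)\<^sup>2) \<le> ennreal (L\<^sup>2) * ennreal ((dist (U \<omega>) (V \<omega>))\<^sup>2)"
      by (simp add: power_mult_distrib ennreal_mult[symmetric] ennreal_leI)
    also have "\<dots> \<le> ennreal (L\<^sup>2) * G \<omega>" by (intro mult_left_mono G(3) \<omega>) simp
    finally show "ennreal ((?D \<omega>)\<^sup>2) \<le> ennreal (L\<^sup>2) * G \<omega>" .
  qed
  also have "\<dots> = ennreal (L\<^sup>2) * (\<integral>\<^sup>+\<omega>. G \<omega> \<partial>M)" by (rule nn_integral_cmult[OF G(1)])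
  also have "\<dots> \<le> ennreal (L\<^sup>2) * ennreal B" by (intro mult_left_mono G(2)) simp
  also have "\<dots> = ennreal (L\<^sup>2 * B)" using B by (simp add: ennreal_mult)
  finally have le: "(\<integral>\<^sup>+\<omega>. ennreal ((?D \<omega>)\<^sup>2) \<partial>M) \<le> ennreal (L\<^sup>2 * B)" .
  have int: "integrable M (\<lambda>\<omega>. (?D \<omega>)\<^sup>2)"
    by (rule integrableI_nonneg) (use fm le_less_trans[OF le] in auto)
  then have sq: "sq_integrable M ?D" using fm by (auto simp: sq_integrable_def)
  have "ennreal (sq_norm M ?D) \<le> ennreal (L\<^sup>2 * B)"
    using le nn_integral_eq_integral[OF int] by (simp add: sq_norm_def)
  then have norm: "sq_norm M ?D \<le> L\<^sup>2 * B" using B by (simp add: ennreal_le_iff)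
  have "\<bar>(\<integral>\<omega>. f (U \<omega>) \<partial>M) - (\<integral>\<omega>. f (V \<omega>) \<partial>M)\<bar> = \<bar>\<integral>\<omega>. ?D \<omega> \<partial>M\<bar>" using i by simp
  also have "\<dots> \<le> (\<integral>\<omega>. \<bar>?D \<omega>\<bar> \<partial>M)" by (rule integral_abs_bound)
  also have "\<dots> \<le> d + sq_norm M ?D / d" by (rule integral_abs_le_sq_norm[OF sq d])
  also have "\<dots> \<le> d + L\<^sup>2 * B / d" using norm d by (intro add_left_mono divide_right_mono) auto
  finally show ?thesis .
qed

text \<open>Chosen so that \<open>\<rho>\<^sup>2/2 = 2\<^sup>-\<^sup>p\<close>: an increment over a dyadic interval of level \<open>l\<close> has second moment of order
  \<open>(2\<^sup>-\<^sup>p)\<^sup>l\<close>. It is less than 1 exactly when \<open>p > 1\<close>.\<close>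

definition chain_ratio :: "real \<Rightarrow> real" where
  "chain_ratio p = 2 powr ((1 - p) / 2)"

text \<open>There are \<open>m + 1\<close> blocks, and chaining in each costs the square of the geometric series in
  \<open>chain_ratio p\<close>. The block length, rounded up to a power of 2 grid steps, is at most \<open>4/m\<close>.\<close>

definition modulus_bound :: "real \<Rightarrow> nat \<Rightarrow> real" where
  "modulus_bound p m = real (Suc m) * (4 / m) powr p / (1 - chain_ratio p)\<^sup>2"

lemma chain_ratio:
  assumes "1 < p"
  shows "0 < chain_ratio p" "chain_ratio p < 1" "(chain_ratio p)\<^sup>2 / 2 = 2 powr (- p)"
proof -
  show "0 < chain_ratio p" by (simp add: chain_ratio_def)
  show "chain_ratio p < 1" using assms by (simp add: chain_ratio_def powr_less_one)
  have "(chain_ratio p)\<^sup>2 = 2 powr (1 - p)"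
    by (simp add: chain_ratio_def power2_eq_square powr_add[symmetric])
  also have "\<dots> = 2 * 2 powr (- p)" by (simp add: powr_diff powr_minus field_simps)
  finally show "(chain_ratio p)\<^sup>2 / 2 = 2 powr (- p)" by simp
qed

lemma modulus_bound_nonneg: "0 \<le> modulus_bound p m"
  by (simp add: modulus_bound_def)

lemma modulus_bound_tendsto_0:
  assumes "1 < p"
  shows "modulus_bound p \<longlonglongrightarrow> 0"
proof -
  have "(\<lambda>m. real (Suc m) * (4 / real m) powr p) \<longlonglongrightarrow> 0"
    using assms by real_asymp
  then have "(\<lambda>m. real (Suc m) * (4 / real m) powr p / (1 - chain_ratio p)\<^sup>2)
      \<longlonglongrightarrow> 0 / (1 - chain_ratio p)\<^sup>2"
    using chain_ratio(2)[OF assms] by (intro tendsto_divide tendsto_const) auto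
  then show ?thesis by (simp add: modulus_bound_def[abs_def])
qed

lemma powr_scale_dyadic:
  fixes x p :: real
  assumes "l \<le> R" "0 \<le> x"
  shows "(2 ^ (R - l) * x) powr p = (2 ^ R * x) powr p * (2 powr (- p)) ^ l"
proof -
  have "(2::real) ^ (R - l) = 2 ^ R * 2 powr (- real l)"
    using assms(1) by (simp add: powr_minus powr_realpow power_diff divide_inverse)
  then have "(2 ^ (R - l) * x) powr p = (2 ^ R * x * 2 powr (- real l)) powr p" by (simp add: ac_simps)
  also have "\<dots> = (2 ^ R * x) powr p * (2 powr (- real l)) powr p"
    using assms(2) by (intro powr_mult) 
  also have "(2 powr (- real l)) powr p = (2 powr (- p)) powr (real l)"
    by (simp add: powr_powr mult.commute)
  also have "\<dots> = (2 powr (- p)) ^ l" by (rule powr_realpow) simp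
  finally show ?thesis .
qed

text \<open>The index range is cut into blocks that start at \<open>\<lfloor>in/m\<rfloor>\<close>. A block of at most \<open>n/m + 1\<close> steps
  is chained on \<open>2\<^sup>R\<close> grid points, which are truncated at \<open>n\<close>.\<close>

lemma grid_process_modulus:
  fixes S :: "nat \<Rightarrow> 'a \<Rightarrow> real" and m n :: nat
  assumes p: "1 < p" and m: "0 < m" "m \<le> n"
    and sq: "\<And>i j. i \<le> n \<Longrightarrow> j \<le> n \<Longrightarrow> sq_integrable M (\<lambda>\<omega>. S j \<omega> - S i \<omega>)"
    and inc: "\<And>i j. i \<le> j \<Longrightarrow> j \<le> n \<Longrightarrow> sq_norm M (\<lambda>\<omega>. S j \<omega> - S i \<omega>) \<le> (real (j - i) / n) powr p"
  shows "mean_square_close M (\<lambda>\<omega>. to_skorohod (grid_path n (\<lambda>j. S j \<omega>)))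
    (\<lambda>\<omega>. to_skorohod (grid_path m (\<lambda>i. S (i * n div m) \<omega>))) (modulus_bound p m)"
proof -
  let ?\<rho> = "chain_ratio p"
  note \<rho> = chain_ratio[OF p]
  define q where "q = n div m + 1"
  have "1 \<le> q" by (simp add: q_def)
  then obtain r where r: "2 ^ r \<le> q" "q < 2 ^ (r + 1)"
    using ex_power_ivl1[of 2 q] by auto
  define R where "R = r + 1"
  define c where "c = (2 ^ R / real n) powr p"
  have n: "0 < n" using m by simp
  have cle: "c \<le> (4 / real m) powr p"
  proof -
    have "real (n div m) \<le> real n / real m" by (rule of_nat_div_le_of_nat)
    then have "real q \<le> real n / real m + 1" by (simp add: q_def)
    also have "1 \<le> real n / real m" using m by simp
    finally have "2 * real q \<le> 4 * real n / real m" by linarith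
    moreover have "real (2 ^ r) \<le> real q" using r(1) by (rule of_nat_mono)
    then have "2 ^ R \<le> 2 * real q" by (simp add: R_def)
    ultimately have "2 ^ R \<le> 4 * real n / real m" by linarith
    then have "2 ^ R / real n \<le> 4 / real m" using n m by (simp add: field_simps)
    then show ?thesis unfolding c_def using p by (intro powr_mono2) auto
  qed
  define Y where "Y i \<tau> \<omega> = S (min n (i * n div m + nat \<lfloor>\<tau> * 2 ^ R\<rfloor>)) \<omega>" for i and \<tau> :: real and \<omega>
  have Y_dyadic: "Y i (real k / 2 ^ l) = S (min n (i * n div m + k * 2 ^ (R - l)))" if "l \<le> R" for i k l
  proof -
    have "(2 :: real) ^ R = 2 ^ (R - l) * 2 ^ l" using that by (simp add: power_add[symmetric])
    then have "real k / 2 ^ l * 2 ^ R = real (k * 2 ^ (R - l))" by simp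
    then show ?thesis by (simp only: Y_def fun_eq_iff floor_of_nat nat_int) simp
  qed
  have Ysq: "sq_integrable M (\<lambda>\<omega>. Y i (real (Suc k) / 2 ^ l) \<omega> - Y i (real k / 2 ^ l) \<omega>)"
    and Yinc: "sq_norm M (\<lambda>\<omega>. Y i (real (Suc k) / 2 ^ l) \<omega> - Y i (real k / 2 ^ l) \<omega>) \<le> c * (?\<rho>\<^sup>2 / 2) ^ l"
    if l: "l \<in> {1..R}" for i k l
  proof -
    let ?a = "min n (i * n div m + k * 2 ^ (R - l))" and ?b = "min n (i * n div m + Suc k * 2 ^ (R - l))"
    have lR: "l \<le> R" using l by simp
    have ab: "?a \<le> ?b" "?b \<le> n" "?b - ?a \<le> 2 ^ (R - l)" by auto
    show "sq_integrable M (\<lambda>\<omega>. Y i (real (Suc k) / 2 ^ l) \<omega> - Y i (real k / 2 ^ l) \<omega>)"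
      unfolding Y_dyadic[OF lR] by (rule sq) auto
    have "sq_norm M (\<lambda>\<omega>. S ?b \<omega> - S ?a \<omega>) \<le> (real (?b - ?a) / n) powr p"
      by (rule inc[OF ab(1,2)])
    also have "\<dots> \<le> (2 ^ (R - l) * (1 / n)) powr p"
    proof (rule powr_mono2)
      have "real (?b - ?a) \<le> real (2 ^ (R - l))" using ab(3) by (rule of_nat_mono)
      then have "real (?b - ?a) / n \<le> real (2 ^ (R - l)) / n" by (rule divide_right_mono) simp
      then show "real (?b - ?a) / n \<le> 2 ^ (R - l) * (1 / n)" by (simp only: of_nat_power of_nat_numeral times_divide_eq_right mult_1_right)
    qed (use p in auto)
    also have "\<dots> = c * (?\<rho>\<^sup>2 / 2) ^ l"
      unfolding \<rho>(3) c_def using powr_scale_dyadic[OF lR, of "1 / n" p] by simp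
    finally show "sq_norm M (\<lambda>\<omega>. Y i (real (Suc k) / 2 ^ l) \<omega> - Y i (real k / 2 ^ l) \<omega>) \<le> c * (?\<rho>\<^sup>2 / 2) ^ l"
      unfolding Y_dyadic[OF lR] .
  qed
  define G where "G \<omega> = (\<Sum>i\<le>m. chain_energy ?\<rho> R (\<lambda>\<tau>. Y i \<tau> \<omega>) / (1 - ?\<rho>))" for \<omega>
  have c0: "0 \<le> c" by (simp add: c_def)
  have E: "integrable M (\<lambda>\<omega>. chain_energy ?\<rho> R (\<lambda>\<tau>. Y i \<tau> \<omega>))"
    "(\<integral>\<omega>. chain_energy ?\<rho> R (\<lambda>\<tau>. Y i \<tau> \<omega>) \<partial>M) \<le> c / (1 - ?\<rho>)" for i
    by (rule chain_energy_integral[OF \<rho>(1,2) c0 Ysq Yinc]; assumption)+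
  have Gint: "integrable M G" unfolding G_def[abs_def] using E(1) by auto
  have energy_nonneg: "0 \<le> chain_energy ?\<rho> R y" for y
    unfolding chain_energy_def using \<rho> by (intro sum_nonneg divide_nonneg_nonneg) auto
  have G0: "0 \<le> G \<omega>" for \<omega>
    unfolding G_def using \<rho> energy_nonneg by (intro sum_nonneg divide_nonneg_nonneg) auto
  have "(\<integral>\<omega>. G \<omega> \<partial>M) = (\<Sum>i\<le>m. (\<integral>\<omega>. chain_energy ?\<rho> R (\<lambda>\<tau>. Y i \<tau> \<omega>) \<partial>M) / (1 - ?\<rho>))"
    unfolding G_def using E(1) by simp
  also have "\<dots> \<le> (\<Sum>i\<le>m. ((4 / real m) powr p / (1 - ?\<rho>)) / (1 - ?\<rho>))"
  proof (intro sum_mono divide_right_mono)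
    show "(\<integral>\<omega>. chain_energy ?\<rho> R (\<lambda>\<tau>. Y i \<tau> \<omega>) \<partial>M) \<le> (4 / real m) powr p / (1 - ?\<rho>)" for i
      using E(2)[of i] divide_right_mono[OF cle, of "1 - ?\<rho>"] \<rho> by simp
  qed (use \<rho> in auto)
  also have "\<dots> = modulus_bound p m" by (simp add: modulus_bound_def power2_eq_square)
  finally have "(\<integral>\<omega>. G \<omega> \<partial>M) \<le> modulus_bound p m" .
  then have "(\<integral>\<^sup>+\<omega>. ennreal (G \<omega>) \<partial>M) \<le> ennreal (modulus_bound p m)"
    using nn_integral_eq_integral[OF Gint] G0 by (simp add: ennreal_leI)
  moreover have "ennreal ((dist (to_skorohod (grid_path n (\<lambda>j. S j \<omega>)))
      (to_skorohod (grid_path m (\<lambda>i. S (i * n div m) \<omega>))))\<^sup>2) \<le> ennreal (G \<omega>)" for \<omega>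
  proof -
    have "\<bar>grid_path n (\<lambda>j. S j \<omega>) t - grid_path m (\<lambda>i. S (i * n div m) \<omega>) t\<bar> \<le> sqrt (G \<omega>)"
      if t: "t \<in> {0..1}" for t
    proof -
      define i where "i = nat \<lfloor>real m * t\<rfloor>"
      define j where "j = nat \<lfloor>real n * t\<rfloor>"
      let ?i0 = "i * n div m"
      have im: "i \<le> m" and jn: "j \<le> n" using nat_floor_le[OF t] by (auto simp: i_def j_def)
      have t0: "0 \<le> real m * t" "0 \<le> real n * t" using t by auto
      have i: "real i \<le> real m * t" "real m * t < real i + 1" using t0 unfolding i_def by linarith+
      have j: "real j \<le> real n * t" "real n * t < real j + 1" using t0 unfolding j_def by linarith+
      have "real (i * n) \<le> real n * t * real m" using mult_left_mono[OF i(1), of "real n"] by (simp add: ac_simps)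
      also have "\<dots> < (real j + 1) * real m" using j(2) m by (intro mult_strict_right_mono) auto
      finally have "real (i * n) < real ((j + 1) * m)" by (simp add: algebra_simps)
      then have "i * n < (j + 1) * m" by (simp only: of_nat_less_iff)
      then have i0j: "?i0 \<le> j" using m by (simp add: less_mult_imp_div_less less_Suc_eq_le[symmetric])
      have "real (j * m) \<le> real n * t * real m" using j(1) m by (simp add: mult_right_mono)
      also have "\<dots> < (real i + 1) * real n" using mult_strict_left_mono[OF i(2), of "real n"] n by (simp add: ac_simps)
      finally have "real (j * m) < real (i * n + n)" by (simp add: algebra_simps)
      then have "j * m < i * n + n" by (simp only: of_nat_less_iff)
      moreover have "i * n < ?i0 * m + m" using m by (metis div_mult_mod_eq mod_less_divisor nat_add_left_cancel_less)
      ultimately have "j * m < n + m + ?i0 * m" by linarith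
      then have "(j - ?i0) * m < n + m"
        using less_diff_conv2[of "?i0 * m" "j * m" "n + m"] mult_le_mono1[OF i0j, of m]
        by (simp only: diff_mult_distrib)
      then have "(j - ?i0) * m div m \<le> (n + m) div m" by (intro div_le_mono) simp
      then have "j - ?i0 \<le> q" using m by (simp add: q_def)
      then have jR: "j - ?i0 < 2 ^ R" using r(2) by (simp add: R_def)
      have "(Y i (real (j - ?i0) / 2 ^ R) \<omega> - Y i 0 \<omega>)\<^sup>2
          \<le> chain_energy ?\<rho> R (\<lambda>\<tau>. Y i \<tau> \<omega>) / (1 - ?\<rho>)"
        using dyadic_chain_square[OF \<rho>(1,2) jR, of "\<lambda>\<tau>. Y i \<tau> \<omega>"] by simp
      also have "\<dots> \<le> G \<omega>"
        unfolding G_def using im \<rho> energy_nonneg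
        by (intro member_le_sum[of i "{..m}" "\<lambda>i. chain_energy ?\<rho> R (\<lambda>\<tau>. Y i \<tau> \<omega>) / (1 - ?\<rho>)"]) auto
      finally have "(S j \<omega> - S ?i0 \<omega>)\<^sup>2 \<le> G \<omega>"
        using Y_dyadic[of R i "j - ?i0"] Y_dyadic[of R i 0] i0j jn by simp
      then have "\<bar>S j \<omega> - S ?i0 \<omega>\<bar> \<le> sqrt (G \<omega>)" by (rule real_le_rsqrt[of "\<bar>_\<bar>", simplified])
      then show ?thesis by (simp add: grid_path_def i_def j_def)
    qed
    then have "dist (to_skorohod (grid_path n (\<lambda>j. S j \<omega>)))
      (to_skorohod (grid_path m (\<lambda>i. S (i * n div m) \<omega>))) \<le> sqrt (G \<omega>)"
      by (rule dist_to_skorohod_le[OF cadlag_grid_path cadlag_grid_path])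
    then have "(dist (to_skorohod (grid_path n (\<lambda>j. S j \<omega>)))
      (to_skorohod (grid_path m (\<lambda>i. S (i * n div m) \<omega>))))\<^sup>2 \<le> (sqrt (G \<omega>))\<^sup>2"
      by (rule power_mono) simp
    then show ?thesis using G0 by (simp add: ennreal_leI)
  qed
  ultimately show ?thesis
    unfolding mean_square_close_def using Gint by (intro bexI[of _ "\<lambda>\<omega>. ennreal (G \<omega>)"]) auto
qed

text \<open>Here the chaining runs over all dyadic subdivisions of \<open>[i/m, (i+1)/m]\<close>. The energies increase with the
  depth, so monotone convergence bounds the expectation of their supremum. Right-continuity extends the estimate from
  dyadic points to every \<open>t\<close>, each \<open>t < 1\<close> being approached from the right.\<close>

lemma cadlag_process_modulus:
  fixes X :: "real \<Rightarrow> 'a \<Rightarrow> real" and m :: nat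
  assumes p: "1 < p" and m: "0 < m"
    and cadlag: "\<And>\<omega>. \<omega> \<in> space M \<Longrightarrow> cadlag (\<lambda>t. X t \<omega>)"
    and sq: "\<And>s t. s \<in> {0..1} \<Longrightarrow> t \<in> {0..1} \<Longrightarrow> sq_integrable M (\<lambda>\<omega>. X t \<omega> - X s \<omega>)"
    and inc: "\<And>s t. s \<in> {0..1} \<Longrightarrow> t \<in> {0..1} \<Longrightarrow> sq_norm M (\<lambda>\<omega>. X t \<omega> - X s \<omega>) \<le> \<bar>t - s\<bar> powr p"
  shows "mean_square_close M (sample_path X)
    (\<lambda>\<omega>. to_skorohod (grid_path m (\<lambda>i. X (real i / m) \<omega>))) (modulus_bound p m)"
proof -
  let ?\<rho> = "chain_ratio p"
  note \<rho> = chain_ratio[OF p]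
  define Y where "Y i \<tau> \<omega> = X ((real i + \<tau>) / m) \<omega>" for i :: nat and \<tau> :: real and \<omega>
  define c where "c = (1 / real m) powr p"
  have c0: "0 \<le> c" by (simp add: c_def)
  have Yin: "(real i + real k / 2 ^ l) / m \<in> {0..1}" if "i < m" "k \<le> 2 ^ l" for i k l :: nat
  proof -
    have "real k \<le> real (2 ^ l)" using that(2) by (rule of_nat_mono)
    then have "real k / 2 ^ l \<le> 1" by simp
    moreover have "real i + 1 \<le> real m" using that(1) by linarith
    ultimately have "real i + real k / 2 ^ l \<le> real m" by linarith
    then show ?thesis using m by simp
  qed
  have Ysq: "sq_integrable M (\<lambda>\<omega>. Y i (real (Suc k) / 2 ^ l) \<omega> - Y i (real k / 2 ^ l) \<omega>)"
    and Yinc: "sq_norm M (\<lambda>\<omega>. Y i (real (Suc k) / 2 ^ l) \<omega> - Y i (real k / 2 ^ l) \<omega>) \<le> c * (?\<rho>\<^sup>2 / 2) ^ l"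
    if i: "i < m" and k: "k < 2 ^ l" for i k l
  proof -
    let ?s = "(real i + real k / 2 ^ l) / m" and ?t = "(real i + real (Suc k) / 2 ^ l) / m"
    have st: "?s \<in> {0..1}" "?t \<in> {0..1}" using i k by (intro Yin; simp)+
    show "sq_integrable M (\<lambda>\<omega>. Y i (real (Suc k) / 2 ^ l) \<omega> - Y i (real k / 2 ^ l) \<omega>)"
      unfolding Y_def by (rule sq[OF st])
    have "?t - ?s = (1 / m) / 2 ^ l"
      using m by (simp add: field_simps)
    then have "\<bar>?t - ?s\<bar> powr p = (1 / m) powr p * ((1 / 2 ^ l) powr p)"
      by (simp add: powr_mult[symmetric])
    also have "(1 / 2 ^ l) powr p = (2 powr (- p)) ^ l"
      using powr_scale_dyadic[of l l "1 / 2 ^ l" p] by simp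
    finally have "\<bar>?t - ?s\<bar> powr p = c * (?\<rho>\<^sup>2 / 2) ^ l" by (simp only: c_def \<rho>(3))
    then show "sq_norm M (\<lambda>\<omega>. Y i (real (Suc k) / 2 ^ l) \<omega> - Y i (real k / 2 ^ l) \<omega>) \<le> c * (?\<rho>\<^sup>2 / 2) ^ l"
      unfolding Y_def using inc[OF st] by simp
  qed
  define G where "G r \<omega> = (\<Sum>i<m. chain_energy ?\<rho> r (\<lambda>\<tau>. Y i \<tau> \<omega>) / (1 - ?\<rho>))" for r \<omega>
  have E: "integrable M (\<lambda>\<omega>. chain_energy ?\<rho> r (\<lambda>\<tau>. Y i \<tau> \<omega>))"
    "(\<integral>\<omega>. chain_energy ?\<rho> r (\<lambda>\<tau>. Y i \<tau> \<omega>) \<partial>M) \<le> c / (1 - ?\<rho>)" if "i < m" for i r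
    by (rule chain_energy_integral[OF \<rho>(1,2) c0 Ysq[OF that] Yinc[OF that]]; assumption)+
  have Gint: "integrable M (G r)" for r unfolding G_def[abs_def] using E(1) by auto
  have energy_nonneg: "0 \<le> chain_energy ?\<rho> r y" for r y
    unfolding chain_energy_def using \<rho> by (intro sum_nonneg divide_nonneg_nonneg) auto
  have G0: "0 \<le> G r \<omega>" for r \<omega>
    unfolding G_def using \<rho> energy_nonneg by (intro sum_nonneg divide_nonneg_nonneg) auto
  have Gmono: "incseq (\<lambda>r \<omega>. ennreal (G r \<omega>))"
  proof (intro incseq_SucI le_funI ennreal_leI)
    fix r \<omega>
    have "chain_energy ?\<rho> r y \<le> chain_energy ?\<rho> (Suc r) y" for y
      unfolding chain_energy_def using \<rho> by (auto intro!: sum_nonneg divide_nonneg_nonneg)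
    then show "G r \<omega> \<le> G (Suc r) \<omega>"
      unfolding G_def using \<rho> by (intro sum_mono divide_right_mono) auto
  qed
  define G' where "G' \<omega> = (SUP r. ennreal (G r \<omega>))" for \<omega>
  have G'_meas: "G' \<in> borel_measurable M"
    unfolding G'_def[abs_def] using Gint by (intro borel_measurable_SUP) auto
  have "(\<integral>\<omega>. G r \<omega> \<partial>M) \<le> modulus_bound p m" for r
  proof -
    have "(\<integral>\<omega>. G r \<omega> \<partial>M) = (\<Sum>i<m. (\<integral>\<omega>. chain_energy ?\<rho> r (\<lambda>\<tau>. Y i \<tau> \<omega>) \<partial>M) / (1 - ?\<rho>))"
      unfolding G_def using E(1) by simp
    also have "\<dots> \<le> (\<Sum>i<m. ((4 / real m) powr p / (1 - ?\<rho>)) / (1 - ?\<rho>))"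
    proof (intro sum_mono divide_right_mono)
      have "c \<le> (4 / real m) powr p"
        unfolding c_def using p by (intro powr_mono2 divide_right_mono) auto
      then show "(\<integral>\<omega>. chain_energy ?\<rho> r (\<lambda>\<tau>. Y i \<tau> \<omega>) \<partial>M) \<le> (4 / real m) powr p / (1 - ?\<rho>)"
        if "i \<in> {..<m}" for i
        using that E(2)[of i r] divide_right_mono[of c _ "1 - ?\<rho>"] \<rho> by fastforce
    qed (use \<rho> in auto)
    also have "\<dots> = real m * (4 / m) powr p / (1 - ?\<rho>)\<^sup>2" by (simp add: power2_eq_square)
    also have "\<dots> \<le> modulus_bound p m"
      unfolding modulus_bound_def by (intro divide_right_mono mult_right_mono) auto
    finally show ?thesis .
  qed
  then have "(\<integral>\<^sup>+\<omega>. ennreal (G r \<omega>) \<partial>M) \<le> ennreal (modulus_bound p m)" for r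
    using nn_integral_eq_integral[OF Gint] G0 by (simp add: ennreal_leI)
  then have G'_le: "(\<integral>\<^sup>+\<omega>. G' \<omega> \<partial>M) \<le> ennreal (modulus_bound p m)"
    unfolding G'_def using Gint
    by (subst nn_integral_monotone_convergence_SUP[OF Gmono]) (auto intro!: SUP_least)
  have "ennreal ((dist (sample_path X \<omega>) (to_skorohod (grid_path m (\<lambda>i. X (real i / m) \<omega>))))\<^sup>2) \<le> G' \<omega>"
    if \<omega>: "\<omega> \<in> space M" for \<omega>
  proof -
    let ?x = "\<lambda>t. X t \<omega>"
    have le: "ennreal ((?x t - ?x (real (nat \<lfloor>real m * t\<rfloor>) / m))\<^sup>2) \<le> G' \<omega>" if t: "t \<in> {0..1}" for t
    proof (cases "t = 1")
      case True
      then show ?thesis using m by simp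
    next
      case False
      define i where "i = nat \<lfloor>real m * t\<rfloor>"
      define a where "a = real m * t - real i"
      have t1: "t < 1" using t False by auto
      have "0 \<le> real m * t" "real m * t < real m" using t t1 m by auto
      then have im: "i < m" and a: "0 \<le> a" "a < 1" unfolding i_def a_def by linarith+
      \<comment> \<open>the next dyadic point strictly to the right; it stays inside the block once \<open>2\<^sup>-\<^sup>r < 1 - a\<close>\<close>
      define j where "j r = nat \<lfloor>a * 2 ^ r\<rfloor> + 1" for r :: nat
      define s where "s r = (real i + real (j r) / 2 ^ r) / m" for r
      have jb: "a * 2 ^ r < real (j r)" "real (j r) \<le> a * 2 ^ r + 1" for r
        using a(1) unfolding j_def by (auto simp: of_nat_nat) linarith+
      have ts: "t = (real i + a) / m" using m by (simp add: a_def)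
      have s_gt: "t < s r" and s_le: "s r \<le> t + (1 / m) * (1 / 2 ^ r)" for r
      proof -
        have "a < real (j r) / 2 ^ r" "real (j r) / 2 ^ r \<le> a + 1 / 2 ^ r"
          using jb[of r] by (simp_all add: field_simps)
        note ab = this
        show "t < s r" unfolding s_def ts using ab(1) m by (simp add: divide_strict_right_mono)
        have "s r \<le> (real i + (a + 1 / 2 ^ r)) / m"
          unfolding s_def using ab(2) by (intro divide_right_mono) auto
        also have "\<dots> = t + (1 / m) * (1 / 2 ^ r)" unfolding ts by (simp add: add_divide_distrib)
        finally show "s r \<le> t + (1 / m) * (1 / 2 ^ r)" .
      qed
      have p0: "(\<lambda>r. 1 / 2 ^ r :: real) \<longlonglongrightarrow> 0"
        using LIMSEQ_inverse_realpow_zero[of 2] by (simp add: inverse_eq_divide)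
      have "(\<lambda>r. t + (1 / m) * (1 / 2 ^ r)) \<longlonglongrightarrow> t + (1 / m) * 0"
        by (intro tendsto_intros p0)
      then have upper: "(\<lambda>r. t + (1 / m) * (1 / 2 ^ r)) \<longlonglongrightarrow> t" by simp
      have "s \<longlonglongrightarrow> t"
        by (rule tendsto_sandwich[OF _ _ tendsto_const upper])
           (simp_all only: s_le less_imp_le[OF s_gt] eventually_True)
      then have "filterlim s (at_right t) sequentially"
      proof -
        have "s r \<in> {t<..} \<and> s r \<noteq> t" for r using s_gt[of r] by auto
        with \<open>s \<longlonglongrightarrow> t\<close> show ?thesis by (simp add: filterlim_at)
      qed
      moreover have "(?x \<longlongrightarrow> ?x t) (at_right t)"
        using cadlag[OF \<omega>] t t1 by (auto simp: cadlag_def)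
      ultimately have "(\<lambda>r. ?x (s r)) \<longlonglongrightarrow> ?x t" by (rule filterlim_compose[rotated])
      then have lim: "(\<lambda>r. ennreal ((?x (s r) - ?x (real i / m))\<^sup>2)) \<longlonglongrightarrow> ennreal ((?x t - ?x (real i / m))\<^sup>2)"
        by (intro tendsto_ennrealI tendsto_intros)
      have "\<forall>\<^sub>F r in sequentially. 1 / 2 ^ r < 1 - a"
        by (rule order_tendstoD(2)[OF p0]) (use a in simp)
      then have "\<forall>\<^sub>F r in sequentially. ennreal ((?x (s r) - ?x (real i / m))\<^sup>2) \<le> G' \<omega>"
      proof eventually_elim
        case (elim r)
        have "a * 2 ^ r + 1 < 2 ^ r" using elim by (simp add: field_simps)
        then have "real (j r) < 2 ^ r" using jb(2)[of r] by linarith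
        then have jr: "j r < 2 ^ r" by simp
        have "(Y i (real (j r) / 2 ^ r) \<omega> - Y i 0 \<omega>)\<^sup>2
            \<le> chain_energy ?\<rho> r (\<lambda>\<tau>. Y i \<tau> \<omega>) / (1 - ?\<rho>)"
          using dyadic_chain_square[OF \<rho>(1,2) jr, of "\<lambda>\<tau>. Y i \<tau> \<omega>"] by simp
        also have "\<dots> \<le> G r \<omega>"
          unfolding G_def using im \<rho> energy_nonneg
          by (intro member_le_sum[of i "{..<m}" "\<lambda>i. chain_energy ?\<rho> r (\<lambda>\<tau>. Y i \<tau> \<omega>) / (1 - ?\<rho>)"]) auto
        finally have "(?x (s r) - ?x (real i / m))\<^sup>2 \<le> G r \<omega>" by (simp add: Y_def s_def)
        then have "ennreal ((?x (s r) - ?x (real i / m))\<^sup>2) \<le> ennreal (G r \<omega>)" by (rule ennreal_leI)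
        also have "\<dots> \<le> G' \<omega>" unfolding G'_def by (rule SUP_upper) simp
        finally show ?case .
      qed
      then show ?thesis
        using tendsto_upperbound[OF lim] by (simp add: i_def)
    qed
    show ?thesis
    proof (cases "G' \<omega>")
      case (real g)
      have "\<bar>?x t - grid_path m (\<lambda>i. ?x (real i / m)) t\<bar> \<le> sqrt g" if t: "t \<in> {0..1}" for t
      proof -
        have "(?x t - ?x (real (nat \<lfloor>real m * t\<rfloor>) / m))\<^sup>2 \<le> g"
          using le[OF t] real by (simp add: ennreal_le_iff)
        then show ?thesis
          unfolding grid_path_def by (intro real_le_rsqrt) simp
      qed
      then have "dist (sample_path X \<omega>) (to_skorohod (grid_path m (\<lambda>i. ?x (real i / m)))) \<le> sqrt g"
        unfolding sample_path_def by (rule dist_to_skorohod_le[OF cadlag[OF \<omega>] cadlag_grid_path])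
      then have "(dist (sample_path X \<omega>) (to_skorohod (grid_path m (\<lambda>i. ?x (real i / m)))))\<^sup>2 \<le> (sqrt g)\<^sup>2"
        by (rule power_mono) simp
      then show ?thesis using real by (simp add: ennreal_leI)
    qed simp
  qed
  then show ?thesis
    unfolding mean_square_close_def using G'_meas G'_le by blast
qed

section \<open>Normalized block sums\<close>

lemma (in prob_space) indep_vars_Suc:
  assumes "indep_vars (\<lambda>_. N) X {1..}"
  shows "indep_vars (\<lambda>_. N) (\<lambda>k. X (Suc k)) UNIV"
proof -
  note X = assms[unfolded indep_vars_def2 indep_sets_def]
  have "prob (\<Inter>j\<in>J. A j) = (\<Prod>j\<in>J. prob (A j))"
    if J: "J \<noteq> {}" "finite J" and A: "\<And>j. j \<in> J \<Longrightarrow> A j \<in> {X (Suc j) -` A \<inter> space M |A. A \<in> sets N}"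
    for J :: "nat set" and A
  proof -
    have "prob (\<Inter>j\<in>Suc ` J. A (j - 1)) = (\<Prod>j\<in>Suc ` J. prob (A (j - 1)))"
    proof (rule X[THEN conjunct2, THEN conjunct2, rule_format])
      show "(\<lambda>j. A (j - 1)) \<in> (\<Pi> j\<in>Suc ` J. {X j -` A \<inter> space M |A. A \<in> sets N})"
      proof (rule Pi_I, elim imageE)
        fix i j assume "j \<in> J" "i = Suc j"
        then show "A (i - 1) \<in> {X i -` A \<inter> space M |A. A \<in> sets N}" using A[of j] by simp
      qed
      show "Suc ` J \<subseteq> {1..}" by auto
    qed (use J in simp_all)
    then show ?thesis by (simp add: prod.reindex)
  qed
  note prod = this
  have rv: "random_variable N (X k)" if "1 \<le> k" for k
    using X that by (elim conjE) simp
  show ?thesis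
    unfolding indep_vars_def2 indep_sets_def
  proof (intro conjI ballI allI impI)
    show "random_variable N (X (Suc k))" for k by (rule rv) simp
    then show "{X (Suc k) -` A \<inter> space M |A. A \<in> sets N} \<subseteq> events" for k
      by (auto intro: measurable_sets)
    fix J A assume J: "J \<noteq> {}" "finite J"
      and A: "A \<in> (\<Pi> j\<in>J. {X (Suc j) -` A \<inter> space M |A. A \<in> sets N})"
    show "prob (\<Inter>j\<in>J. A j) = (\<Prod>j\<in>J. prob (A j))" by (rule prod[OF J Pi_mem[OF A]])
  qed
qed

text \<open>The characteristic functions of both sums are the same power of that of one summand.\<close>

lemma (in prob_space) iid_sum_distr:
  fixes X :: "nat \<Rightarrow> 'a \<Rightarrow> real"
  assumes indep: "indep_vars (\<lambda>_. borel) X {1..}"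
    and ident: "\<And>k. 1 \<le> k \<Longrightarrow> distr M borel (X k) = distr M borel (X 1)"
    and I: "finite I" "I \<subseteq> {1..}" "finite J" "J \<subseteq> {1..}" "card I = card J"
  shows "distr M borel (\<lambda>\<omega>. \<Sum>k\<in>I. X k \<omega>) = distr M borel (\<lambda>\<omega>. \<Sum>k\<in>J. X k \<omega>)"
proof (rule Levy_uniqueness)
  have meas: "X k \<in> borel_measurable M" if "1 \<le> k" for k
    using indep that by (auto simp: indep_vars_def)
  show "real_distribution (distr M borel (\<lambda>\<omega>. \<Sum>k\<in>I. X k \<omega>))"
    "real_distribution (distr M borel (\<lambda>\<omega>. \<Sum>k\<in>J. X k \<omega>))"
    using I meas by (auto intro!: borel_measurable_sum real_distribution_distr)
  have "char (distr M borel (\<lambda>\<omega>. \<Sum>k\<in>K. X k \<omega>)) t = (char (distr M borel (X 1)) t) ^ card K"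
    if "K \<subseteq> {1..}" for K t
  proof -
    have "char (distr M borel (\<lambda>\<omega>. \<Sum>k\<in>K. X k \<omega>)) t = (\<Prod>k\<in>K. char (distr M borel (X k)) t)"
      by (rule char_distr_sum[OF indep_vars_subset[OF indep that]])
    also have "\<dots> = (\<Prod>k\<in>K. char (distr M borel (X 1)) t)"
    proof (rule prod.cong[OF refl])
      fix k assume "k \<in> K"
      with that have "1 \<le> k" by auto
      then show "char (distr M borel (X k)) t = char (distr M borel (X 1)) t" by (simp only: ident[of k])
    qed
    finally show ?thesis by simp
  qed
  then show "char (distr M borel (\<lambda>\<omega>. \<Sum>k\<in>I. X k \<omega>)) = char (distr M borel (\<lambda>\<omega>. \<Sum>k\<in>J. X k \<omega>))"
    using I by (simp add: fun_eq_iff)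
qed

lemma prod_space_coordinates_indep:
  assumes P: "prob_space \<Omega>" and I: "finite I" "I \<noteq> {}"
  shows "prob_space.indep_vars (Pi\<^sub>M I (\<lambda>_. \<Omega>)) (\<lambda>_. \<Omega>) (\<lambda>i \<omega>. \<omega> i) I"
proof -
  let ?P = "Pi\<^sub>M I (\<lambda>_. \<Omega>)"
  interpret P: prob_space ?P by (rule prob_space_PiM) (rule P)
  have "distr ?P ?P (\<lambda>\<omega>. \<lambda>i\<in>I. \<omega> i) = distr ?P ?P (\<lambda>\<omega>. \<omega>)"
    by (rule distr_cong) (auto simp: space_PiM)
  also have "\<dots> = ?P" by (rule distr_id)
  also have "?P = (\<Pi>\<^sub>M i\<in>I. distr ?P \<Omega> (\<lambda>\<omega>. \<omega> i))"
    using distr_PiM_component[of I "\<lambda>_. \<Omega>"] P by (intro PiM_cong) auto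
  finally show ?thesis
    using P.indep_vars_iff_distr_eq_PiM'[OF I(2), where M'="\<lambda>_. \<Omega>" and X="\<lambda>i \<omega>. \<omega> i"] by simp
qed

lemma expectation_indep_same_law:
  fixes g :: "('i \<Rightarrow> real) \<Rightarrow> real"
  assumes M: "prob_space M" and N: "prob_space N" and I: "I \<noteq> {}"
    and U: "prob_space.indep_vars M (\<lambda>_. borel) U I" and V: "prob_space.indep_vars N (\<lambda>_. borel) V I"
    and law: "\<And>i. i \<in> I \<Longrightarrow> distr M borel (U i) = distr N borel (V i)"
    and g: "g \<in> borel_measurable (Pi\<^sub>M I (\<lambda>_. borel))"
  shows "(\<integral>\<omega>. g (\<lambda>i\<in>I. U i \<omega>) \<partial>M) = (\<integral>\<omega>. g (\<lambda>i\<in>I. V i \<omega>) \<partial>N)"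
proof -
  interpret M: prob_space M by fact
  interpret N: prob_space N by fact
  have Um: "\<And>i. i \<in> I \<Longrightarrow> U i \<in> borel_measurable M" using U by (simp add: M.indep_vars_def)
  have Vm: "\<And>i. i \<in> I \<Longrightarrow> V i \<in> borel_measurable N" using V by (simp add: N.indep_vars_def)
  have "distr M (Pi\<^sub>M I (\<lambda>_. borel)) (\<lambda>\<omega>. \<lambda>i\<in>I. U i \<omega>) = (\<Pi>\<^sub>M i\<in>I. distr M borel (U i))"
    using M.indep_vars_iff_distr_eq_PiM'[OF I Um] U by simp
  also have "\<dots> = (\<Pi>\<^sub>M i\<in>I. distr N borel (V i))" using law by (intro PiM_cong) auto
  also have "\<dots> = distr N (Pi\<^sub>M I (\<lambda>_. borel)) (\<lambda>\<omega>. \<lambda>i\<in>I. V i \<omega>)"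
    using N.indep_vars_iff_distr_eq_PiM'[OF I Vm] V by simp
  finally have eq: "distr M (Pi\<^sub>M I (\<lambda>_. borel)) (\<lambda>\<omega>. \<lambda>i\<in>I. U i \<omega>)
    = distr N (Pi\<^sub>M I (\<lambda>_. borel)) (\<lambda>\<omega>. \<lambda>i\<in>I. V i \<omega>)" .
  have "(\<integral>\<omega>. g (\<lambda>i\<in>I. U i \<omega>) \<partial>M) = (\<integral>x. g x \<partial>distr M (Pi\<^sub>M I (\<lambda>_. borel)) (\<lambda>\<omega>. \<lambda>i\<in>I. U i \<omega>))"
    by (rule integral_distr[symmetric, OF measurable_restrict[OF Um] g])
  also have "\<dots> = (\<integral>\<omega>. g (\<lambda>i\<in>I. V i \<omega>) \<partial>N)"
    unfolding eq by (rule integral_distr[OF measurable_restrict[OF Vm] g])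
  finally show ?thesis .
qed

text \<open>The \<open>j\<close>-th of \<open>p\<close> consecutive blocks of \<open>{1..n}\<close>: the \<open>k\<close> with \<open>k/n \<in> (j/p, (j+1)/p]\<close>.\<close>

definition block :: "nat \<Rightarrow> nat \<Rightarrow> nat \<Rightarrow> nat set" where
  "block p n j = {n * j div p <.. n * Suc j div p}"

lemma block_subset: "block p n j \<subseteq> {1..}"
  by (auto simp: block_def)

lemma block_disjoint: "i < j \<Longrightarrow> block p n i \<inter> block p n j = {}"
proof -
  assume "i < j"
  then have "n * Suc i div p \<le> n * j div p" by (intro div_le_mono mult_le_mono2) auto
  then show ?thesis by (auto simp: block_def)
qed

lemma div_ratio_tendsto:
  assumes "0 < p"
  shows "(\<lambda>n. real (n * c div p) / real n) \<longlonglongrightarrow> real c / real p"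
proof (rule tendsto_sandwich)
  have b: "real (n * c) / real p - 1 \<le> real (n * c div p)" "real (n * c div p) \<le> real (n * c) / real p" for n
  proof -
    have "real (n * c div p) = of_int \<lfloor>real (n * c) / real p\<rfloor>"
      by (simp only: floor_divide_of_nat_eq of_int_of_nat_eq)
    then show "real (n * c) / real p - 1 \<le> real (n * c div p)" "real (n * c div p) \<le> real (n * c) / real p"
      by linarith+
  qed
  show "\<forall>\<^sub>F n in sequentially. real c / real p - 1 / real n \<le> real (n * c div p) / real n"
    using eventually_gt_at_top[of 0]
  proof eventually_elim
    case (elim n)
    have "real c / real p - 1 / real n = (real (n * c) / real p - 1) / real n"
      using elim by (simp add: diff_divide_distrib)
    also have "\<dots> \<le> real (n * c div p) / real n" using b(1) by (intro divide_right_mono) auto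
    finally show ?case .
  qed
  show "\<forall>\<^sub>F n in sequentially. real (n * c div p) / real n \<le> real c / real p"
    using eventually_gt_at_top[of 0]
  proof eventually_elim
    case (elim n)
    have "real (n * c div p) / real n \<le> (real (n * c) / real p) / real n"
      using b(2) by (intro divide_right_mono) auto
    also have "\<dots> = real c / real p" using elim by simp
    finally show ?case .
  qed
  have "(\<lambda>n. real c / real p - 1 / real n) \<longlonglongrightarrow> real c / real p - 0"
    by (intro tendsto_diff tendsto_const lim_const_over_n)
  then show "(\<lambda>n. real c / real p - 1 / real n) \<longlonglongrightarrow> real c / real p" by simp
qed (rule tendsto_const)

lemma card_block_ratio:
  assumes "0 < p"
  shows "(\<lambda>n. real (card (block p n j)) / real n) \<longlonglongrightarrow> 1 / real p"
proof -
  have "(\<lambda>n. real (n * Suc j div p) / real n - real (n * j div p) / real n) \<longlonglongrightarrow> real (Suc j) / p - real j / p"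
    by (intro tendsto_diff div_ratio_tendsto assms)
  moreover have "real (card (block p n j)) / real n = real (n * Suc j div p) / real n - real (n * j div p) / real n" for n
  proof -
    have "n * j div p \<le> n * Suc j div p" by (intro div_le_mono) simp
    then show ?thesis by (simp add: block_def of_nat_diff diff_divide_distrib)
  qed
  moreover have "real (Suc j) / p - real j / p = 1 / p" by (simp add: diff_divide_distrib[symmetric])
  ultimately show ?thesis by simp
qed

lemma card_block_at_top:
  assumes "0 < p"
  shows "filterlim (\<lambda>n. card (block p n j)) at_top sequentially"
proof -
  have "filterlim (\<lambda>n. real (card (block p n j)) / real n * real n) at_top sequentially"
    by (rule filterlim_tendsto_pos_mult_at_top[OF card_block_ratio[OF assms] _ filterlim_real_sequentially])
       (use assms in simp)
  also have "?this \<longleftrightarrow> filterlim (\<lambda>n. real (card (block p n j))) at_top sequentially"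
    by (rule filterlim_cong[OF refl refl], rule eventually_mono[OF eventually_gt_at_top[of 0]]) simp
  finally have "filterlim (\<lambda>n. real (card (block p n j))) at_top sequentially" .
  then show ?thesis by (simp add: filterlim_sequentially_iff_filterlim_real)
qed

text \<open>A block of length \<open>L\<close> has a sum with the law of \<open>\<xi>\<^sub>1 + \<dots> + \<xi>\<^sub>L\<close>. By Skorohod's representation,
  the laws of these sums, divided by \<open>\<surd>L\<close>, are those of random variables \<open>Y\<^sub>L\<close> that converge pointwise on one
  probability space. On its \<open>p\<close>-fold power, \<open>\<surd>(L/n) Y\<^sub>L\<close> evaluated at the \<open>j\<close>-th coordinate, where \<open>L\<close> is
  the length of the \<open>j\<close>-th block, reproduces the joint law of the blocks. It converges pointwise
  because \<open>L/n\<close> tends to \<open>1/p\<close>, so dominated convergence applies.\<close>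

lemma block_sums_converge:
  fixes \<xi> :: "nat \<Rightarrow> 'a \<Rightarrow> real" and g :: "(nat \<Rightarrow> real) \<Rightarrow> real"
  assumes M: "prob_space M"
    and indep: "prob_space.indep_vars M (\<lambda>_. borel) \<xi> {1..}"
    and ident: "\<And>k. k \<ge> 1 \<Longrightarrow> distr M borel (\<xi> k) = distr M borel (\<xi> 1)"
    and mean: "\<And>k. k \<ge> 1 \<Longrightarrow> has_bochner_integral M (\<xi> k) 0"
    and var: "\<And>k. k \<ge> 1 \<Longrightarrow> has_bochner_integral M (\<lambda>\<omega>. (\<xi> k \<omega>)\<^sup>2) 1"
    and N: "prob_space N" and W: "standard_brownian_motion N W"
    and p: "0 < p"
    and g: "g \<in> borel_measurable (Pi\<^sub>M {..<p} (\<lambda>_. borel))" "\<And>v. \<bar>g v\<bar> \<le> A"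
    and g_cont: "\<And>x y. (\<And>j. j < p \<Longrightarrow> (\<lambda>n. x n j) \<longlonglongrightarrow> y j) \<Longrightarrow> (\<lambda>n. g (x n)) \<longlonglongrightarrow> g y"
  shows "(\<lambda>n. \<integral>\<omega>. g (\<lambda>j. (\<Sum>k\<in>block p n j. \<xi> k \<omega>) / sqrt n) \<partial>M)
    \<longlonglongrightarrow> (\<integral>\<omega>. g (\<lambda>j. W (real (Suc j) / p) \<omega> - W (real j / p) \<omega>) \<partial>N)"
proof -
  interpret M: prob_space M by fact
  interpret N: prob_space N by fact
  have \<xi>_meas: "\<xi> k \<in> borel_measurable M" if "1 \<le> k" for k
    using indep that by (auto simp: M.indep_vars_def)
  define S where "S L \<omega> = (\<Sum>i<L. \<xi> (Suc i) \<omega>)" for L \<omega>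
  have S_meas: "S L \<in> borel_measurable M" for L
    unfolding S_def[abs_def] by (intro borel_measurable_sum \<xi>_meas) simp
  let ?\<mu> = "\<lambda>L. distr M borel (\<lambda>\<omega>. S L \<omega> / sqrt L)"
  have "weak_conv_m (\<lambda>L. distr M borel (\<lambda>\<omega>. S L \<omega> / sqrt (real L * 1\<^sup>2))) std_normal_distribution"
    unfolding S_def
  proof (rule M.central_limit_theorem_zero_mean[where \<mu>="distr M borel (\<xi> 1)"])
    show "M.indep_vars (\<lambda>i. borel) (\<lambda>i. \<xi> (Suc i)) UNIV" by (rule M.indep_vars_Suc[OF indep])
    show "M.expectation (\<xi> (Suc n)) = 0" "integrable M (\<lambda>x. (\<xi> (Suc n) x)\<^sup>2)" for n
      using mean[of "Suc n"] var[of "Suc n"] by (auto simp: has_bochner_integral_iff)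
    show "M.variance (\<xi> (Suc n)) = 1\<^sup>2" for n
      using mean[of "Suc n"] var[of "Suc n"] by (simp add: has_bochner_integral_iff)
    show "distr M borel (\<xi> (Suc n)) = distr M borel (\<xi> 1)" for n by (rule ident) simp
  qed simp
  then have clt: "weak_conv_m ?\<mu> std_normal_distribution" by simp
  have rd: "real_distribution (?\<mu> L)" for L
    by (intro M.real_distribution_distr borel_measurable_divide S_meas) auto
  obtain \<Omega> :: "real measure" and Yn :: "nat \<Rightarrow> real \<Rightarrow> real" and Y :: "real \<Rightarrow> real"
    where \<Omega>: "prob_space \<Omega>" and Yn: "\<And>L. Yn L \<in> borel_measurable \<Omega>" "\<And>L. distr \<Omega> borel (Yn L) = ?\<mu> L"
      and Y: "Y \<in> measurable \<Omega> lborel" "distr \<Omega> borel Y = std_normal_distribution"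
      and conv: "\<And>x. x \<in> space \<Omega> \<Longrightarrow> (\<lambda>L. Yn L x) \<longlonglongrightarrow> Y x"
    using Skorohod[OF rd real_dist_normal_dist clt]
  proof (elim exE)
    fix \<Omega> :: "real measure" and Yn :: "nat \<Rightarrow> real \<Rightarrow> real" and Y :: "real \<Rightarrow> real"
    assume "prob_space \<Omega> \<and> (\<forall>n. Yn n \<in> measurable \<Omega> borel) \<and> (\<forall>n. distr \<Omega> borel (Yn n) = ?\<mu> n) \<and>
       Y \<in> measurable \<Omega> lborel \<and> distr \<Omega> borel Y = std_normal_distribution \<and>
       (\<forall>x \<in> space \<Omega>. (\<lambda>n. Yn n x) \<longlonglongrightarrow> Y x)"
    then show thesis by (intro that[of \<Omega> Yn Y]) simp_all
  qed
  interpret \<Omega>: prob_space \<Omega> by fact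
  have Y_meas: "Y \<in> borel_measurable \<Omega>" using Y(1) by simp
  let ?I = "{..<p}"
  let ?P = "Pi\<^sub>M ?I (\<lambda>_. \<Omega>)"
  interpret P: prob_space ?P by (rule prob_space_PiM) (rule \<Omega>)
  have I: "finite ?I" "?I \<noteq> {}" using p by auto
  note coord = prod_space_coordinates_indep[OF \<Omega> I]
  have coord_law: "distr ?P borel (\<lambda>\<omega>. \<phi> (\<omega> i)) = distr \<Omega> borel \<phi>"
    if "i \<in> ?I" "\<phi> \<in> borel_measurable \<Omega>" for i and \<phi> :: "real \<Rightarrow> real"
  proof -
    have "distr ?P borel (\<lambda>\<omega>. \<phi> (\<omega> i)) = distr (distr ?P \<Omega> (\<lambda>\<omega>. \<omega> i)) borel \<phi>"
      using that by (subst distr_distr) (auto simp: comp_def)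
    also have "distr ?P \<Omega> (\<lambda>\<omega>. \<omega> i) = \<Omega>"
      by (rule distr_PiM_component) (use that \<Omega> in auto)
    finally show ?thesis .
  qed
  let ?L = "\<lambda>n j. card (block p n j)"
  define V where "V n j x = sqrt (real (?L n j) / n) * Yn (?L n j) x" for n j x
  define V' where "V' x = sqrt (1 / p) * Y x" for x
  define B where "B n j \<omega> = (\<Sum>k\<in>block p n j. \<xi> k \<omega>) / sqrt n" for n j \<omega>
  define D where "D j \<omega> = W (real (Suc j) / p) \<omega> - W (real j / p) \<omega>" for j \<omega>
  have V_meas: "V n j \<in> borel_measurable \<Omega>" for n j unfolding V_def[abs_def] using Yn(1) by simp
  have V'_meas: "V' \<in> borel_measurable \<Omega>" unfolding V'_def[abs_def] using Y_meas by simp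
  \<comment> \<open>\<open>g\<close> reads only the coordinates below \<open>p\<close>: apply \<open>g_cont\<close> to a constant sequence\<close>
  have restrict: "g (restrict v ?I) = g v" for v
    by (rule LIMSEQ_unique[OF tendsto_const g_cont]) auto
  have B_V: "(\<integral>\<omega>. g (\<lambda>j. B n j \<omega>) \<partial>M) = (\<integral>\<omega>. g (\<lambda>j. V n j (\<omega> j)) \<partial>?P)" for n
  proof -
    have "M.indep_vars (\<lambda>_. borel) (B n) ?I"
    proof -
      have "M.indep_vars (\<lambda>j. Pi\<^sub>M (block p n j) (\<lambda>_. borel)) (\<lambda>j \<omega>. restrict (\<lambda>k. \<xi> k \<omega>) (block p n j)) ?I"
      proof (rule M.indep_vars_restrict[OF indep])
        show "disjoint_family_on (block p n) ?I"
          unfolding disjoint_family_on_def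
        proof (intro ballI impI)
          fix i j :: nat assume "i \<noteq> j"
          then show "block p n i \<inter> block p n j = {}"
            using block_disjoint[of i j] block_disjoint[of j i] by (cases "i < j") (auto simp: Int_commute)
        qed
      qed (use block_subset in auto)
      then have "M.indep_vars (\<lambda>_. borel)
          (\<lambda>j \<omega>. (\<lambda>v. (\<Sum>k\<in>block p n j. v k) / sqrt n) (restrict (\<lambda>k. \<xi> k \<omega>) (block p n j))) ?I"
        by (rule M.indep_vars_compose2) (auto intro!: borel_measurable_sum borel_measurable_divide)
      moreover have "(\<lambda>v. (\<Sum>k\<in>block p n j. v k) / sqrt n) (restrict (\<lambda>k. \<xi> k \<omega>) (block p n j)) = B n j \<omega>"
        for j \<omega> unfolding B_def by simp
      ultimately show ?thesis by (simp only:)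
    qed
    moreover have "P.indep_vars (\<lambda>_. borel) (\<lambda>j \<omega>. V n j (\<omega> j)) ?I"
      by (rule P.indep_vars_compose2[OF coord]) (rule V_meas)
    moreover have "distr M borel (B n j) = distr ?P borel (\<lambda>\<omega>. V n j (\<omega> j))" if "j \<in> ?I" for j
    proof -
      let ?l = "?L n j"
      have Sl: "distr M borel (\<lambda>\<omega>. \<Sum>k\<in>block p n j. \<xi> k \<omega>) = distr M borel (S ?l)"
      proof -
        have "distr M borel (\<lambda>\<omega>. \<Sum>k\<in>block p n j. \<xi> k \<omega>) = distr M borel (\<lambda>\<omega>. \<Sum>k\<in>Suc ` {..<?l}. \<xi> k \<omega>)"
          using block_subset by (intro M.iid_sum_distr[OF indep ident]) (auto simp: block_def card_image)
        also have "(\<lambda>\<omega>. \<Sum>k\<in>Suc ` {..<?l}. \<xi> k \<omega>) = S ?l"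
          by (simp add: fun_eq_iff S_def sum.reindex)
        finally show ?thesis .
      qed
      have sum_meas: "(\<lambda>\<omega>. \<Sum>k\<in>block p n j. \<xi> k \<omega>) \<in> borel_measurable M"
        using block_subset by (intro borel_measurable_sum \<xi>_meas) auto
      have "distr M borel (B n j) = distr (distr M borel (\<lambda>\<omega>. \<Sum>k\<in>block p n j. \<xi> k \<omega>)) borel (\<lambda>x. x / sqrt n)"
        unfolding B_def[abs_def] using sum_meas by (subst distr_distr) (auto simp: comp_def)
      also have "\<dots> = distr M borel (\<lambda>\<omega>. S ?l \<omega> / sqrt n)"
        unfolding Sl using S_meas by (subst distr_distr) (auto simp: comp_def)
      also have "(\<lambda>\<omega>. S ?l \<omega> / sqrt n) = (\<lambda>\<omega>. sqrt (real ?l / n) * (S ?l \<omega> / sqrt ?l))"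
        by (cases "?l = 0") (auto simp: S_def real_sqrt_divide fun_eq_iff)
      also have "distr M borel \<dots> = distr (?\<mu> ?l) borel (\<lambda>x. sqrt (real ?l / n) * x)"
        using S_meas by (subst distr_distr) (auto simp: comp_def)
      also have "\<dots> = distr \<Omega> borel (V n j)"
        unfolding Yn(2)[symmetric] V_def[abs_def] using Yn(1) by (subst distr_distr) (auto simp: comp_def)
      also have "\<dots> = distr ?P borel (\<lambda>\<omega>. V n j (\<omega> j))" by (rule coord_law[OF that V_meas, symmetric])
      finally show ?thesis .
    qed
    ultimately have "(\<integral>\<omega>. g (\<lambda>j\<in>?I. B n j \<omega>) \<partial>M) = (\<integral>\<omega>. g (\<lambda>j\<in>?I. V n j (\<omega> j)) \<partial>?P)"
      by (intro expectation_indep_same_law M P.prob_space_axioms I g) 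
    then show ?thesis by (simp only: restrict)
  qed
  have D_V': "(\<integral>\<omega>. g (\<lambda>j. D j \<omega>) \<partial>N) = (\<integral>\<omega>. g (\<lambda>j. V' (\<omega> j)) \<partial>?P)"
  proof -
    have "N.indep_vars (\<lambda>_. borel) D ?I"
      unfolding D_def[abs_def] by (rule brownian_grid_increments_indep[OF W])
    moreover have "P.indep_vars (\<lambda>_. borel) (\<lambda>j \<omega>. V' (\<omega> j)) ?I"
      by (rule P.indep_vars_compose2[OF coord]) (rule V'_meas)
    moreover have "distr N borel (D j) = distr ?P borel (\<lambda>\<omega>. V' (\<omega> j))" if "j \<in> ?I" for j
    proof -
      have std: "distributed \<Omega> lborel Y std_normal_density"
        using Y by (auto simp: distributed_def cong: distr_cong)
      have V'_dist: "distributed \<Omega> lborel V' (normal_density 0 (sqrt (1 / p)))"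
        using \<Omega>.normal_density_affine[OF std, of "sqrt (1 / p)" 0] p by (simp add: V'_def[abs_def])
      have "distr N borel (D j) = distr N lborel (D j)" by (rule distr_cong) auto
      also have "\<dots> = density lborel (normal_density 0 (sqrt (1 / p)))"
        using brownian_grid_increment[OF W, of j p] that
        unfolding D_def[abs_def] by (intro distributed_distr_eq_density) auto
      also have "\<dots> = distr \<Omega> lborel V'" by (rule distributed_distr_eq_density[OF V'_dist, symmetric])
      also have "\<dots> = distr \<Omega> borel V'" by (rule distr_cong) auto
      also have "\<dots> = distr ?P borel (\<lambda>\<omega>. V' (\<omega> j))" by (rule coord_law[OF that V'_meas, symmetric])
      finally show ?thesis .
    qed
    ultimately have "(\<integral>\<omega>. g (\<lambda>j\<in>?I. D j \<omega>) \<partial>N) = (\<integral>\<omega>. g (\<lambda>j\<in>?I. V' (\<omega> j)) \<partial>?P)"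
      by (intro expectation_indep_same_law N P.prob_space_axioms I g)
    then show ?thesis by (simp only: restrict)
  qed
  have V_lim: "(\<lambda>n. V n j x) \<longlonglongrightarrow> V' x" if "x \<in> space \<Omega>" for j x
    unfolding V_def V'_def
    by (intro tendsto_mult tendsto_real_sqrt card_block_ratio p
        filterlim_compose[OF conv[OF that] card_block_at_top])
  have g_meas: "(\<lambda>\<omega>. g (\<lambda>j. F j (\<omega> j))) \<in> borel_measurable ?P"
    if "\<And>j. F j \<in> borel_measurable \<Omega>" for F :: "nat \<Rightarrow> real \<Rightarrow> real"
  proof -
    have "(\<lambda>\<omega>. \<lambda>j\<in>?I. F j (\<omega> j)) \<in> measurable ?P (Pi\<^sub>M ?I (\<lambda>_. borel))"
      by (intro measurable_restrict measurable_compose[OF measurable_component_singleton[where M="\<lambda>_. \<Omega>"] that])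
    from measurable_compose[OF this g(1)] show ?thesis by (simp only: restrict)
  qed
  have "(\<lambda>n. \<integral>\<omega>. g (\<lambda>j. V n j (\<omega> j)) \<partial>?P) \<longlonglongrightarrow> (\<integral>\<omega>. g (\<lambda>j. V' (\<omega> j)) \<partial>?P)"
  proof (rule integral_dominated_convergence[where w="\<lambda>_. A"])
    show "AE \<omega> in ?P. (\<lambda>n. g (\<lambda>j. V n j (\<omega> j))) \<longlonglongrightarrow> g (\<lambda>j. V' (\<omega> j))"
    proof (rule AE_I2)
      fix \<omega> assume "\<omega> \<in> space ?P"
      then show "(\<lambda>n. g (\<lambda>j. V n j (\<omega> j))) \<longlonglongrightarrow> g (\<lambda>j. V' (\<omega> j))"
        by (intro g_cont V_lim) (auto simp: space_PiM)
    qed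
  qed (use g_meas[OF V'_meas] g_meas[OF V_meas] g(2) in auto)
  then show ?thesis
    unfolding B_V[symmetric] D_V'[symmetric] unfolding B_def D_def .
qed

section \<open>Weighted sums of the innovations\<close>

text \<open>The inner product of \<open>f\<close> with the indicator of \<open>(k/n, (k+1)/n]\<close>.\<close>

definition cell_coeff :: "nat \<Rightarrow> (real \<Rightarrow> real) \<Rightarrow> nat \<Rightarrow> real" where
  "cell_coeff n f k = (\<integral>u. (ind_upto (real (Suc k) / n) u - ind_upto (real k / n) u) * f u \<partial>lborel)"

text \<open>The analogue of the Wiener integral for the innovations: \<open>\<surd>n\<close> times the indicators of the cells is an
  orthonormal system in \<open>L\<^sup>2\<close>, and its members are mapped to the orthonormal random variables \<open>\<xi> (Suc k)\<close>.\<close>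

definition noise_sum :: "(nat \<Rightarrow> 'a \<Rightarrow> real) \<Rightarrow> nat \<Rightarrow> (real \<Rightarrow> real) \<Rightarrow> 'a \<Rightarrow> real" where
  "noise_sum \<xi> n f \<omega> = (\<Sum>k<n. (sqrt n * cell_coeff n f k) * \<xi> (Suc k) \<omega>)"

lemma cell_coeff_integrable:
  assumes "sq_integrable lborel f" "k < n"
  shows "integrable lborel (\<lambda>u. (ind_upto (real (Suc k) / n) u - ind_upto (real k / n) u) * f u)"
  by (intro sq_integrable_mult ind_upto.sq_integrable_increment ind_upto.grid_point assms(1))
     (use assms(2) in auto)

lemma noise_sum_diff:
  assumes "sq_integrable lborel f" "sq_integrable lborel g"
  shows "noise_sum \<xi> n (\<lambda>u. f u - g u) \<omega> = noise_sum \<xi> n f \<omega> - noise_sum \<xi> n g \<omega>"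
proof -
  have "cell_coeff n (\<lambda>u. f u - g u) k = cell_coeff n f k - cell_coeff n g k" if "k < n" for k
    unfolding cell_coeff_def right_diff_distrib[of _ "f _"]
    by (rule Bochner_Integration.integral_diff) (intro cell_coeff_integrable assms that)+
  then show ?thesis
    unfolding noise_sum_def sum_subtractf[symmetric]
    by (intro sum.cong refl) (simp add: left_diff_distrib right_diff_distrib)
qed

lemma cell_coeff_grid_sum:
  assumes "k < n"
  shows "cell_coeff n (grid_sum ind_upto n b) k = b k / n"
proof -
  let ?D = "\<lambda>k u. ind_upto (real (Suc k) / n) u - ind_upto (real k / n) u"
  have "cell_coeff n (grid_sum ind_upto n b) k = (\<integral>u. (\<Sum>l<n. b l * (?D k u * ?D l u)) \<partial>lborel)"
    unfolding cell_coeff_def grid_sum_def sum_distrib_left by (simp only: mult.left_commute)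
  also have "\<dots> = (\<Sum>l<n. \<integral>u. b l * (?D k u * ?D l u) \<partial>lborel)"
    by (intro Bochner_Integration.integral_sum integrable_mult_right sq_integrable_mult
        ind_upto.sq_integrable_increment ind_upto.grid_point) (use assms in auto)
  also have "\<dots> = (\<Sum>l<n. if l = k then b k / n else 0)"
  proof (rule sum.cong[OF refl])
    fix l assume "l \<in> {..<n}"
    then have "(\<integral>u. ?D k u * ?D l u \<partial>lborel) = (if k = l then 1 / n else 0)"
      by (intro ind_upto.grid_increments_inner assms) simp
    then show "(\<integral>u. b l * (?D k u * ?D l u) \<partial>lborel) = (if l = k then b k / n else 0)"
      by (simp only: integral_mult_right_zero) auto
  qed
  finally show ?thesis using assms by simp
qed

text \<open>Bessel's inequality for the orthonormal system of normalized cell indicators, read off from the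
  distance of \<open>f\<close> to its projection, whose value on the \<open>k\<close>-th cell is the mean of \<open>f\<close> there.\<close>

lemma bessel_cell_coeff:
  assumes f: "sq_integrable lborel f"
  shows "(\<Sum>k<n. n * (cell_coeff n f k)\<^sup>2) \<le> sq_norm lborel f"
proof -
  define b where "b k = n * cell_coeff n f k" for k
  let ?g = "grid_sum ind_upto n b"
  have g: "sq_integrable lborel ?g" by (rule ind_upto.sq_integrable_grid_sum)
  have "(\<integral>u. ?g u * f u \<partial>lborel) = (\<Sum>k<n. b k * cell_coeff n f k)"
    unfolding grid_sum_def sum_distrib_right cell_coeff_def mult.assoc
    by (subst Bochner_Integration.integral_sum)
       (auto intro!: integrable_mult_right cell_coeff_integrable f simp del: of_nat_Suc)
  also have "\<dots> = (\<Sum>k<n. n * (cell_coeff n f k)\<^sup>2)"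
    by (intro sum.cong refl) (simp add: b_def power2_eq_square)
  finally have inner: "(\<integral>u. ?g u * f u \<partial>lborel) = (\<Sum>k<n. n * (cell_coeff n f k)\<^sup>2)" .
  have norm: "sq_norm lborel ?g = (\<Sum>k<n. n * (cell_coeff n f k)\<^sup>2)"
    unfolding ind_upto.sq_norm_grid_sum sum_divide_distrib
    by (intro sum.cong refl) (simp add: b_def power2_eq_square)
  have "0 \<le> sq_norm lborel (\<lambda>u. f u - ?g u)" by (rule sq_norm_nonneg)
  also have "\<dots> = (\<integral>u. (f u)\<^sup>2 - 2 * (?g u * f u) + (?g u)\<^sup>2 \<partial>lborel)"
    unfolding sq_norm_def by (simp add: power2_diff algebra_simps)
  also have "\<dots> = sq_norm lborel f - 2 * (\<integral>u. ?g u * f u \<partial>lborel) + sq_norm lborel ?g"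
    using f g sq_integrable_mult[OF g f] by (simp add: sq_norm_def sq_integrable_def)
  finally show ?thesis using inner norm by simp
qed

lemma (in prob_space) iid_weighted_sum:
  fixes \<xi> :: "nat \<Rightarrow> 'a \<Rightarrow> real"
  assumes indep: "indep_vars (\<lambda>_. borel) \<xi> {1..}"
    and mean: "\<And>k. k \<ge> 1 \<Longrightarrow> has_bochner_integral M (\<xi> k) 0"
    and var: "\<And>k. k \<ge> 1 \<Longrightarrow> has_bochner_integral M (\<lambda>\<omega>. (\<xi> k \<omega>)\<^sup>2) 1"
  shows "sq_integrable M (\<lambda>\<omega>. \<Sum>k<n. c k * \<xi> (Suc k) \<omega>)"
    and "sq_norm M (\<lambda>\<omega>. \<Sum>k<n. c k * \<xi> (Suc k) \<omega>) = (\<Sum>k<n. (c k)\<^sup>2)"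
proof -
  have sq: "sq_integrable M (\<lambda>\<omega>. c k * \<xi> (Suc k) \<omega>)" for k
    using indep var[of "Suc k"]
    by (intro sq_integrable_cmult) (auto simp: sq_integrable_def has_bochner_integral_iff indep_vars_def)
  then show "sq_integrable M (\<lambda>\<omega>. \<Sum>k<n. c k * \<xi> (Suc k) \<omega>)" by (intro sq_integrable_sum)
  have "(\<integral>\<omega>. (c k * \<xi> (Suc k) \<omega>) * (c l * \<xi> (Suc l) \<omega>) \<partial>M) = 0" if "k \<noteq> l" for k l
  proof -
    have "indep_vars (\<lambda>_. borel) \<xi> {Suc k, Suc l}" by (rule indep_vars_subset[OF indep]) auto
    then have "(\<integral>\<omega>. (\<Prod>i\<in>{Suc k, Suc l}. \<xi> i \<omega>) \<partial>M) = (\<Prod>i\<in>{Suc k, Suc l}. \<integral>\<omega>. \<xi> i \<omega> \<partial>M)"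
      by (intro indep_vars_lebesgue_integral) (use mean in \<open>auto simp: has_bochner_integral_iff\<close>)
    then have "(\<integral>\<omega>. \<xi> (Suc k) \<omega> * \<xi> (Suc l) \<omega> \<partial>M) = 0"
      using that mean by (simp add: has_bochner_integral_iff)
    moreover have "(\<lambda>\<omega>. (c k * \<xi> (Suc k) \<omega>) * (c l * \<xi> (Suc l) \<omega>))
      = (\<lambda>\<omega>. (c k * c l) * (\<xi> (Suc k) \<omega> * \<xi> (Suc l) \<omega>))" by (simp add: ac_simps)
    ultimately show ?thesis by (simp only: integral_mult_right_zero mult_zero_right)
  qed
  then have "sq_norm M (\<lambda>\<omega>. \<Sum>k<n. c k * \<xi> (Suc k) \<omega>) = (\<Sum>k<n. sq_norm M (\<lambda>\<omega>. c k * \<xi> (Suc k) \<omega>))"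
    by (intro sq_norm_orthogonal_sum sq) auto
  also have "\<dots> = (\<Sum>k<n. (c k)\<^sup>2)"
    unfolding sq_norm_cmult using var by (simp add: sq_norm_def has_bochner_integral_iff)
  finally show "sq_norm M (\<lambda>\<omega>. \<Sum>k<n. c k * \<xi> (Suc k) \<omega>) = (\<Sum>k<n. (c k)\<^sup>2)" .
qed

lemma (in prob_space) noise_sum_contraction:
  fixes \<xi> :: "nat \<Rightarrow> 'a \<Rightarrow> real"
  assumes indep: "indep_vars (\<lambda>_. borel) \<xi> {1..}"
    and mean: "\<And>k. k \<ge> 1 \<Longrightarrow> has_bochner_integral M (\<xi> k) 0"
    and var: "\<And>k. k \<ge> 1 \<Longrightarrow> has_bochner_integral M (\<lambda>\<omega>. (\<xi> k \<omega>)\<^sup>2) 1"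
    and f: "sq_integrable lborel f"
  shows "sq_integrable M (noise_sum \<xi> n f)" "sq_norm M (noise_sum \<xi> n f) \<le> sq_norm lborel f"
proof -
  note iid = iid_weighted_sum[OF indep mean var, where n=n and c="\<lambda>k. sqrt n * cell_coeff n f k"]
  show "sq_integrable M (noise_sum \<xi> n f)" using iid(1) by (simp add: noise_sum_def[abs_def])
  have "sq_norm M (noise_sum \<xi> n f) = (\<Sum>k<n. n * (cell_coeff n f k)\<^sup>2)"
    using iid(2) by (simp add: noise_sum_def[abs_def] power_mult_distrib)
  also have "\<dots> \<le> sq_norm lborel f" by (rule bessel_cell_coeff[OF f])
  finally show "sq_norm M (noise_sum \<xi> n f) \<le> sq_norm lborel f" .
qed

lemma Suc_mem_block_iff:
  assumes "0 < p" "0 < n"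
  shows "real (Suc k) / n \<in> {real j / p<..real (Suc j) / p} \<longleftrightarrow> Suc k \<in> block p n j"
proof -
  have "real j / p < real (Suc k) / n \<longleftrightarrow> real (n * j) < real (Suc k * p)"
    using assms by (simp add: field_simps)
  also have "\<dots> \<longleftrightarrow> n * j < Suc k * p" by (rule of_nat_less_iff)
  also have "\<dots> \<longleftrightarrow> n * j div p < Suc k" using assms by (simp add: div_less_iff_less_mult)
  finally have 1: "real j / p < real (Suc k) / n \<longleftrightarrow> n * j div p < Suc k" .
  have "real (Suc k) / n \<le> real (Suc j) / p \<longleftrightarrow> real (Suc k * p) \<le> real (n * Suc j)"
    using assms by (simp add: field_simps)
  also have "\<dots> \<longleftrightarrow> Suc k * p \<le> n * Suc j" by (rule of_nat_le_iff)
  also have "\<dots> \<longleftrightarrow> Suc k \<le> n * Suc j div p" using assms by (simp add: less_eq_div_iff_mult_less_eq)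
  finally show ?thesis using 1 by (simp only: block_def greaterThanAtMost_iff)
qed

text \<open>A step function on the grid of mesh \<open>1/p\<close>, sampled at the right end points of the cells of mesh
  \<open>1/n\<close>, is constant along each block of indices.\<close>

lemma noise_sum_block:
  assumes "0 < p" "0 < n"
  shows "noise_sum \<xi> n (grid_sum ind_upto n (\<lambda>k. grid_sum ind_upto p b (real (Suc k) / n))) \<omega>
    = (\<Sum>j<p. b j * ((\<Sum>k\<in>block p n j. \<xi> k \<omega>) / sqrt n))"
proof -
  let ?s = "grid_sum ind_upto p b"
  have s: "?s (real (Suc k) / n) = (\<Sum>j<p. b j * indicator (block p n j) (Suc k))" for k
    unfolding grid_sum_def
  proof (rule sum.cong[OF refl], rule arg_cong2[where f="(*)", OF refl])
    fix j
    have "ind_upto (real (Suc j) / p) (real (Suc k) / n) - ind_upto (real j / p) (real (Suc k) / n)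
        = indicator {real j / p<..real (Suc j) / p} (real (Suc k) / n)"
      by (rule ind_upto_increment) (auto simp: divide_right_mono)
    also have "\<dots> = indicator (block p n j) (Suc k)"
      using Suc_mem_block_iff[OF assms, of k j] by (simp only: indicator_def)
    finally show "ind_upto (real (Suc j) / p) (real (Suc k) / n) - ind_upto (real j / p) (real (Suc k) / n)
        = indicator (block p n j) (Suc k)" .
  qed
  have block_sum: "(\<Sum>k<n. indicator (block p n j) (Suc k) * \<xi> (Suc k) \<omega>) = (\<Sum>k\<in>block p n j. \<xi> k \<omega>)"
    if "j < p" for j
  proof -
    have "n * Suc j div p \<le> n"
      using that assms by (metis Suc_leI div_le_mono mult_le_mono2 nonzero_mult_div_cancel_right neq0_conv)
    moreover have "x \<in> Suc ` {..<n}" if "0 < x" "x \<le> n" for x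
      using that by (intro image_eqI[of _ _ "x - 1"]) auto
    ultimately have sub: "block p n j \<subseteq> Suc ` {..<n}" by (auto simp: block_def)
    have "(\<Sum>k<n. indicator (block p n j) (Suc k) * \<xi> (Suc k) \<omega>)
      = (\<Sum>k\<in>Suc ` {..<n}. indicator (block p n j) k * \<xi> k \<omega>)"
      by (simp only: sum.reindex[OF inj_Suc] comp_def)
    also have "\<dots> = (\<Sum>k\<in>block p n j. \<xi> k \<omega>)"
      using sub by (intro sum.mono_neutral_cong_right) auto
    finally show ?thesis .
  qed
  have n: "sqrt n * (x / n) = x / sqrt n" for x
  proof -
    have "sqrt n * (x / n) = sqrt n * x / (sqrt n * sqrt n)" by simp
    also have "\<dots> = x / sqrt n"
      using assms by (intro nonzero_mult_divide_mult_cancel_left) simp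
    finally show ?thesis .
  qed
  have "noise_sum \<xi> n (grid_sum ind_upto n (\<lambda>k. ?s (real (Suc k) / n))) \<omega>
    = (\<Sum>k<n. (?s (real (Suc k) / n) / sqrt n) * \<xi> (Suc k) \<omega>)"
    unfolding noise_sum_def by (rule sum.cong[OF refl]) (simp only: cell_coeff_grid_sum lessThan_iff n)
  also have "\<dots> = (\<Sum>k<n. \<Sum>j<p. b j / sqrt n * (indicator (block p n j) (Suc k) * \<xi> (Suc k) \<omega>))"
    unfolding s by (simp only: sum_divide_distrib sum_distrib_right times_divide_eq_left mult.assoc)
  also have "\<dots> = (\<Sum>j<p. b j / sqrt n * (\<Sum>k<n. indicator (block p n j) (Suc k) * \<xi> (Suc k) \<omega>))"
    by (subst sum.swap) (simp only: sum_distrib_left)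
  also have "\<dots> = (\<Sum>j<p. b j * ((\<Sum>k\<in>block p n j. \<xi> k \<omega>) / sqrt n))"
    by (rule sum.cong[OF refl]) (simp only: block_sum lessThan_iff, simp)
  finally show ?thesis .
qed

text \<open>The value at time \<open>j/n\<close> of the approximating process for a general kernel \<open>K\<close>.\<close>

definition volterra_sum ::
    "(real \<Rightarrow> real \<Rightarrow> real) \<Rightarrow> (nat \<Rightarrow> 'a \<Rightarrow> real) \<Rightarrow> nat \<Rightarrow> nat \<Rightarrow> 'a \<Rightarrow> real" where
  "volterra_sum K \<xi> n j \<omega> =
     (\<Sum>k = 1..j. real n * (LBINT u:{(real k - 1) / real n..real k / real n}. K (real j / real n) u)
        * (\<xi> k \<omega> / sqrt (real n)))"

text \<open>The kernel at time \<open>j/n\<close> vanishes on the cells beyond \<open>j\<close>, so the sum may run over all \<open>n\<close>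
  cells. This is what makes increments in \<open>j\<close> linear in the kernel.\<close>

lemma volterra_sum_eq_noise_sum:
  assumes K: "\<And>t u. u \<notin> {0<..<t} \<Longrightarrow> K t u = 0" and meas: "K (real j / n) \<in> borel_measurable borel"
    and j: "j \<le> n" and n: "0 < n"
  shows "volterra_sum K \<xi> n j \<omega> = noise_sum \<xi> n (K (real j / n)) \<omega>"
proof -
  let ?f = "K (real j / n)"
  have coeff: "(LBINT u:{(real (Suc k) - 1) / n..real (Suc k) / n}. ?f u) = cell_coeff n ?f k" for k
    unfolding set_lebesgue_integral_def cell_coeff_def
  proof (rule integral_cong_AE)
    show "AE u in lborel. indicator {(real (Suc k) - 1) / n..real (Suc k) / n} u *\<^sub>R ?f u
        = (ind_upto (real (Suc k) / n) u - ind_upto (real k / n) u) * ?f u"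
      using AE_lborel_singleton[of "real k / n"]
    proof eventually_elim
      case (elim u)
      have "ind_upto (real (Suc k) / n) u - ind_upto (real k / n) u = indicator {real k / n<..real (Suc k) / n} u"
        by (rule ind_upto_increment) (auto simp: divide_right_mono)
      then show ?case using elim by (auto simp: indicator_def)
    qed
  qed (use meas in \<open>auto simp: ind_upto_def[abs_def]\<close>)
  have zero: "cell_coeff n ?f k = 0" if "j \<le> k" for k
  proof -
    have "(ind_upto (real (Suc k) / n) u - ind_upto (real k / n) u) * ?f u = 0" for u
    proof (cases "u < real j / n")
      case True
      then have "u < real k / n" using that n by (auto simp: field_simps intro: less_le_trans)
      moreover have "ind_upto (real (Suc k) / n) u - ind_upto (real k / n) u
          = indicator {real k / n<..real (Suc k) / n} u"
        by (rule ind_upto_increment) (auto simp: divide_right_mono)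
      ultimately show ?thesis by simp
    next
      case False
      then have "?f u = 0" by (intro K) auto
      then show ?thesis by simp
    qed
    then show ?thesis unfolding cell_coeff_def by (simp only: Bochner_Integration.integral_zero)
  qed
  have nn: "real n * c * (x / sqrt n) = (sqrt n * c) * x" for c x
  proof -
    have "real n / sqrt n = sqrt n" by (rule real_div_sqrt) simp
    then show ?thesis by (metis (no_types, opaque_lifting) mult.assoc mult.commute times_divide_eq_right)
  qed
  have "volterra_sum K \<xi> n j \<omega> = (\<Sum>k<j. real n * cell_coeff n ?f k * (\<xi> (Suc k) \<omega> / sqrt n))"
    unfolding volterra_sum_def
    by (simp only: coeff[symmetric] One_nat_def sum.atLeast1_atMost_eq)
  also have "\<dots> = (\<Sum>k<j. (sqrt n * cell_coeff n ?f k) * \<xi> (Suc k) \<omega>)"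
    by (simp only: nn)
  also have "\<dots> = noise_sum \<xi> n ?f \<omega>"
    unfolding noise_sum_def using j zero by (intro sum.mono_neutral_left) auto
  finally show ?thesis .
qed

lemma subfbm_approx_eq_grid_path:
  "subfbm_approx H C \<xi> n t \<omega> = grid_path n (\<lambda>j. volterra_sum (subfbm_kernel H C) \<xi> n j \<omega>) t"
proof (cases "0 \<le> \<lfloor>real n * t\<rfloor>")
  case True
  then have "real (nat \<lfloor>real n * t\<rfloor>) = real_of_int \<lfloor>real n * t\<rfloor>" by (rule of_nat_nat)
  then show ?thesis by (simp only: subfbm_approx_def grid_path_def volterra_sum_def)
qed (simp add: subfbm_approx_def grid_path_def volterra_sum_def)

section \<open>The invariance principle\<close>

lemma (in prob_space) lipschitz_grid_expectation:
  assumes f: "\<And>x y. \<bar>f x - f y\<bar> \<le> L * dist x y" "\<And>x. \<bar>f x\<bar> \<le> A" and L: "0 \<le> L"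
    and meas: "\<And>i. U i \<in> borel_measurable M" "\<And>i. V i \<in> borel_measurable M"
    and sq: "\<And>i. i \<le> m \<Longrightarrow> sq_integrable M (\<lambda>\<omega>. U i \<omega> - V i \<omega>)"
    and close: "\<And>i. i \<le> m \<Longrightarrow> sq_norm M (\<lambda>\<omega>. U i \<omega> - V i \<omega>) \<le> d\<^sup>2" and d: "0 < d"
  shows "\<bar>(\<integral>\<omega>. f (to_skorohod (grid_path m (\<lambda>i. U i \<omega>))) \<partial>M)
      - (\<integral>\<omega>. f (to_skorohod (grid_path m (\<lambda>i. V i \<omega>))) \<partial>M)\<bar> \<le> L * (real (Suc m) * (2 * d))"
proof -
  let ?F = "\<lambda>v. f (to_skorohod (grid_path m v))"
  have f_meas: "f \<in> borel_measurable borel"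
    by (rule borel_measurable_continuous_onI[OF continuous_on_lipschitz[OF f(1)]])
  have int: "integrable M (\<lambda>\<omega>. ?F (\<lambda>i. X i \<omega>))" if "\<And>i. X i \<in> borel_measurable M" for X
    by (rule integrable_const_bound[of _ A])
       (use f(2) measurable_compose[OF measurable_grid_path[of X, OF that] f_meas] in auto)
  have abs_int: "integrable M (\<lambda>\<omega>. \<bar>U i \<omega> - V i \<omega>\<bar>)" if "i \<le> m" for i
    using sq_integrable_imp_integrable[OF sq[OF that]] by simp
  have "\<bar>(\<integral>\<omega>. ?F (\<lambda>i. U i \<omega>) \<partial>M) - (\<integral>\<omega>. ?F (\<lambda>i. V i \<omega>) \<partial>M)\<bar>
    = \<bar>\<integral>\<omega>. ?F (\<lambda>i. U i \<omega>) - ?F (\<lambda>i. V i \<omega>) \<partial>M\<bar>"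
    using int[OF meas(1)] int[OF meas(2)] by simp
  also have "\<dots> \<le> (\<integral>\<omega>. \<bar>?F (\<lambda>i. U i \<omega>) - ?F (\<lambda>i. V i \<omega>)\<bar> \<partial>M)" by (rule integral_abs_bound)
  also have "\<dots> \<le> (\<integral>\<omega>. L * (\<Sum>i\<le>m. \<bar>U i \<omega> - V i \<omega>\<bar>) \<partial>M)"
  proof (rule integral_mono)
    show "integrable M (\<lambda>\<omega>. \<bar>?F (\<lambda>i. U i \<omega>) - ?F (\<lambda>i. V i \<omega>)\<bar>)"
      using int[OF meas(1)] int[OF meas(2)] by simp
    show "integrable M (\<lambda>\<omega>. L * (\<Sum>i\<le>m. \<bar>U i \<omega> - V i \<omega>\<bar>))"
      by (intro integrable_mult_right Bochner_Integration.integrable_sum abs_int) simp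
    show "\<bar>?F (\<lambda>i. U i \<omega>) - ?F (\<lambda>i. V i \<omega>)\<bar> \<le> L * (\<Sum>i\<le>m. \<bar>U i \<omega> - V i \<omega>\<bar>)" for \<omega>
      by (rule order_trans[OF f(1) mult_left_mono[OF dist_grid_path_le L]])
  qed
  also have "\<dots> = L * (\<Sum>i\<le>m. \<integral>\<omega>. \<bar>U i \<omega> - V i \<omega>\<bar> \<partial>M)"
    using abs_int by (simp add: Bochner_Integration.integral_sum)
  also have "\<dots> \<le> L * (\<Sum>i\<le>m. 2 * d)"
  proof (intro mult_left_mono sum_mono L)
    fix i assume "i \<in> {..m}"
    then have i: "i \<le> m" by simp
    have "(\<integral>\<omega>. \<bar>U i \<omega> - V i \<omega>\<bar> \<partial>M) \<le> d + sq_norm M (\<lambda>\<omega>. U i \<omega> - V i \<omega>) / d"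
      by (rule integral_abs_le_sq_norm[OF sq[OF i] d])
    also have "\<dots> \<le> d + d\<^sup>2 / d" using close[OF i] d by (intro add_left_mono divide_right_mono) auto
    also have "\<dots> = 2 * d" using d by (simp add: power2_eq_square)
    finally show "(\<integral>\<omega>. \<bar>U i \<omega> - V i \<omega>\<bar> \<partial>M) \<le> 2 * d" .
  qed
  finally show ?thesis by simp
qed

text \<open>The setting of the invariance principle for an arbitrary Volterra kernel. What matters is the
  Hoelder exponent \<open>p/2 > 1/2\<close> of \<open>t \<mapsto> K t\<close> as a map into \<open>L\<^sup>2\<close>.\<close>

locale volterra_approximation = M: prob_space M + N: prob_space N
  for M :: "'a measure" and N :: "'b measure" +
  fixes \<xi> :: "nat \<Rightarrow> 'a \<Rightarrow> real" and W X :: "real \<Rightarrow> 'b \<Rightarrow> real"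
    and K :: "real \<Rightarrow> real \<Rightarrow> real" and p :: real
  assumes indep: "M.indep_vars (\<lambda>_. borel) \<xi> {1..}"
    and ident: "\<And>k. k \<ge> 1 \<Longrightarrow> distr M borel (\<xi> k) = distr M borel (\<xi> 1)"
    and mean: "\<And>k. k \<ge> 1 \<Longrightarrow> has_bochner_integral M (\<xi> k) 0"
    and var: "\<And>k. k \<ge> 1 \<Longrightarrow> has_bochner_integral M (\<lambda>\<omega>. (\<xi> k \<omega>)\<^sup>2) 1"
    and W: "standard_brownian_motion N W"
    and X: "skorohod_random_element N X"
    and K_outside: "\<And>t u. u \<notin> {0<..<t} \<Longrightarrow> K t u = 0"
    and pair: "\<And>t. t \<in> {0..1} \<Longrightarrow> wiener_pair N W (K t) (X t)"
    and K_increment: "\<And>s t. s \<in> {0..1} \<Longrightarrow> t \<in> {0..1} \<Longrightarrow>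
      sq_norm lborel (\<lambda>u. K t u - K s u) \<le> \<bar>t - s\<bar> powr p"
    and p: "1 < p"
begin

lemma K_sq: "t \<in> {0..1} \<Longrightarrow> sq_integrable lborel (K t)"
  by (rule wiener_pairD(1)[OF pair])

lemma X_sq: "t \<in> {0..1} \<Longrightarrow> sq_integrable N (X t)"
  by (rule wiener_pairD(2)[OF pair])

abbreviation S :: "nat \<Rightarrow> nat \<Rightarrow> 'a \<Rightarrow> real" where
  "S \<equiv> volterra_sum K \<xi>"

lemma S_eq: "j \<le> n \<Longrightarrow> 0 < n \<Longrightarrow> S n j = noise_sum \<xi> n (K (real j / n))"
  using K_sq[OF ind_upto.grid_point[of j n]]
  by (intro ext volterra_sum_eq_noise_sum K_outside) (auto simp: sq_integrable_def)

lemma S_measurable: "S n j \<in> borel_measurable M"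
  unfolding volterra_sum_def[abs_def] using indep
  by (intro borel_measurable_sum borel_measurable_times borel_measurable_divide) (auto simp: M.indep_vars_def)

lemma noise_sum_close:
  assumes "sq_integrable lborel f" "sq_integrable lborel g"
  shows "sq_integrable M (\<lambda>\<omega>. noise_sum \<xi> n f \<omega> - noise_sum \<xi> n g \<omega>)"
    and "sq_norm M (\<lambda>\<omega>. noise_sum \<xi> n f \<omega> - noise_sum \<xi> n g \<omega>) \<le> sq_norm lborel (\<lambda>u. f u - g u)"
  using M.noise_sum_contraction[OF indep mean var sq_integrable_diff[OF assms], of n]
  by (simp_all add: noise_sum_diff[OF assms, abs_def])

lemma approximation_modulus:
  assumes "0 < m" "m \<le> n"
  shows "mean_square_close M (\<lambda>\<omega>. to_skorohod (grid_path n (\<lambda>j. S n j \<omega>)))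
    (\<lambda>\<omega>. to_skorohod (grid_path m (\<lambda>i. S n (i * n div m) \<omega>))) (modulus_bound p m)"
proof (rule grid_process_modulus[OF p assms])
  fix i j assume ij: "i \<le> n" "j \<le> n"
  then show "sq_integrable M (\<lambda>\<omega>. S n j \<omega> - S n i \<omega>)"
    using assms by (simp add: S_eq noise_sum_close K_sq ind_upto.grid_point)
next
  fix i j assume ij: "i \<le> j" "j \<le> n"
  then have g: "real i / n \<in> {0..1}" "real j / n \<in> {0..1}" by (intro ind_upto.grid_point; simp)+
  have "sq_norm M (\<lambda>\<omega>. S n j \<omega> - S n i \<omega>) \<le> sq_norm lborel (\<lambda>u. K (real j / n) u - K (real i / n) u)"
    using assms ij by (simp add: S_eq noise_sum_close K_sq g)
  also have "\<dots> \<le> \<bar>real j / n - real i / n\<bar> powr p" by (rule K_increment[OF g])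
  also have "\<bar>real j / n - real i / n\<bar> = real (j - i) / n"
    using ij by (simp add: diff_divide_distrib[symmetric] of_nat_diff)
  finally show "sq_norm M (\<lambda>\<omega>. S n j \<omega> - S n i \<omega>) \<le> (real (j - i) / n) powr p" .
qed

lemma limit_modulus:
  assumes "0 < m"
  shows "mean_square_close N (sample_path X)
    (\<lambda>\<omega>. to_skorohod (grid_path m (\<lambda>i. X (real i / m) \<omega>))) (modulus_bound p m)"
proof (rule cadlag_process_modulus[OF p assms])
  show "cadlag (\<lambda>t. X t \<omega>)" if "\<omega> \<in> space N" for \<omega>
    using X that by (simp add: skorohod_random_element_def)
next
  fix s t :: real assume st: "s \<in> {0..1}" "t \<in> {0..1}"
  show "sq_integrable N (\<lambda>\<omega>. X t \<omega> - X s \<omega>)" by (intro sq_integrable_diff X_sq st)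
  have "sq_norm N (\<lambda>\<omega>. X t \<omega> - X s \<omega>) = sq_norm lborel (\<lambda>u. K t u - K s u)"
    using wiener_pair_isometry[OF brownian_unit_increments[OF N.prob_space_axioms W]
        wiener_pair_lincomb[OF brownian_unit_increments[OF N.prob_space_axioms W] pair[OF st(2)] pair[OF st(1)], of 1 "-1"]]
    by simp
  also have "\<dots> \<le> \<bar>t - s\<bar> powr p" by (rule K_increment[OF st])
  finally show "sq_norm N (\<lambda>\<omega>. X t \<omega> - X s \<omega>) \<le> \<bar>t - s\<bar> powr p" .
qed

text \<open>Besides the error \<open>e\<close> of the step function on the grid of mesh \<open>1/q\<close>, there are the error of moving
  the kernel from time \<open>t\<close> to the grid time \<open>s\<close> and that of rounding the step function to the grid of mesh
  \<open>1/n\<close>. Both vanish as \<open>n\<close> grows.\<close>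

lemma noise_sum_block_close:
  assumes t: "t \<in> {0..1}" "s \<in> {0..1}" and q: "0 < q" "0 < n"
    and e: "sq_norm lborel (\<lambda>u. grid_sum ind_upto q b u - K t u) \<le> e"
  shows "sq_integrable M (\<lambda>\<omega>. noise_sum \<xi> n (K s) \<omega> - (\<Sum>j<q. b j * ((\<Sum>k\<in>block q n j. \<xi> k \<omega>) / sqrt n)))"
    and "sq_norm M (\<lambda>\<omega>. noise_sum \<xi> n (K s) \<omega> - (\<Sum>j<q. b j * ((\<Sum>k\<in>block q n j. \<xi> k \<omega>) / sqrt n)))
      \<le> 2 * \<bar>s - t\<bar> powr p + 4 * e + 4 * (q * (\<Sum>i<q. (b i)\<^sup>2 * 4) / n)"
proof -
  let ?s = "grid_sum ind_upto q b"
  let ?sn = "grid_sum ind_upto n (\<lambda>k. ?s (real (Suc k) / n))"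
  have sq: "sq_integrable lborel ?s" "sq_integrable lborel ?sn" "sq_integrable lborel (K s)" "sq_integrable lborel (K t)"
    by (rule ind_upto.sq_integrable_grid_sum K_sq t)+
  note close = noise_sum_close[OF sq(3,2), of n, unfolded noise_sum_block[OF q]]
  show "sq_integrable M (\<lambda>\<omega>. noise_sum \<xi> n (K s) \<omega> - (\<Sum>j<q. b j * ((\<Sum>k\<in>block q n j. \<xi> k \<omega>) / sqrt n)))"
    by (rule close(1))
  let ?pt = "\<lambda>j :: nat. real j / q"
  have pt: "mono_on {..q} ?pt" "?pt ` {..q} \<subseteq> {0..1}"
    by (auto simp: mono_on_def divide_right_mono divide_le_eq_1)
  have s_step: "step_integral ind_upto q ?pt b = ?s" by (simp add: fun_eq_iff step_integral_def grid_sum_def)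
  have "sq_norm lborel (\<lambda>u. ?sn u - ?s u) \<le> q * (\<Sum>i<q. (b i)\<^sup>2 * 4) / n"
    using ind_upto.sq_norm_grid_sum_step_integral[OF pt q(2), of b]
    unfolding step_integral_ind_upto[OF pt, symmetric] s_step .
  moreover have "sq_norm lborel (\<lambda>u. K t u - ?s u) \<le> e"
    using e by (simp add: sq_norm_minus_commute)
  moreover have "sq_norm lborel (\<lambda>u. ?s u - ?sn u) = sq_norm lborel (\<lambda>u. ?sn u - ?s u)"
    by (rule sq_norm_minus_commute)
  moreover have "sq_norm lborel (\<lambda>u. K s u - K t u) \<le> \<bar>s - t\<bar> powr p" by (rule K_increment[OF t])
  ultimately show "sq_norm M (\<lambda>\<omega>. noise_sum \<xi> n (K s) \<omega> - (\<Sum>j<q. b j * ((\<Sum>k\<in>block q n j. \<xi> k \<omega>) / sqrt n)))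
      \<le> 2 * \<bar>s - t\<bar> powr p + 4 * e + 4 * (q * (\<Sum>i<q. (b i)\<^sup>2 * 4) / n)"
    using close(2) sq_norm_triangle[OF sq(3) sq(4) sq(2)] sq_norm_triangle[OF sq(4) sq(1) sq(2)]
    by linarith
qed

text \<open>The same coefficients \<open>b\<close> approximate the kernels, hence both the values of the approximation, through the
  contraction property of \<open>noise_sum\<close>, and those of the limit, through the definition of
  \<open>wiener_pair\<close>.\<close>

lemma finite_dimensional_convergence:
  assumes m: "0 < m" and f: "\<And>x y. \<bar>f x - f y\<bar> \<le> L * dist x y" "\<And>x. \<bar>f x\<bar> \<le> A" and L: "0 \<le> L"
  shows "(\<lambda>n. \<integral>\<omega>. f (to_skorohod (grid_path m (\<lambda>i. S n (i * n div m) \<omega>))) \<partial>M)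
    \<longlonglongrightarrow> (\<integral>\<omega>. f (to_skorohod (grid_path m (\<lambda>i. X (real i / m) \<omega>))) \<partial>N)"
proof (rule tendstoI)
  fix e :: real assume e: "0 < e"
  interpret W: unit_increments N W by (rule brownian_unit_increments[OF N.prob_space_axioms W])
  let ?F = "\<lambda>v. f (to_skorohod (grid_path m v))"
  \<comment> \<open>the minimum keeps all times in \<open>[0,1]\<close>; a step path over \<open>m\<close> cells reads only the indices up to \<open>m\<close>\<close>
  let ?t = "\<lambda>i. real (min i m) / m"
  have t: "?t i \<in> {0..1}" for i by (rule ind_upto.grid_point) simp
  have f_meas: "f \<in> borel_measurable borel"
    by (rule borel_measurable_continuous_onI[OF continuous_on_lipschitz[OF f(1)]])
  \<comment> \<open>mean square errors at most \<open>d\<^sup>2\<close> in all \<open>m + 1\<close> coordinates then cost at most \<open>e/4\<close>\<close>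
  define d where "d = e / (8 * (L + 1) * real (Suc m))"
  have pos: "0 < 8 * (L + 1) * real (Suc m)" using L by (intro mult_pos_pos) auto
  have d: "0 < d" using e pos by (simp add: d_def)
  have small: "L * (real (Suc m) * (2 * d)) \<le> e / 4"
  proof -
    have "L * (real (Suc m) * (2 * d)) \<le> (L + 1) * (real (Suc m) * (2 * d))"
      using d by (intro mult_right_mono) auto
    also have "\<dots> = (8 * (L + 1) * real (Suc m)) * d / 4" by simp
    also have "(8 * (L + 1) * real (Suc m)) * d = e"
      unfolding d_def times_divide_eq_right
      by (rule nonzero_mult_div_cancel_left) (rule less_imp_neq[OF pos, symmetric])
    finally show ?thesis .
  qed
  have "\<forall>\<^sub>F q in sequentially. \<forall>i\<in>{..m}. \<exists>b.
      sq_norm lborel (\<lambda>u. grid_sum ind_upto q b u - K (?t i) u) < d\<^sup>2 / 16 \<and>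
      sq_norm N (\<lambda>\<omega>. grid_sum W q b \<omega> - X (?t i) \<omega>) < d\<^sup>2 / 16"
    using d by (intro eventually_ball_finite ballI wiener_pairD(3) pair t) auto
  then have "\<forall>\<^sub>F q in sequentially. 0 < q \<and> (\<forall>i\<in>{..m}. \<exists>b.
      sq_norm lborel (\<lambda>u. grid_sum ind_upto q b u - K (?t i) u) < d\<^sup>2 / 16 \<and>
      sq_norm N (\<lambda>\<omega>. grid_sum W q b \<omega> - X (?t i) \<omega>) < d\<^sup>2 / 16)"
    by (intro eventually_conj eventually_gt_at_top)
  from eventually_happens'[OF sequentially_bot this] obtain q where q: "0 < q"
    and ex_b: "\<forall>i\<in>{..m}. \<exists>b.
      sq_norm lborel (\<lambda>u. grid_sum ind_upto q b u - K (?t i) u) < d\<^sup>2 / 16 \<and>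
      sq_norm N (\<lambda>\<omega>. grid_sum W q b \<omega> - X (?t i) \<omega>) < d\<^sup>2 / 16" by blast
  obtain b where "\<forall>i\<in>{..m}.
      sq_norm lborel (\<lambda>u. grid_sum ind_upto q (b i) u - K (?t i) u) < d\<^sup>2 / 16 \<and>
      sq_norm N (\<lambda>\<omega>. grid_sum W q (b i) \<omega> - X (?t i) \<omega>) < d\<^sup>2 / 16"
    by (rule exE[OF bchoice[OF ex_b]])
  then have b:
      "\<And>i. i \<le> m \<Longrightarrow> sq_norm lborel (\<lambda>u. grid_sum ind_upto q (b i) u - K (?t i) u) < d\<^sup>2 / 16"
      "\<And>i. i \<le> m \<Longrightarrow> sq_norm N (\<lambda>\<omega>. grid_sum W q (b i) \<omega> - X (?t i) \<omega>) < d\<^sup>2 / 16"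
    by (simp_all only: atMost_iff)
  define g where "g v = ?F (\<lambda>i. \<Sum>j<q. b i j * v j)" for v
  let ?B = "\<lambda>n i \<omega>. \<Sum>j<q. b i j * ((\<Sum>k\<in>block q n j. \<xi> k \<omega>) / sqrt n)"
  have g_lim: "(\<lambda>n. \<integral>\<omega>. g (\<lambda>j. (\<Sum>k\<in>block q n j. \<xi> k \<omega>) / sqrt n) \<partial>M)
    \<longlonglongrightarrow> (\<integral>\<omega>. g (\<lambda>j. W (real (Suc j) / q) \<omega> - W (real j / q) \<omega>) \<partial>N)"
  proof (rule block_sums_converge[OF M.prob_space_axioms indep ident mean var N.prob_space_axioms W q])
    have "(\<lambda>v. \<Sum>j<q. b i j * v j) \<in> borel_measurable (Pi\<^sub>M {..<q} (\<lambda>_. borel))" for i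
      by (intro borel_measurable_sum borel_measurable_times measurable_component_singleton) auto
    from measurable_compose[OF measurable_grid_path[of "\<lambda>i v. \<Sum>j<q. b i j * v j", OF this] f_meas]
    show "g \<in> borel_measurable (Pi\<^sub>M {..<q} (\<lambda>_. borel))" by (simp add: g_def[abs_def])
    show "\<bar>g v\<bar> \<le> A" for v unfolding g_def by (rule f(2))
    fix x :: "nat \<Rightarrow> nat \<Rightarrow> real" and y assume lim: "\<And>j. j < q \<Longrightarrow> (\<lambda>n. x n j) \<longlonglongrightarrow> y j"
    have "(\<lambda>n. L * (\<Sum>i\<le>m. \<bar>(\<Sum>j<q. b i j * x n j) - (\<Sum>j<q. b i j * y j)\<bar>))
      \<longlonglongrightarrow> L * (\<Sum>i\<le>m. \<bar>(\<Sum>j<q. b i j * y j) - (\<Sum>j<q. b i j * y j)\<bar>)"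
      by (intro tendsto_intros lim) auto
    then have "(\<lambda>n. L * (\<Sum>i\<le>m. \<bar>(\<Sum>j<q. b i j * x n j) - (\<Sum>j<q. b i j * y j)\<bar>)) \<longlonglongrightarrow> 0" by simp
    moreover have "norm (g (x n) - g y) \<le> L * (\<Sum>i\<le>m. \<bar>(\<Sum>j<q. b i j * x n j) - (\<Sum>j<q. b i j * y j)\<bar>)" for n
      unfolding g_def real_norm_def by (rule order_trans[OF f(1) mult_left_mono[OF dist_grid_path_le L]])
    ultimately have "(\<lambda>n. g (x n) - g y) \<longlonglongrightarrow> 0"
      by (rule Lim_null_comparison[OF always_eventually[OF allI], rotated])
    then show "(\<lambda>n. g (x n)) \<longlonglongrightarrow> g y" by (rule LIM_zero_cancel)
  qed
  have g_W: "g (\<lambda>j. W (real (Suc j) / q) \<omega> - W (real j / q) \<omega>) = ?F (\<lambda>i. grid_sum W q (b i) \<omega>)" for \<omega>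
    by (simp add: g_def grid_sum_def)
  have limit_close: "\<bar>(\<integral>\<omega>. ?F (\<lambda>i. grid_sum W q (b i) \<omega>) \<partial>N) - (\<integral>\<omega>. ?F (\<lambda>i. X (?t i) \<omega>) \<partial>N)\<bar> \<le> e / 4"
  proof (rule order_trans[OF N.lipschitz_grid_expectation[where d=d, OF f L] small])
    fix i
    show "grid_sum W q (b i) \<in> borel_measurable N" "X (?t i) \<in> borel_measurable N"
      using W.sq_integrable_grid_sum X_sq[OF t] by (auto simp: sq_integrable_def)
    show "sq_integrable N (\<lambda>\<omega>. grid_sum W q (b i) \<omega> - X (?t i) \<omega>)"
      by (intro sq_integrable_diff W.sq_integrable_grid_sum X_sq t)
    assume i: "i \<le> m"
    have "d\<^sup>2 / 16 \<le> d\<^sup>2" by simp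
    with b(2)[OF i] show "sq_norm N (\<lambda>\<omega>. grid_sum W q (b i) \<omega> - X (?t i) \<omega>) \<le> d\<^sup>2" by linarith
  qed (rule d)
  have X_t: "(\<integral>\<omega>. ?F (\<lambda>i. X (?t i) \<omega>) \<partial>N) = (\<integral>\<omega>. ?F (\<lambda>i. X (real i / m) \<omega>) \<partial>N)"
  proof -
    have "dist (to_skorohod (grid_path m (\<lambda>i. X (?t i) \<omega>))) (to_skorohod (grid_path m (\<lambda>i. X (real i / m) \<omega>))) \<le> 0" for \<omega>
      using dist_grid_path_le[of m "\<lambda>i. X (?t i) \<omega>" "\<lambda>i. X (real i / m) \<omega>"] by simp
    then show ?thesis by simp
  qed
  let ?s = "\<lambda>n i. real (i * n div m) / n"
  have err: "\<forall>\<^sub>F n in sequentially. 2 * \<bar>?s n i - ?t i\<bar> powr p + 4 * (d\<^sup>2 / 16)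
      + 4 * (q * (\<Sum>j<q. (b i j)\<^sup>2 * 4) / n) < d\<^sup>2" if i: "i \<le> m" for i
  proof -
    have "(\<lambda>n. ?s n i) \<longlonglongrightarrow> ?t i"
      using div_ratio_tendsto[OF m, of i] i by (simp add: mult.commute)
    then have "(\<lambda>n. \<bar>?s n i - ?t i\<bar>) \<longlonglongrightarrow> 0"
      by (intro tendsto_rabs_zero) (simp add: LIM_zero_iff)
    then have "(\<lambda>n. \<bar>?s n i - ?t i\<bar> powr p) \<longlonglongrightarrow> 0"
      by (rule tendsto_zero_powrI[where b=p]) (use p in auto)
    then have "(\<lambda>n. 2 * \<bar>?s n i - ?t i\<bar> powr p + 4 * (d\<^sup>2 / 16) + 4 * (q * (\<Sum>j<q. (b i j)\<^sup>2 * 4) / n))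
      \<longlonglongrightarrow> 2 * 0 + 4 * (d\<^sup>2 / 16) + 4 * 0"
      by (intro tendsto_intros lim_const_over_n)
    then show ?thesis by (rule order_tendstoD) (use d in simp)
  qed
  have "\<forall>\<^sub>F n in sequentially. \<forall>i\<in>{..m}. 2 * \<bar>?s n i - ?t i\<bar> powr p + 4 * (d\<^sup>2 / 16)
      + 4 * (q * (\<Sum>j<q. (b i j)\<^sup>2 * 4) / n) < d\<^sup>2"
    using err by (intro eventually_ball_finite) auto
  moreover have "\<forall>\<^sub>F n in sequentially.
      dist (\<integral>\<omega>. g (\<lambda>j. (\<Sum>k\<in>block q n j. \<xi> k \<omega>) / sqrt n) \<partial>M)
        (\<integral>\<omega>. g (\<lambda>j. W (real (Suc j) / q) \<omega> - W (real j / q) \<omega>) \<partial>N) < e / 4"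
    by (rule tendstoD[OF g_lim]) (use e in simp)
  ultimately show "\<forall>\<^sub>F n in sequentially.
      dist (\<integral>\<omega>. ?F (\<lambda>i. S n (i * n div m) \<omega>) \<partial>M) (\<integral>\<omega>. ?F (\<lambda>i. X (real i / m) \<omega>) \<partial>N) < e"
    using eventually_gt_at_top[of 0]
  proof eventually_elim
    case (elim n)
    have n: "0 < n" by (rule elim(3))
    have B_meas: "?B n i \<in> borel_measurable M" for i
      using indep block_subset[of q n]
      by (intro borel_measurable_sum borel_measurable_times borel_measurable_divide)
         (auto simp: M.indep_vars_def)
    have "\<bar>(\<integral>\<omega>. ?F (\<lambda>i. S n (i * n div m) \<omega>) \<partial>M) - (\<integral>\<omega>. ?F (\<lambda>i. ?B n i \<omega>) \<partial>M)\<bar> \<le> e / 4"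
    proof (rule order_trans[OF M.lipschitz_grid_expectation[where d=d, OF f L S_measurable B_meas] small])
      fix i assume i: "i \<le> m"
      have in_le: "i * n div m \<le> n" using i m by (metis div_le_mono mult_le_mono1 nonzero_mult_div_cancel_left neq0_conv)
      have s1: "?s n i \<in> {0..1}" by (rule ind_upto.grid_point[OF in_le])
      note close = noise_sum_block_close[OF t s1 q n less_imp_le[OF b(1)[OF i]]]
      show "sq_integrable M (\<lambda>\<omega>. S n (i * n div m) \<omega> - ?B n i \<omega>)"
        unfolding S_eq[OF in_le n] by (rule close(1))
      show "sq_norm M (\<lambda>\<omega>. S n (i * n div m) \<omega> - ?B n i \<omega>) \<le> d\<^sup>2"
        unfolding S_eq[OF in_le n] by (rule order_trans[OF close(2) less_imp_le[OF bspec[OF elim(1)]]]) (use i in simp)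
    qed (rule d)
    moreover have "\<bar>(\<integral>\<omega>. ?F (\<lambda>i. ?B n i \<omega>) \<partial>M) - (\<integral>\<omega>. ?F (\<lambda>i. grid_sum W q (b i) \<omega>) \<partial>N)\<bar> < e / 4"
      using elim(2) unfolding g_W by (simp only: g_def dist_real_def)
    ultimately show ?case
      using limit_close e unfolding X_t dist_real_def by linarith
  qed
qed

theorem volterra_invariance_principle:
  "converges_in_law_skorohod M (\<lambda>n t \<omega>. grid_path n (\<lambda>j. S n j \<omega>) t) N X"
proof -
  let ?X = "\<lambda>n t \<omega>. grid_path n (\<lambda>j. S n j \<omega>) t"
  have path: "sample_path (?X n) = (\<lambda>\<omega>. to_skorohod (grid_path n (\<lambda>j. S n j \<omega>)))" for n
    by (simp add: fun_eq_iff sample_path_def)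
  have Xn_meas: "sample_path (?X n) \<in> borel_measurable M" for n
    unfolding path by (rule measurable_grid_path[OF S_measurable])
  have X_meas: "sample_path X \<in> borel_measurable N" using X by (simp add: skorohod_random_element_def)
  have "weakly_converges (\<lambda>n. distr M borel (sample_path (?X n))) (distr N borel (sample_path X))"
  proof (rule weakly_converges_if_lipschitz)
    show "prob_space (distr M borel (sample_path (?X n)))" for n by (rule M.prob_space_distr[OF Xn_meas])
    show "prob_space (distr N borel (sample_path X))" by (rule N.prob_space_distr[OF X_meas])
    fix f :: "skorohod \<Rightarrow> real" and L' A assume L': "\<And>x y. \<bar>f x - f y\<bar> \<le> L' * dist x y" and A: "\<And>x. \<bar>f x\<bar> \<le> A"
    define L where "L = \<bar>L'\<bar>"
    have L: "0 \<le> L" by (simp add: L_def)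
    have f: "\<bar>f x - f y\<bar> \<le> L * dist x y" for x y
      by (rule order_trans[OF L']) (simp add: L_def mult_right_mono)
    have f_meas: "f \<in> borel_measurable borel"
      by (rule borel_measurable_continuous_onI[OF continuous_on_lipschitz[OF f]])
    have "(\<lambda>n. \<integral>\<omega>. f (sample_path (?X n) \<omega>) \<partial>M) \<longlonglongrightarrow> (\<integral>\<omega>. f (sample_path X \<omega>) \<partial>N)"
    proof (rule tendstoI)
      fix e :: real assume e: "0 < e"
      \<comment> \<open>passing to the coarse grid costs less than \<open>2 d\<close> on either side, the comparison on the grid less than \<open>d\<close>\<close>
      define d where "d = e / 6"
      have d: "0 < d" using e by (simp add: d_def)
      have "(\<lambda>m. L\<^sup>2 * modulus_bound p m / d) \<longlonglongrightarrow> L\<^sup>2 * 0 / d"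
        using d by (intro tendsto_intros modulus_bound_tendsto_0 p) auto
      then have "\<forall>\<^sub>F m in sequentially. L\<^sup>2 * modulus_bound p m / d < d"
        by (rule order_tendstoD) (use d in simp)
      then have "\<forall>\<^sub>F m in sequentially. 0 < m \<and> L\<^sup>2 * modulus_bound p m / d < d"
        by (intro eventually_conj eventually_gt_at_top)
      from eventually_happens'[OF sequentially_bot this]
      obtain m where m: "0 < m" "L\<^sup>2 * modulus_bound p m / d < d" by blast
      let ?Xm = "\<lambda>\<omega>. to_skorohod (grid_path m (\<lambda>i. X (real i / m) \<omega>))"
      let ?Sm = "\<lambda>n \<omega>. to_skorohod (grid_path m (\<lambda>i. S n (i * n div m) \<omega>))"
      have "\<bar>(\<integral>\<omega>. f (sample_path X \<omega>) \<partial>N) - (\<integral>\<omega>. f (?Xm \<omega>) \<partial>N)\<bar> \<le> d + L\<^sup>2 * modulus_bound p m / d"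
      proof (rule N.mean_square_close_expectation[OF limit_modulus[OF m(1)] X_meas _ f A d modulus_bound_nonneg])
        have eq: "?Xm = (\<lambda>\<omega>. to_skorohod (grid_path m (\<lambda>i. X (real (min i m) / m) \<omega>)))"
        proof
          fix \<omega>
          have "dist (?Xm \<omega>) (to_skorohod (grid_path m (\<lambda>i. X (real (min i m) / m) \<omega>))) \<le> 0"
            using dist_grid_path_le[of m "\<lambda>i. X (real i / m) \<omega>" "\<lambda>i. X (real (min i m) / m) \<omega>"] by simp
          then show "?Xm \<omega> = to_skorohod (grid_path m (\<lambda>i. X (real (min i m) / m) \<omega>))" by simp
        qed
        show "?Xm \<in> borel_measurable N"
          unfolding eq
          by (intro measurable_grid_path sq_integrableD(1)[OF X_sq] ind_upto.grid_point) simp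
      qed
      then have X_close: "\<bar>(\<integral>\<omega>. f (sample_path X \<omega>) \<partial>N) - (\<integral>\<omega>. f (?Xm \<omega>) \<partial>N)\<bar> < 2 * d"
        using m(2) by linarith
      have "\<forall>\<^sub>F n in sequentially. dist (\<integral>\<omega>. f (?Sm n \<omega>) \<partial>M) (\<integral>\<omega>. f (?Xm \<omega>) \<partial>N) < d"
        by (rule tendstoD[OF finite_dimensional_convergence[OF m(1) f A L] d])
      then show "\<forall>\<^sub>F n in sequentially.
          dist (\<integral>\<omega>. f (sample_path (?X n) \<omega>) \<partial>M) (\<integral>\<omega>. f (sample_path X \<omega>) \<partial>N) < e"
        using eventually_ge_at_top[of m]
      proof eventually_elim
        case (elim n)
        have "\<bar>(\<integral>\<omega>. f (sample_path (?X n) \<omega>) \<partial>M) - (\<integral>\<omega>. f (?Sm n \<omega>) \<partial>M)\<bar> \<le> d + L\<^sup>2 * modulus_bound p m / d"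
          unfolding path
          by (rule M.mean_square_close_expectation[OF approximation_modulus[OF m(1) elim(2)]
                measurable_grid_path[OF S_measurable] measurable_grid_path[OF S_measurable] f A d modulus_bound_nonneg])
        then show ?case
          using elim(1) X_close m(2) d_def unfolding dist_real_def by linarith
      qed
    qed
    then show "(\<lambda>n. integral\<^sup>L (distr M borel (sample_path (?X n))) f) \<longlonglongrightarrow> integral\<^sup>L (distr N borel (sample_path X)) f"
      by (simp only: integral_distr[OF Xn_meas f_meas] integral_distr[OF X_meas f_meas])
  qed simp_all
  moreover have "skorohod_random_element M (?X n)" for n
    using Xn_meas[of n] cadlag_grid_path by (simp add: skorohod_random_element_def)
  ultimately show ?thesis using X by (simp add: converges_in_law_skorohod_def)
qed

end

theorem theorem2p1:
  fixes H C :: real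
    and M :: "'a measure" and \<xi> :: "nat \<Rightarrow> 'a \<Rightarrow> real"
    and N :: "'b measure" and W X :: "real \<Rightarrow> 'b \<Rightarrow> real"
  assumes H: "1/2 < H" "H < 1"
    and C: "subfbm_normalizing H C"
    and M: "prob_space M"
    and indep: "prob_space.indep_vars M (\<lambda>_. borel) \<xi> {1..}"
    and ident: "\<And>k. k \<ge> 1 \<Longrightarrow> distr M borel (\<xi> k) = distr M borel (\<xi> 1)"
    and mean: "\<And>k. k \<ge> 1 \<Longrightarrow> has_bochner_integral M (\<xi> k) 0"
    and var: "\<And>k. k \<ge> 1 \<Longrightarrow> has_bochner_integral M (\<lambda>\<omega>. (\<xi> k \<omega>)\<^sup>2) 1"
    and N: "prob_space N"
    and W: "standard_brownian_motion N W"
    and X: "skorohod_random_element N X"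
    and X_eq: "\<And>t. t \<in> {0..1} \<Longrightarrow> has_wiener_integral N W t (subfbm_kernel H C t) (X t)"
  shows "subfractional_brownian_motion N H X \<and>
    converges_in_law_skorohod M (subfbm_approx H C \<xi>) N X"
proof
  interpret M: prob_space M by (rule M)
  interpret N: prob_space N by (rule N)
  let ?K = "subfbm_kernel H C"
  have pair: "wiener_pair N W (?K t) (X t)" if "t \<in> {0..1}" for t
    using that
    by (intro has_wiener_integral_imp_wiener_pair[OF brownian_unit_increments[OF N W] _ X_eq])
       (auto intro!: subfbm_kernel_outside)
  show "subfractional_brownian_motion N H X"
    by (rule subfbm_wiener_integral_is_subfbm[OF C N W pair])
  interpret volterra_approximation M N \<xi> W X ?K "2 * H"
  proof
    show "sq_norm lborel (\<lambda>u. ?K t u - ?K s u) \<le> \<bar>t - s\<bar> powr (2 * H)" if "s \<in> {0..1}" "t \<in> {0..1}" for s t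
      using subfbm_kernel_increment[OF C _ that wiener_pairD(1)[OF pair[OF that(1)]] wiener_pairD(1)[OF pair[OF that(2)]]] H
      by simp
    show "1 < 2 * H" using H by simp
  qed (fact indep ident mean var W X subfbm_kernel_outside pair)+
  have "subfbm_approx H C \<xi> = (\<lambda>n t \<omega>. grid_path n (\<lambda>j. volterra_sum ?K \<xi> n j \<omega>) t)"
    by (intro ext subfbm_approx_eq_grid_path)
  then show "converges_in_law_skorohod M (subfbm_approx H C \<xi>) N X"
    using volterra_invariance_principle by simp
qed

end
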